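(* Suppose that the matrices $A,A_z$ have no eigenvalues of the form $-\bar k^2\pi^2$, for $\bar k\in\mathbb N$. Consider the plant $$\dot X=AX+Bu_x(0,t),\quad u_t=qu_{xx},\quad u(0,t)=C_XX(t),\quad u(1,t)=C_zZ(t),\quad \dot Z=A_zZ+B_zU(t),$$ and the observer $$\dot{\hat X}=A\hat X+Bu_x(0,t)+P_0\big(u_x(0,t)-\hat u_x(0,t)\big),\qquad \hat u_t=q\hat u_{xx}+p_1(x)\big(u_x(0,t)-\hat u_x(0,t)\big),$$ $$\hat u(0,t)=C_X\hat X(t),\quad \hat u(1,t)=C_z\hat Z(t),\qquad \dot{\hat Z}=A_z\hat Z+B_zU(t)+P_2\big(u_x(0,t)-\hat u_x(0,t)\big),$$ $(x,t)\in[0,1]\times[0,\infty)$, with data and gains as in the context, and the resulting observer error system for $\tilde u=u-\hat u$, $\tilde X=X-\hat X$, $\tilde Z=Z-\hat Z$, $$\dot{\tilde X}=A\tilde X-P_0\tilde u_x(0,t),\quad \tilde u_t=q\tilde u_{xx}-p_1(x)\tilde u_x(0,t),\quad \tilde u(0,t)=C_X\tilde X,\quad \tilde u(1,t)=C_z\tilde Z,\quad \dot{\tilde Z}=A_z\tilde Z-P_2\tilde u_x(0,t),$$ with initial values $\hat u(x,0)\in H^{2m}(0,1)$ and $u(x,0)\in H^{2m}(0,1)$. Then there exist constants $\Upsilon_e>0$ and $\lambda_e>0$ such that $$\Theta_e(t)\le\Upsilon_e\Big(\Theta_e(0)^2+\tilde u_x(0,0)^2\Big)^{1/2}e^{-\lambda_et},\qquad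 \Theta_e(t)=\Big(\sum_{i=0}^{2m}\|\partial_x^i\tilde u(\cdot,t)\|^2+|\tilde Z(t)|^2+|\tilde X(t)|^2\Big)^{1/2},$$ where $\|\cdot\|$ is the $L^2(0,1)$ norm and $|\cdot|$ the Euclidean norm.
   Context: **Plant data.** $n,m$ are positive integers; $X(t)\in\mathbb R^n$, $Z(t)\in\mathbb R^m$ are ODE states, $u(x,t)\in\mathbb R$ is the PDE state. $A\in\mathbb R^{n\times n}$, $B\in\mathbb R^{n\times1}$ with $(A,B)$ controllable; $C_X\in\mathbb R^{1\times n}$ and $q\in\mathbb R$ are arbitrary. $A_z\in\mathbb R^{m\times m}$ is the companion matrix with ones on the superdiagonal, last row $(\bar a_1,\dots,\bar a_m)$ (arbitrary constants) and zeros elsewhere; $B_z=[0,\dots,0,1]^T\in\mathbb R^{m\times1}$, $C_z=[1,0,\dots,0]\in\mathbb R^{1\times m}$. $U(t)$ is the scalar control input. $H^{2m}(0,1)$ is the space of $u$ with $u,u_x,\dots,\partial_x^{2m}u\in L^2(0,1)$. **Observer gains.** With $I$ the identity matrix of appropriate dimension, let $F=\begin{pmatrix}0&\frac{A_z}{q}\\ I&0\end{pmatrix}$, $F_1=\begin{pmatrix}0&\frac{A}{q}\\ I&0\end{pmatrix}$, $G=[0,I]e^F[I,0]^T$, $G_1=[0,I]e^{F_1}[I,0]^T$ (taken to be nonsingular by virtue of the eigenvalue assumption), and $$\vartheta(x)=[0,\,-C_zG^{-1}]e^{Fx}\begin{bmatrix}I\\0\end{bmatrix},\qquad \theta(x)=\Big[-C_X,\;C_X[I\;\;0]e^{F_1}\begin{bmatrix}I\\0\end{bmatrix}G_1^{-1}\Big]e^{F_1x}\begin{bmatrix}I\\0\end{bmatrix},$$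 the row-vector solutions of $\vartheta A_z-q\vartheta''=0$, $\vartheta(0)=0$, $\vartheta(1)=-C_z$ and $\theta A-q\theta''=0$, $\theta(0)=-C_X$, $\theta(1)=0$. Let $A_a=\begin{pmatrix}A_z&0\\0&A\end{pmatrix}$ and let $B_a=[\vartheta'(0),\theta'(0)]$ (a row vector). The pair $(A_a,B_a)$ ($B_a$ as output matrix) is supposed observable; $P_2\in\mathbb R^m$, $P_0\in\mathbb R^n$ are chosen so that $A_a+\begin{bmatrix}P_2\\P_0\end{bmatrix}B_a$ is Hurwitz, and $p_1(x)=-\vartheta(x)P_2-\theta(x)P_0$.
   Formalization: q>0 is assumed (q=0 leaves A/q undefined; for q<0 the error has a growing mode, so the bound fails), and u, û are taken continuous in time with values in H^{2m}(0,1) up to t=0 (for m≥2, error data incompatible with the boundary conditions make Θ_e blow up as t→0+). *)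

theory Defs
  imports "HOL-Analysis.Analysis"
begin

section \<open>Linear systems\<close>

text \<open>Row vectors and column vectors are both of type \<^typ>\<open>real^'n\<close>; a row vector acts on
  states through the inner product and on matrices through \<open>v*\<close>.\<close>

definition controllable :: "real^'n^'n \<Rightarrow> real^'n \<Rightarrow> bool" where
  "controllable A B \<longleftrightarrow>
     (\<forall>x0 x1. \<exists>T>0. \<exists>U x. continuous_on {0..T} U
        \<and> (\<forall>t\<in>{0..T}. (x has_vector_derivative (A *v x t + U t *\<^sub>R B)) (at t within {0..T}))
        \<and> x 0 = x0 \<and> x T = x1)"

definition observable :: "real^'n^'n \<Rightarrow> real^'n \<Rightarrow> bool" where
  "observable A c \<longleftrightarrow>
     (\<exists>T>0. \<forall>x y.
        (\<forall>t\<in>{0..T}. (x has_vector_derivative (A *v x t)) (at t within {0..T})) \<and>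
        (\<forall>t\<in>{0..T}. (y has_vector_derivative (A *v y t)) (at t within {0..T})) \<and>
        (\<forall>t\<in>{0..T}. c \<bullet> x t = c \<bullet> y t) \<longrightarrow> x 0 = y 0)"

definition eigenvalue :: "real^'n^'n \<Rightarrow> complex \<Rightarrow> bool" where
  "eigenvalue M l \<longleftrightarrow> (\<exists>v. v \<noteq> 0 \<and> map_matrix complex_of_real M *v v = l *s v)"

definition hurwitz :: "real^'n^'n \<Rightarrow> bool" where
  "hurwitz M \<longleftrightarrow> (\<forall>l. eigenvalue M l \<longrightarrow> Re l < 0)"

text \<open>The type \<^typ>\<open>real^'n^'n\<close> is not an instance of the class on which \<^const>\<open>exp\<close> lives, and the
  type-class power on it would be componentwise.\<close>

definition matpow :: "real^'n^'n \<Rightarrow> nat \<Rightarrow> real^'n^'n" where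
  "matpow M k = ((\<lambda>N. M ** N) ^^ k) (mat 1)"

definition mexp :: "real^'n^'n \<Rightarrow> real^'n^'n" where
  "mexp M = (\<Sum>k. (1 / fact k) *\<^sub>R matpow M k)"

section \<open>Block matrices, indexed by sum types\<close>

definition block_mat ::
  "real^'c^'a \<Rightarrow> real^'d^'a \<Rightarrow> real^'c^'b \<Rightarrow> real^'d^'b \<Rightarrow> real^('c + 'd)^('a + 'b)" where
  "block_mat P Q R S = (\<chi> i j.
     case i of
       Inl a \<Rightarrow> (case j of Inl c \<Rightarrow> P $ a $ c | Inr d \<Rightarrow> Q $ a $ d)
     | Inr b \<Rightarrow> (case j of Inl c \<Rightarrow> R $ b $ c | Inr d \<Rightarrow> S $ b $ d))"

definition join_vec :: "real^'a \<Rightarrow> real^'b \<Rightarrow> real^('a + 'b)" where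
  "join_vec v w = (\<chi> i. case i of Inl a \<Rightarrow> v $ a | Inr b \<Rightarrow> w $ b)"

text \<open>The block columns \<open>[I, 0]\<^sup>T\<close> and \<open>[0, I]\<^sup>T\<close>.\<close>

definition col_I0 :: "real^'a^('a + 'b::finite)" where
  "col_I0 = (\<chi> i j. case i of Inl a \<Rightarrow> mat 1 $ a $ j | Inr b \<Rightarrow> 0)"

definition col_0I :: "real^'b^('a::finite + 'b)" where
  "col_0I = (\<chi> i j. case i of Inl a \<Rightarrow> 0 | Inr b \<Rightarrow> mat 1 $ b $ j)"

definition outer :: "real^'a \<Rightarrow> real^'b \<Rightarrow> real^'b^'a" where
  "outer v w = (\<chi> i j. v $ i * w $ j)"

section \<open>The companion system\<close>

text \<open>The coordinates \<open>1, \<dots>, m\<close> are the elements of a finite linearly ordered type in increasing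
  order; \<open>rank0\<close> is the position of an index, counted from 0.\<close>

definition rank0 :: "'m::{finite,linorder} \<Rightarrow> nat" where
  "rank0 i = card {..<i}"

definition companion :: "real^('m::{finite,linorder}) \<Rightarrow> real^('m::{finite,linorder})^('m::{finite,linorder})" where
  "companion abar = (\<chi> i j.
     if Suc (rank0 i) = CARD('m) then abar $ j
     else if rank0 j = Suc (rank0 i) then 1 else 0)"

definition B_z :: "real^('m::{finite,linorder})" where
  "B_z = (\<chi> i. if Suc (rank0 i) = CARD('m) then 1 else 0)"

definition C_z :: "real^('m::{finite,linorder})" where
  "C_z = (\<chi> i. if rank0 i = 0 then 1 else 0)"

section \<open>Observer gains\<close>

definition F_mat :: "real \<Rightarrow> real^'a^'a \<Rightarrow> real^('a + 'a)^('a + 'a)" where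
  "F_mat q M = block_mat 0 ((1 / q) *\<^sub>R M) (mat 1) 0"

definition G_mat :: "real \<Rightarrow> real^'a^'a \<Rightarrow> real^'a^'a" where
  "G_mat q M = transpose col_0I ** mexp (F_mat q M) ** col_I0"

definition vtheta :: "real \<Rightarrow> real^('m::{finite,linorder}) \<Rightarrow> real \<Rightarrow> real^('m::{finite,linorder})" where
  "vtheta q abar x =
     join_vec 0 (- (C_z v* matrix_inv (G_mat q (companion abar))))
       v* mexp (x *\<^sub>R F_mat q (companion abar)) v* col_I0"

definition theta :: "real \<Rightarrow> real^'n^'n \<Rightarrow> real^'n \<Rightarrow> real \<Rightarrow> real^'n" where
  "theta q A C_X x =
     join_vec (- C_X)
       (C_X v* (transpose col_I0 ** mexp (F_mat q A) ** col_I0) v* matrix_inv (G_mat q A))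
       v* mexp (x *\<^sub>R F_mat q A) v* col_I0"

definition A_a :: "real^'n^'n \<Rightarrow> real^('m::{finite,linorder}) \<Rightarrow> real^('m + 'n)^('m + 'n)" where
  "A_a A abar = block_mat (companion abar) 0 0 A"

definition B_a ::
  "real \<Rightarrow> real^'n^'n \<Rightarrow> real^'n \<Rightarrow> real^('m::{finite,linorder}) \<Rightarrow> real^('m + 'n)" where
  "B_a q A C_X abar =
     join_vec (vector_derivative (vtheta q abar) (at 0))
              (vector_derivative (theta q A C_X) (at 0))"

definition p1 ::
  "real \<Rightarrow> real^'n^'n \<Rightarrow> real^'n \<Rightarrow> real^('m::{finite,linorder}) \<Rightarrow> real^('m::{finite,linorder}) \<Rightarrow> real^'n \<Rightarrow> real \<Rightarrow> real"
where
  "p1 q A C_X abar P2 P0 x = - (vtheta q abar x \<bullet> P2) - theta q A C_X x \<bullet> P0"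

section \<open>Sobolev spaces on the unit interval\<close>

definition L2_01 :: "(real \<Rightarrow> real) set" where
  "L2_01 = {f. f \<in> borel_measurable (lebesgue_on {0<..<1})
              \<and> integrable (lebesgue_on {0<..<1}) (\<lambda>x. (f x)\<^sup>2)}"

definition L2_norm :: "(real \<Rightarrow> real) \<Rightarrow> real" where
  "L2_norm f = sqrt (integral\<^sup>L (lebesgue_on {0<..<1}) (\<lambda>x. (f x)\<^sup>2))"

text \<open>Weak derivatives are tested against compactly supported \<open>C\<^sup>1\<close> functions (Brezis' convention
  in one dimension, equivalent to smooth test functions).\<close>

definition is_weak_deriv :: "(real \<Rightarrow> real) \<Rightarrow> (real \<Rightarrow> real) \<Rightarrow> bool" where
  "is_weak_deriv f g \<longleftrightarrow>
     (\<forall>\<phi> \<phi>' a b. 0 < a \<and> a < b \<and> b < 1 \<and> (\<forall>x. x \<notin> {a..b} \<longrightarrow> \<phi> x = 0)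
        \<and> (\<forall>x. (\<phi> has_real_derivative \<phi>' x) (at x)) \<and> continuous_on UNIV \<phi>' \<longrightarrow>
        integral\<^sup>L (lebesgue_on {0<..<1}) (\<lambda>x. f x * \<phi>' x)
          = - integral\<^sup>L (lebesgue_on {0<..<1}) (\<lambda>x. g x * \<phi> x))"

text \<open>A representative; weak derivatives are unique almost everywhere, so the \<open>L\<^sup>2\<close> norms below do
  not depend on the choice.\<close>

definition weak_deriv :: "(real \<Rightarrow> real) \<Rightarrow> (real \<Rightarrow> real)" where
  "weak_deriv f = (SOME g. g \<in> L2_01 \<and> is_weak_deriv f g)"

primrec H_sp :: "nat \<Rightarrow> (real \<Rightarrow> real) set" where
  "H_sp 0 = L2_01"
| "H_sp (Suc k) = {f \<in> L2_01. \<exists>g \<in> H_sp k. is_weak_deriv f g}"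

definition H_norm :: "nat \<Rightarrow> (real \<Rightarrow> real) \<Rightarrow> real" where
  "H_norm k f = sqrt (\<Sum>i\<le>k. (L2_norm ((weak_deriv ^^ i) f))\<^sup>2)"

section \<open>Solutions of the plant and of the observer\<close>

text \<open>Functions \<open>u x t\<close> of space and time. The spatial derivative is one-sided at the end points.\<close>

definition Dx :: "(real \<Rightarrow> real \<Rightarrow> real) \<Rightarrow> real \<Rightarrow> real \<Rightarrow> real" where
  "Dx u x t = vector_derivative (\<lambda>y. u y t) (at x within {0..1})"

text \<open>\<open>u\<close> is the continuous representative of a curve in \<open>C([0,\<infinity>); H\<^sup>k(0,1))\<close>. Continuity at
  \<open>t = 0\<close> in \<open>H\<^sup>k\<close> encodes the compatibility of the initial value with the boundary conditions.\<close>

definition H_curve :: "nat \<Rightarrow> (real \<Rightarrow> real \<Rightarrow> real) \<Rightarrow> bool" where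
  "H_curve k u \<longleftrightarrow>
     continuous_on ({0..1} \<times> {0..}) (\<lambda>(x, t). u x t) \<and>
     (\<forall>t\<ge>0. \<forall>x\<in>{0..1}. (\<lambda>y. u y t) differentiable (at x within {0..1})) \<and>
     (\<forall>t\<ge>0. (\<lambda>x. u x t) \<in> H_sp k) \<and>
     (\<forall>s\<ge>0. ((\<lambda>t. H_norm k (\<lambda>x. u x t - u x s)) \<longlongrightarrow> 0) (at s within {0..}))"

definition heat_eq ::
  "real \<Rightarrow> (real \<Rightarrow> real \<Rightarrow> real) \<Rightarrow> (real \<Rightarrow> real \<Rightarrow> real) \<Rightarrow> bool" where
  "heat_eq q u f \<longleftrightarrow>
     (\<forall>t>0. \<forall>x\<in>{0<..<1}.
        (\<lambda>y. Dx u y t) differentiable (at x) \<and>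
        ((\<lambda>s. u x s) has_real_derivative (q * Dx (Dx u) x t + f x t)) (at t))"

definition plant_solution ::
  "real \<Rightarrow> real^'n^'n \<Rightarrow> real^'n \<Rightarrow> real^'n \<Rightarrow> real^('m::{finite,linorder}) \<Rightarrow> (real \<Rightarrow> real) \<Rightarrow>
   (real \<Rightarrow> real^'n) \<Rightarrow> (real \<Rightarrow> real \<Rightarrow> real) \<Rightarrow> (real \<Rightarrow> real^('m::{finite,linorder})) \<Rightarrow> bool" where
  "plant_solution q A B C_X abar U X u Z \<longleftrightarrow>
     H_curve (2 * CARD('m)) u \<and>
     (\<forall>t\<ge>0. (X has_vector_derivative (A *v X t + Dx u 0 t *\<^sub>R B)) (at t within {0..})) \<and>
     heat_eq q u (\<lambda>x t. 0) \<and>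
     (\<forall>t\<ge>0. u 0 t = C_X \<bullet> X t) \<and>
     (\<forall>t\<ge>0. u 1 t = C_z \<bullet> Z t) \<and>
     (\<forall>t\<ge>0. (Z has_vector_derivative (companion abar *v Z t + U t *\<^sub>R B_z)) (at t within {0..}))"

text \<open>The observer is driven by the control \<open>U\<close> and by the measurement \<open>y t = u\<^sub>x(0,t)\<close>.\<close>

definition observer_solution ::
  "real \<Rightarrow> real^'n^'n \<Rightarrow> real^'n \<Rightarrow> real^'n \<Rightarrow> real^('m::{finite,linorder}) \<Rightarrow> real^('m::{finite,linorder}) \<Rightarrow> real^'n \<Rightarrow>
   (real \<Rightarrow> real) \<Rightarrow> (real \<Rightarrow> real) \<Rightarrow>
   (real \<Rightarrow> real^'n) \<Rightarrow> (real \<Rightarrow> real \<Rightarrow> real) \<Rightarrow> (real \<Rightarrow> real^('m::{finite,linorder})) \<Rightarrow> bool" where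
  "observer_solution q A B C_X abar P2 P0 U y Xh uh Zh \<longleftrightarrow>
     H_curve (2 * CARD('m)) uh \<and>
     (\<forall>t\<ge>0. (Xh has_vector_derivative
        (A *v Xh t + y t *\<^sub>R B + (y t - Dx uh 0 t) *\<^sub>R P0)) (at t within {0..})) \<and>
     heat_eq q uh (\<lambda>x t. p1 q A C_X abar P2 P0 x * (y t - Dx uh 0 t)) \<and>
     (\<forall>t\<ge>0. uh 0 t = C_X \<bullet> Xh t) \<and>
     (\<forall>t\<ge>0. uh 1 t = C_z \<bullet> Zh t) \<and>
     (\<forall>t\<ge>0. (Zh has_vector_derivative
        (companion abar *v Zh t + U t *\<^sub>R B_z + (y t - Dx uh 0 t) *\<^sub>R P2)) (at t within {0..}))"

definition Theta_e ::
  "(real \<Rightarrow> real \<Rightarrow> real) \<Rightarrow> (real \<Rightarrow> real^('m::{finite,linorder})) \<Rightarrow> (real \<Rightarrow> real^'n) \<Rightarrow> real \<Rightarrow> real"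
where
  "Theta_e v Z X t =
     sqrt ((\<Sum>i\<le>2 * CARD('m). (L2_norm ((weak_deriv ^^ i) (\<lambda>x. v x t)))\<^sup>2)
           + (norm (Z t))\<^sup>2 + (norm (X t))\<^sup>2)"

end

theory Submission
  imports Defs "HOL-Computational_Algebra.Fundamental_Theorem_Algebra"
begin

text \<open>The error system splits into a heat equation that decays on its own and a finite-dimensional
  system driven by one boundary value of that heat equation.

  Write \<open>v\<close> for the error of the PDE state and set \<open>w(x,t) = v(x,t) + \<vartheta>(x) Z(t) + \<theta>(x) X(t)\<close>, where
  \<open>X\<close> and \<open>Z\<close> are the errors of the ODE states. The equations \<open>q \<vartheta>'' = \<vartheta> A\<^sub>z\<close> and \<open>q \<theta>'' = \<theta> A\<close> together
  with the choice of \<open>p\<^sub>1\<close> make all terms with \<open>v\<^sub>x(0,t)\<close> cancel, so that \<open>w\<^sub>t = q w\<^sub>x\<^sub>x\<close>; the boundary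
  values of \<open>\<vartheta>\<close> and \<open>\<theta>\<close> make \<open>w\<close> vanish at both end points. Since
  \<open>v\<^sub>x(0,t) = w\<^sub>x(0,t) - B\<^sub>a (Z,X)\<close>, the vector \<open>Y = (Z,X)\<close> satisfies \<open>Y' = M Y - P w\<^sub>x(0,t)\<close> with \<open>P = (P\<^sub>2,P\<^sub>0)\<close>
  and the Hurwitz matrix \<open>M = A\<^sub>a + P B\<^sub>a\<close>.

  The maximum principle (\<open>heat_maximum_principle\<close>) and the density of sine polynomials
  (\<open>sine_polynomials_dense\<close>) show that \<open>w\<close> is a uniform limit of finite sums of the solutions
  \<open>exp (- q k\<^sup>2 \<pi>\<^sup>2 t) sin (k \<pi> x)\<close>. Hence every sine coefficient decays exactly like its mode
  (\<open>sine_coef_decay\<close>), and for \<open>t > 0\<close> the function \<open>w(\<cdot>,t)\<close> is the sum of a rapidly converging sine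
  series. Comparing the series at two times mode by mode, the \<open>L\<^sup>2\<close> norm of every spatial derivative shrinks by
  \<open>exp (- q \<pi>\<^sup>2 (t - s))\<close> from time \<open>s > 0\<close> to time \<open>t\<close>. Continuity at \<open>t = 0\<close> in \<open>H\<^bsup>2m\<^esup>\<close> allows \<open>s \<rightarrow> 0\<close>
  (\<open>H_norm_decay\<close>); this is where the compatibility of the initial value with the boundary conditions
  enters.

  Because \<open>2m \<ge> 2\<close>, the forcing \<open>w\<^sub>x(0,t)\<close> is bounded by the \<open>H\<^bsup>2m\<^esup>\<close> norm of \<open>w\<close> (\<open>w_deriv_trace\<close>) and
  decays exponentially as well. A Hurwitz system with exponentially decaying forcing decays
  exponentially (\<open>hurwitz_decay\<close>): a suitable product of factors \<open>M - l\<close> over eigenvalues \<open>l\<close> vanishes, and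
  removing one factor at a time reduces the claim to scalar equations \<open>z' = l z + r\<close>. Finally \<open>v\<close> and
  \<open>w\<close> differ by \<open>\<vartheta> Z + \<theta> X\<close>, whose Sobolev norm is at most a constant times the norm of \<open>Y\<close>.\<close>

section \<open>Exponential decay of linear systems with a Hurwitz matrix\<close>

definition shift :: "complex^'n^'n \<Rightarrow> complex \<Rightarrow> complex^'n \<Rightarrow> complex^'n" where
  "shift M l v = M *v v - l *s v"

text \<open>Solutions of \<open>y' = M y\<close> are tracked through the vectors \<open>\<Prod>(M - l) y\<close> with fewer and fewer
  factors. Acting on vectors, such a product is stable under splitting the list, which is how the
  inductions below peel off factors.\<close>

definition shifts :: "complex^'n^'n \<Rightarrow> complex list \<Rightarrow> complex^'n \<Rightarrow> complex^'n" where
  "shifts M ls v = foldr (shift M) ls v"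

lemma shifts_Nil [simp]: "shifts M [] v = v"
  and shifts_Cons [simp]: "shifts M (l # ls) v = shift M l (shifts M ls v)"
  and shifts_append [simp]: "shifts M (ls @ ks) v = shifts M ls (shifts M ks v)"
  by (simp_all add: shifts_def)

lemma shift_commute: "shift M l (shift M m v) = shift M m (shift M l v)"
  by (simp add: shift_def matrix_vector_mult_diff_distrib vector_scalar_commute vec.scale_right_diff_distrib
      vector_smult_assoc mult.commute)

lemma shift_shifts_commute: "shift M l (shifts M ls v) = shifts M ls (shift M l v)"
  by (induction ls) (simp_all add: shift_commute)

lemma shift_mult_commute: "shift M l (M *v v) = M *v shift M l v"
  by (simp add: shift_def matrix_vector_mult_diff_distrib vector_scalar_commute)

lemma shifts_mult_commute: "shifts M ls (M *v v) = M *v shifts M ls v"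
  by (induction ls) (simp_all add: shift_mult_commute)

lemma shift_add: "shift M l (v + w) = shift M l v + shift M l w"
  by (simp add: shift_def matrix_vector_right_distrib vec.scale_right_distrib)

lemma shift_scaleR: "shift M l (c *\<^sub>R v) = c *\<^sub>R shift M l v"
  by (simp add: shift_def vec_eq_iff matrix_vector_mult_def scaleR_sum_right scaleR_diff_right)

lemma shift_smult: "shift M l (c *s v) = c *s shift M l v"
  by (simp add: shift_def vector_scalar_commute vec.scale_right_diff_distrib vector_smult_assoc mult.commute)

lemma shifts_add: "shifts M ls (v + w) = shifts M ls v + shifts M ls w"
  by (induction ls) (simp_all add: shift_add)

lemma shifts_scaleR: "shifts M ls (c *\<^sub>R v) = c *\<^sub>R shifts M ls v"
  by (induction ls) (simp_all add: shift_scaleR)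

lemma bounded_linear_shifts: "bounded_linear (shifts M ls)"
  by (intro linear_conv_bounded_linear[THEN iffD1] linearI shifts_add shifts_scaleR)

definition poly_apply :: "complex^'n^'n \<Rightarrow> complex poly \<Rightarrow> complex^'n \<Rightarrow> complex^'n" where
  "poly_apply M p v = (\<Sum>k\<le>degree p. coeff p k *s (((*v) M ^^ k) v))"

text \<open>The degree drops out of the range of summation, so that polynomials of different degree can
  be compared term by term.\<close>

lemma poly_apply_bound:
  assumes "degree p \<le> n"
  shows "poly_apply M p v = (\<Sum>k\<le>n. coeff p k *s (((*v) M ^^ k) v))"
  unfolding poly_apply_def
  by (rule sum.mono_neutral_left) (use assms in \<open>auto simp: coeff_eq_0\<close>)

lemma mult_sum_right: "M *v (\<Sum>k\<in>A. f k) = (\<Sum>k\<in>A. M *v f k)" for M :: "complex^'n^'n"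
  by (induction A rule: infinite_finite_induct) (simp_all add: matrix_vector_right_distrib)

lemma poly_apply_linear_factor: "poly_apply M ([:- l, 1:] * p) v = shift M l (poly_apply M p v)"
proof -
  let ?g = "\<lambda>k. ((*v) M ^^ k) v"
  let ?n = "degree p"
  have "degree ([:- l, 1:] * p) \<le> Suc ?n"
    using degree_mult_le[of "[:- l, 1:]" p] by simp
  then have "poly_apply M ([:- l, 1:] * p) v = (\<Sum>k\<le>Suc ?n. coeff ([:- l, 1:] * p) k *s ?g k)"
    by (rule poly_apply_bound)
  also have "\<dots> = (\<Sum>k\<le>Suc ?n. (- l * coeff p k) *s ?g k) + (\<Sum>k\<le>Suc ?n. coeff (pCons 0 p) k *s ?g k)"
  proof -
    have "[:- l, 1:] * p = smult (- l) p + pCons 0 p" by simp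
    then show ?thesis by (simp only: coeff_add coeff_smult vec.scale_left_distrib sum.distrib)
  qed
  also have "(\<Sum>k\<le>Suc ?n. coeff (pCons 0 p) k *s ?g k) = (\<Sum>k\<le>?n. coeff p k *s ?g (Suc k))"
    by (subst sum.atMost_Suc_shift) simp
  also have "\<dots> = M *v (\<Sum>k\<le>?n. coeff p k *s ?g k)"
    by (simp add: mult_sum_right vector_scalar_commute)
  also have "(\<Sum>k\<le>Suc ?n. (- l * coeff p k) *s ?g k) = - (l *s (\<Sum>k\<le>Suc ?n. coeff p k *s ?g k))"
    by (simp only: vec.scale_sum_right vector_smult_assoc mult_minus_left vec.scale_minus_left sum_negf)
  also have "(\<Sum>k\<le>Suc ?n. coeff p k *s ?g k) = poly_apply M p v"
    by (rule poly_apply_bound[symmetric]) simp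
  finally show ?thesis by (simp add: shift_def poly_apply_def)
qed

text \<open>The fundamental theorem of algebra removes one linear factor at a time.\<close>

lemma poly_apply_factorization:
  assumes "p \<noteq> 0"
  shows "\<exists>c ls. c \<noteq> 0 \<and> (\<forall>v. poly_apply M p v = c *s shifts M ls v)"
  using assms
proof (induction "degree p" arbitrary: p)
  case 0
  then obtain c where "p = [:c:]" using degree_0_id by metis
  then have "c \<noteq> 0 \<and> (\<forall>v. poly_apply M p v = c *s shifts M [] v)"
    using 0 by (simp add: poly_apply_def)
  then show ?case by blast
next
  case (Suc n)
  then have "\<not> constant (poly p)" by (simp add: constant_degree)
  then obtain l where "poly p l = 0" using fundamental_theorem_of_algebra by blast
  then obtain r where r: "p = [:- l, 1:] * r" by (auto simp: poly_eq_0_iff_dvd)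
  then have "r \<noteq> 0" using Suc.prems by auto
  then have "degree p = Suc (degree r)" unfolding r by (subst degree_mult_eq) auto
  then obtain c ls where "c \<noteq> 0" and c: "\<And>v. poly_apply M r v = c *s shifts M ls v"
    using Suc.hyps \<open>r \<noteq> 0\<close> by (metis nat.inject)
  have "poly_apply M p v = c *s shifts M (l # ls) v" for v
    unfolding r poly_apply_linear_factor c by (simp add: shift_smult)
  then show ?case using \<open>c \<noteq> 0\<close> by blast
qed

text \<open>Too many powers of \<open>M\<close> in a finite-dimensional space: some polynomial annihilates \<open>M\<close>, a
  weak form of the Cayley-Hamilton theorem.\<close>

lemma powers_dependent:
  fixes M :: "complex^'n^'n"
  obtains n and c :: "nat \<Rightarrow> real" where "\<exists>k\<le>n. c k \<noteq> 0"
    and "(\<Sum>k\<le>n. c k *\<^sub>R ((\<lambda>N. M ** N) ^^ k) (mat 1)) = 0"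
proof -
  let ?f = "\<lambda>k. ((\<lambda>N. M ** N) ^^ k) (mat 1)"
  let ?n = "DIM(complex^'n^'n)"
  show ?thesis
  proof (cases "inj_on ?f {..?n}")
    case False
    then obtain i j where ij: "i \<le> ?n" "j \<le> ?n" "i \<noteq> j" "?f i = ?f j"
      by (auto simp: inj_on_def)
    define c :: "nat \<Rightarrow> real" where "c k = (if k = i then 1 else 0) - (if k = j then 1 else 0)" for k
    have "(\<Sum>k\<le>?n. c k *\<^sub>R ?f k)
        = (\<Sum>k\<le>?n. if k = i then ?f i else 0) - (\<Sum>k\<le>?n. if k = j then ?f j else 0)"
      unfolding sum_subtractf[symmetric] by (rule sum.cong) (auto simp: c_def)
    also have "\<dots> = 0" using ij by (simp add: sum.delta)
    finally have "(\<Sum>k\<le>?n. c k *\<^sub>R ?f k) = 0" .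
    moreover have "\<exists>k\<le>?n. c k \<noteq> 0" using ij by (intro exI[of _ i]) (auto simp: c_def)
    ultimately show ?thesis by (rule that[rotated])
  next
    case True
    then have "card (?f ` {..?n}) = Suc ?n" by (simp add: card_image)
    then have "dependent (?f ` {..?n})" by (intro dependent_biggerset) simp
    then obtain u where u: "\<exists>v\<in>?f ` {..?n}. u v \<noteq> 0" "(\<Sum>v\<in>?f ` {..?n}. u v *\<^sub>R v) = 0"
      using dependent_finite[of "?f ` {..?n}"] by auto
    have "(\<Sum>k\<le>?n. u (?f k) *\<^sub>R ?f k) = 0"
      using u(2) unfolding sum.reindex[OF True] o_def .
    moreover have "\<exists>k\<le>?n. u (?f k) \<noteq> 0" using u(1) by auto
    ultimately show ?thesis by (rule that[rotated])
  qed
qed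

lemma shifts_annihilate:
  fixes M :: "complex^'n^'n"
  obtains ls where "\<And>v. shifts M ls v = 0"
proof -
  obtain n and c :: "nat \<Rightarrow> real" where c: "\<exists>k\<le>n. c k \<noteq> 0"
    and c0: "(\<Sum>k\<le>n. c k *\<^sub>R ((\<lambda>N. M ** N) ^^ k) (mat 1)) = 0"
    by (rule powers_dependent)
  define p where "p = (\<Sum>k\<le>n. monom (complex_of_real (c k)) k)"
  have coeff: "coeff p k = (if k \<le> n then of_real (c k) else 0)" for k
    by (simp add: p_def coeff_sum sum.delta' if_distrib cong: if_cong)
  have "p \<noteq> 0"
  proof
    assume "p = 0"
    then show False using c coeff by (metis coeff_0 of_real_eq_0_iff)
  qed
  have deg: "degree p \<le> n" by (rule degree_le) (simp add: coeff)
  have pow: "((\<lambda>N. M ** N) ^^ k) (mat 1) *v v = ((*v) M ^^ k) v" for k v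
    by (induction k) (simp_all add: matrix_vector_mul_assoc[symmetric])
  have scale: "(r *\<^sub>R N) *v v = complex_of_real r *s (N *v v)" for r and N :: "complex^'n^'n" and v
  proof -
    have "(r *\<^sub>R N) $ i $ j = of_real r * (N $ i $ j)" for i j
      by (simp add: scaleR_conv_of_real[of r "N $ i $ j"])
    then show ?thesis by (simp add: vec_eq_iff matrix_vector_mult_def sum_distrib_left mult.assoc)
  qed
  have sumv: "(\<Sum>k\<in>A. f k) *v v = (\<Sum>k\<in>A. f k *v v)" for f :: "nat \<Rightarrow> complex^'n^'n" and A v
    by (induction A rule: infinite_finite_induct) (simp_all add: matrix_vector_mult_add_rdistrib)
  have "poly_apply M p v = 0" for v
  proof -
    have "poly_apply M p v = (\<Sum>k\<le>n. (c k *\<^sub>R ((\<lambda>N. M ** N) ^^ k) (mat 1)) *v v)"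
      unfolding poly_apply_bound[OF deg] by (intro sum.cong refl) (simp add: coeff scale pow)
    also have "\<dots> = 0" unfolding sumv[symmetric] c0 by simp
    finally show ?thesis .
  qed
  moreover obtain d ls where "d \<noteq> 0" "\<And>v. poly_apply M p v = d *s shifts M ls v"
    using poly_apply_factorization[OF \<open>p \<noteq> 0\<close>] by blast
  ultimately have "d *s shifts M ls v = 0" for v by metis
  then have "shifts M ls v = 0" for v using \<open>d \<noteq> 0\<close> by (simp add: vec.scale_eq_0_iff)
  then show ?thesis by (rule that)
qed

text \<open>A factor that is injective can be moved to the front and cancelled, because all factors
  commute. With \<open>P\<close> the property of being an eigenvalue, only eigenvalues remain.\<close>

lemma shifts_annihilate_filter:
  assumes inj: "\<And>l v. \<not> P l \<Longrightarrow> shift M l v = 0 \<Longrightarrow> v = 0"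
    and "\<And>v. shifts M (as @ ls) v = 0"
  shows "shifts M (as @ filter P ls) v = 0"
  using assms(2)
proof (induction ls arbitrary: as v)
  case (Cons l ls)
  show ?case
  proof (cases "P l")
    case True
    then show ?thesis using Cons.IH[of "as @ [l]" v] Cons.prems by simp
  next
    case False
    have "shift M l (shifts M (as @ ls) v) = 0" for v
      using Cons.prems[of v] by (simp add: shift_shifts_commute)
    then have "shifts M (as @ ls) v = 0" for v using inj[OF False] by blast
    then show ?thesis using Cons.IH False by simp
  qed
qed simp

lemma hurwitz_annihilating_shifts:
  fixes M :: "real^'n^'n"
  assumes "hurwitz M"
  obtains ls where "\<And>v. shifts (map_matrix complex_of_real M) ls v = 0" "\<And>l. l \<in> set ls \<Longrightarrow> Re l < 0"
proof -
  let ?M = "map_matrix complex_of_real M"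
  obtain ls where "\<And>v. shifts ?M ls v = 0" by (rule shifts_annihilate) blast
  then have "shifts ?M ([] @ filter (eigenvalue M) ls) v = 0" for v
    by (intro shifts_annihilate_filter) (auto simp: eigenvalue_def shift_def)
  then show ?thesis using that[of "filter (eigenvalue M) ls"] assms by (auto simp: hurwitz_def)
qed

text \<open>Variation of constants, written as a bound on the derivative of \<open>exp (- l t) z(t)\<close>, which
  makes sense for forcing that is merely bounded. The rate \<open>b\<close> stays away from \<open>- Re l\<close>; otherwise a
  forcing in resonance with the equation would produce a factor \<open>t\<close>.\<close>

lemma scalar_ode_decay:
  fixes z r :: "real \<Rightarrow> complex"
  assumes l: "Re l < 0" and b: "0 < b" "b \<le> a" "b \<le> - Re l / 2" and "0 \<le> C"
    and z: "continuous_on {0..} z"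
    and z': "\<And>t. 0 < t \<Longrightarrow> (z has_vector_derivative (l * z t + r t)) (at t)"
    and r: "\<And>t. 0 < t \<Longrightarrow> norm (r t) \<le> C * exp (- a * t)"
    and t: "0 \<le> t"
  shows "norm (z t) \<le> (norm (z 0) + 2 / (- Re l) * C) * exp (- b * t)"
proof (cases "t = 0")
  case True
  have "0 \<le> 2 / (- Re l) * C" using l \<open>0 \<le> C\<close> by (intro mult_nonneg_nonneg divide_nonneg_nonneg) auto
  then show ?thesis using True by simp
next
  case False
  with t have "0 < t" by simp
  define s where "s = - Re l"
  have s: "0 < s" "b < s" "s / 2 \<le> s - b" using l b by (auto simp: s_def)
  define w where "w = (\<lambda>t. exp (- l * of_real t) * z t)"
  define \<phi> where "\<phi> = (\<lambda>t. C / (s - b) * exp ((s - b) * t))"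
  have nexp: "norm (exp (- l * of_real t)) = exp (s * t)" for t :: real
    by (simp add: norm_exp_eq_Re s_def)
  have "norm (w t - w 0) \<le> \<phi> t - \<phi> 0"
  proof (rule differentiable_bound_general[OF \<open>0 < t\<close>])
    show "continuous_on {0..t} w"
      unfolding w_def using continuous_on_subset[OF z, of "{0..t}"]
      by (auto intro!: continuous_intros)
    show "continuous_on {0..t} \<phi>" unfolding \<phi>_def by (intro continuous_intros)
    fix x assume x: "0 < x" "x < t"
    have "((\<lambda>t. exp (- l * of_real t)) has_vector_derivative (- l) * exp (- l * of_real x)) (at x)"
      by (rule has_vector_derivative_real_field) (auto intro!: derivative_eq_intros)
    from has_vector_derivative_mult[OF this z'[OF x(1)]]
    show "(w has_vector_derivative exp (- l * of_real x) * r x) (at x)"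
      unfolding w_def by (simp add: algebra_simps)
    show "(\<phi> has_vector_derivative C * exp ((s - b) * x)) (at x)"
      unfolding \<phi>_def has_real_derivative_iff_has_vector_derivative[symmetric]
      using s by (auto intro!: derivative_eq_intros)
    have "norm (exp (- l * of_real x) * r x) \<le> exp (s * x) * (C * exp (- a * x))"
      unfolding norm_mult nexp using r[OF x(1)] by (intro mult_left_mono) auto
    also have "\<dots> \<le> exp (s * x) * (C * exp (- b * x))"
      using b x \<open>0 \<le> C\<close> by (intro mult_left_mono) (auto intro: mult_right_mono)
    also have "\<dots> = C * exp ((s - b) * x)" by (simp add: algebra_simps flip: exp_add)
    finally show "norm (exp (- l * of_real x) * r x) \<le> C * exp ((s - b) * x)" .
  qed
  also have "\<dots> \<le> \<phi> t" using s \<open>0 \<le> C\<close> by (simp add: \<phi>_def)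
  finally have "norm (w t) \<le> norm (z 0) + \<phi> t"
    using norm_triangle_ineq2[of "w t" "w 0"] by (simp add: w_def)
  moreover have "norm (w t) = exp (s * t) * norm (z t)" unfolding w_def norm_mult nexp ..
  ultimately have "norm (z t) \<le> exp (- s * t) * (norm (z 0) + \<phi> t)"
    by (simp add: exp_minus field_simps)
  also have "\<dots> = exp (- s * t) * norm (z 0) + C / (s - b) * exp (- b * t)"
    by (simp add: \<phi>_def algebra_simps flip: exp_add)
  also have "\<dots> \<le> exp (- b * t) * norm (z 0) + (2 / s * C) * exp (- b * t)"
  proof (intro add_mono mult_right_mono)
    show "exp (- s * t) \<le> exp (- b * t)" using s t by (simp add: mult_right_mono)
    have "C / (s - b) \<le> C / (s / 2)" using s \<open>0 \<le> C\<close> by (intro divide_left_mono) auto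
    then show "C / (s - b) \<le> 2 / s * C" by (simp add: mult.commute)
  qed auto
  finally show ?thesis by (simp add: s_def algebra_simps)
qed

lemma vector_ode_decay:
  fixes z r :: "real \<Rightarrow> complex^'n"
  assumes l: "Re l < 0" and b: "0 < b" "b \<le> a" "b \<le> - Re l / 2" and "0 \<le> C"
    and z: "continuous_on {0..} z"
    and z': "\<And>t. 0 < t \<Longrightarrow> (z has_vector_derivative (l *s z t + r t)) (at t)"
    and r: "\<And>t. 0 < t \<Longrightarrow> norm (r t) \<le> C * exp (- a * t)"
    and t: "0 \<le> t"
  shows "norm (z t) \<le> real CARD('n) * (norm (z 0) + 2 / (- Re l) * C) * exp (- b * t)"
proof -
  have comp: "norm (z t $ i) \<le> (norm (z 0) + 2 / (- Re l) * C) * exp (- b * t)" for i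
  proof -
    have "norm (z t $ i) \<le> (norm (z 0 $ i) + 2 / (- Re l) * C) * exp (- b * t)"
    proof (rule scalar_ode_decay[where z = "\<lambda>t. z t $ i" and r = "\<lambda>t. r t $ i", OF l b \<open>0 \<le> C\<close> _ _ _ t])
      show "continuous_on {0..} (\<lambda>t. z t $ i)"
        by (rule bounded_linear.continuous_on[OF bounded_linear_vec_nth z])
      fix t :: real assume "0 < t"
      show "((\<lambda>t. z t $ i) has_vector_derivative (l * z t $ i + r t $ i)) (at t)"
        using bounded_linear.has_vector_derivative[OF bounded_linear_vec_nth z'[OF \<open>0 < t\<close>], of i] by simp
      show "norm (r t $ i) \<le> C * exp (- a * t)"
        using r[OF \<open>0 < t\<close>] Finite_Cartesian_Product.norm_nth_le[of "r t" i] by linarith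
    qed
    also have "\<dots> \<le> (norm (z 0) + 2 / (- Re l) * C) * exp (- b * t)"
      using Finite_Cartesian_Product.norm_nth_le[of "z 0" i] by (intro mult_right_mono) auto
    finally show ?thesis .
  qed
  have "norm (z t) \<le> (\<Sum>i\<in>UNIV. norm (z t $ i))"
    unfolding norm_vec_def by (rule L2_set_le_sum) simp
  also have "\<dots> \<le> (\<Sum>i\<in>(UNIV :: 'n set). (norm (z 0) + 2 / (- Re l) * C) * exp (- b * t))"
    by (intro sum_mono comp)
  finally show ?thesis by (simp add: mult.assoc)
qed

text \<open>The decay statement that is carried through the induction over the list of factors. The
  constants \<open>K\<close> and \<open>b\<close> are parameters, because they must be chosen before the trajectory \<open>y\<close> and the
  forcing \<open>g\<close>.\<close>

definition forced_decay :: "complex^'n^'n \<Rightarrow> complex list \<Rightarrow> real \<Rightarrow> real \<Rightarrow> real \<Rightarrow> bool" where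
  "forced_decay M ls a K b \<longleftrightarrow> (\<forall>y g C. 0 \<le> C \<longrightarrow> continuous_on {0..} y \<longrightarrow>
      (\<forall>t>0. (y has_vector_derivative (M *v y t + g t)) (at t)) \<longrightarrow>
      (\<forall>t>0. norm (g t) \<le> C * exp (- a * t)) \<longrightarrow>
      (\<forall>t\<ge>0. norm (shifts M ls (y t)) \<le> C * exp (- a * t)) \<longrightarrow>
      (\<forall>t\<ge>0. norm (y t) \<le> K * (norm (y 0) + C) * exp (- b * t)))"

lemma forced_decayI:
  fixes M :: "complex^'n^'n"
  assumes "\<And>y g C t. 0 \<le> C \<Longrightarrow> continuous_on {0..} y \<Longrightarrow>
      (\<And>t. 0 < t \<Longrightarrow> (y has_vector_derivative (M *v y t + g t)) (at t)) \<Longrightarrow>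
      (\<And>t. 0 < t \<Longrightarrow> norm (g t) \<le> C * exp (- a * t)) \<Longrightarrow>
      (\<And>t. 0 \<le> t \<Longrightarrow> norm (shifts M ls (y t)) \<le> C * exp (- a * t)) \<Longrightarrow> 0 \<le> t \<Longrightarrow>
      norm (y t) \<le> K * (norm (y 0) + C) * exp (- b * t)"
  shows "forced_decay M ls a K b"
  unfolding forced_decay_def
proof (intro allI impI)
  fix y :: "real \<Rightarrow> complex^'n" and g C and t :: real
  assume "0 \<le> C" "continuous_on {0..} y" "0 \<le> t"
    and y': "\<forall>t>0. (y has_vector_derivative (M *v y t + g t)) (at t)"
    and g: "\<forall>t>0. norm (g t) \<le> C * exp (- a * t)"
    and h: "\<forall>t\<ge>0. norm (shifts M ls (y t)) \<le> C * exp (- a * t)"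
  then show "norm (y t) \<le> K * (norm (y 0) + C) * exp (- b * t)"
    by (intro assms[of C y g t] y'[rule_format] g[rule_format] h[rule_format])
qed

lemma forced_decayD:
  assumes "forced_decay M ls a K b" "0 \<le> C" "continuous_on {0..} y"
    "\<And>t. 0 < t \<Longrightarrow> (y has_vector_derivative (M *v y t + g t)) (at t)"
    "\<And>t. 0 < t \<Longrightarrow> norm (g t) \<le> C * exp (- a * t)"
    "\<And>t. 0 \<le> t \<Longrightarrow> norm (shifts M ls (y t)) \<le> C * exp (- a * t)" "0 \<le> t"
  shows "norm (y t) \<le> K * (norm (y 0) + C) * exp (- b * t)"
  using assms(1)[unfolded forced_decay_def, rule_format, of C y g t] assms(2-) by simp

text \<open>If \<open>z\<close> denotes the product of all factors but the first applied to \<open>y\<close>, then \<open>M z = l z + h\<close>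
  where \<open>h\<close> is the full product applied to \<open>y\<close> and decays by assumption. Thus \<open>z\<close> satisfies a scalar
  equation, decays with a smaller rate, and satisfies the assumption for the shorter list.\<close>

lemma shifts_decay:
  fixes M :: "complex^'n^'n"
  assumes "\<And>l. l \<in> set ls \<Longrightarrow> Re l < 0" and "0 < a"
  shows "\<exists>K\<ge>0. \<exists>b>0. b \<le> a \<and> forced_decay M ls a K b"
  using assms
proof (induction ls arbitrary: a)
  case Nil
  have "forced_decay M [] a 1 a"
  proof (rule forced_decayI)
    fix y :: "real \<Rightarrow> complex^'n" and g C and t :: real
    assume h: "\<And>t. 0 \<le> t \<Longrightarrow> norm (shifts M [] (y t)) \<le> C * exp (- a * t)" and t: "0 \<le> t"
    have "norm (y t) \<le> C * exp (- a * t)" using h[OF t] by simp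
    then show "norm (y t) \<le> 1 * (norm (y 0) + C) * exp (- a * t)"
      by (auto intro: order_trans simp: distrib_right)
  qed
  then show ?case
    using Nil by (intro exI[of _ 1] conjI exI[of _ a]) auto
next
  case (Cons l ls)
  have l: "Re l < 0" using Cons.prems(1)[of l] by simp
  \<comment> \<open>Half of the decay rate of the scalar equation, capped by the rate of the forcing.\<close>
  define b where "b = min a (- Re l / 2)"
  have b: "0 < b" "b \<le> a" "b \<le> - Re l / 2" using l Cons.prems(2) by (auto simp: b_def)
  have "\<And>m. m \<in> set ls \<Longrightarrow> Re m < 0" using Cons.prems(1) by simp
  from Cons.IH[OF this b(1)] obtain K1 c where "0 \<le> K1" "0 < c" "c \<le> b"
    and IH: "forced_decay M ls b K1 c" by auto
  obtain L where "0 \<le> L" and L: "\<And>v. norm (shifts M ls v) \<le> norm v * L"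
    using bounded_linear.nonneg_bounded[OF bounded_linear_shifts[of M ls]] by blast
  define N where "N = real CARD('n)"
  have "0 \<le> N" by (simp add: N_def)
  define s where "s = 2 / (- Re l)"
  have "0 \<le> s" using l by (simp add: s_def)
  define K where "K = K1 * (1 + N * L + N * (s * (1 + L)))"
  have "0 \<le> K" unfolding K_def
    using \<open>0 \<le> K1\<close> \<open>0 \<le> N\<close> \<open>0 \<le> L\<close> \<open>0 \<le> s\<close> by (intro mult_nonneg_nonneg add_nonneg_nonneg) auto
  have "forced_decay M (l # ls) a K c"
  proof (rule forced_decayI)
    fix y :: "real \<Rightarrow> complex^'n" and g C and t :: real
    assume "0 \<le> C" and y: "continuous_on {0..} y"
      and y': "\<And>t. 0 < t \<Longrightarrow> (y has_vector_derivative (M *v y t + g t)) (at t)"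
      and g: "\<And>t. 0 < t \<Longrightarrow> norm (g t) \<le> C * exp (- a * t)"
      and h: "\<And>t. 0 \<le> t \<Longrightarrow> norm (shifts M (l # ls) (y t)) \<le> C * exp (- a * t)" and "0 \<le> t"
    have mono: "D * exp (- a * t) \<le> D * exp (- b * t)" if "0 \<le> D" "0 \<le> t" for D t
      using that b by (intro mult_left_mono) (auto intro: mult_right_mono)
    define z where "z = (\<lambda>t. shifts M ls (y t))"
    define C' where "C' = C + N * (norm (y 0) * L + s * ((1 + L) * C))"
    have "C \<le> C'" unfolding C'_def
      using \<open>0 \<le> C\<close> \<open>0 \<le> N\<close> \<open>0 \<le> L\<close> \<open>0 \<le> s\<close>
      by (simp add: mult_nonneg_nonneg add_nonneg_nonneg)
    have zt: "norm (z t) \<le> C' * exp (- b * t)" if "0 \<le> t" for t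
    proof -
      have "norm (z t) \<le> real CARD('n) * (norm (z 0) + 2 / (- Re l) * ((1 + L) * C)) * exp (- b * t)"
      proof (rule vector_ode_decay[OF l b, where r = "\<lambda>t. shifts M (l # ls) (y t) + shifts M ls (g t)"])
        show "0 \<le> (1 + L) * C" using \<open>0 \<le> L\<close> \<open>0 \<le> C\<close> by simp
        show "continuous_on {0..} z"
          unfolding z_def by (rule bounded_linear.continuous_on[OF bounded_linear_shifts y])
        fix t :: real assume t: "0 < t"
        have "shifts M ls (M *v y t + g t) = l *s z t + (shifts M (l # ls) (y t) + shifts M ls (g t))"
          by (simp add: shifts_add shifts_mult_commute z_def shift_def)
        then show "(z has_vector_derivative l *s z t + (shifts M (l # ls) (y t) + shifts M ls (g t))) (at t)"
          using bounded_linear.has_vector_derivative[OF bounded_linear_shifts y'[OF t], of M ls]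
          by (simp only: z_def)
        have "norm (shifts M ls (g t)) \<le> C * exp (- a * t) * L"
          using L[of "g t"] mult_right_mono[OF g[OF t] \<open>0 \<le> L\<close>] by linarith
        then have "norm (shifts M (l # ls) (y t) + shifts M ls (g t)) \<le> C * exp (- a * t) + C * exp (- a * t) * L"
          by (rule norm_triangle_mono[OF h[OF less_imp_le[OF t]]])
        then show "norm (shifts M (l # ls) (y t) + shifts M ls (g t)) \<le> (1 + L) * C * exp (- a * t)"
          by (simp only: algebra_simps)
      qed (rule that)
      also have "\<dots> \<le> C' * exp (- b * t)"
      proof (rule mult_right_mono)
        have "N * (norm (z 0) + s * ((1 + L) * C)) \<le> N * (norm (y 0) * L + s * ((1 + L) * C))"
          using L[of "y 0"] \<open>0 \<le> N\<close> by (intro mult_left_mono) (auto simp: z_def)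
        then show "real CARD('n) * (norm (z 0) + 2 / (- Re l) * ((1 + L) * C)) \<le> C'"
          using \<open>0 \<le> C\<close> unfolding C'_def N_def[symmetric] s_def[symmetric] by linarith
      qed simp
      finally show ?thesis .
    qed
    have "norm (y t) \<le> K1 * (norm (y 0) + C') * exp (- c * t)"
    proof (rule forced_decayD[OF IH _ y y'])
      show "0 \<le> C'" using \<open>0 \<le> C\<close> \<open>C \<le> C'\<close> by simp
      show "norm (g t) \<le> C' * exp (- b * t)" if "0 < t" for t
      proof -
        have "norm (g t) \<le> C * exp (- b * t)" using g[OF that] mono[OF \<open>0 \<le> C\<close>, of t] that by linarith
        also have "\<dots> \<le> C' * exp (- b * t)" using \<open>C \<le> C'\<close> by (intro mult_right_mono) auto
        finally show ?thesis .
      qed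
      show "norm (shifts M ls (y t)) \<le> C' * exp (- b * t)" if "0 \<le> t" for t
        using zt[OF that] by (simp add: z_def)
    qed (assumption | fact)+
    also have "\<dots> \<le> K * (norm (y 0) + C) * exp (- c * t)"
    proof (rule mult_right_mono)
      have nn: "0 \<le> N * L" "0 \<le> N * (s * (1 + L))"
        using \<open>0 \<le> N\<close> \<open>0 \<le> L\<close> \<open>0 \<le> s\<close> by auto
      have "norm (y 0) + C' = (norm (y 0) + C) + (N * L) * norm (y 0) + (N * (s * (1 + L))) * C"
        by (simp add: C'_def algebra_simps)
      also have "\<dots> \<le> (norm (y 0) + C) + (N * L) * (norm (y 0) + C) + (N * (s * (1 + L))) * (norm (y 0) + C)"
        using nn \<open>0 \<le> C\<close> by (intro add_mono mult_left_mono) auto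
      also have "\<dots> = (1 + N * L + N * (s * (1 + L))) * (norm (y 0) + C)" by (simp add: algebra_simps)
      finally show "K1 * (norm (y 0) + C') \<le> K * (norm (y 0) + C)"
        unfolding K_def mult.assoc using \<open>0 \<le> K1\<close> by (intro mult_left_mono) (simp_all add: mult.assoc)
    qed simp
    finally show "norm (y t) \<le> K * (norm (y 0) + C) * exp (- c * t)" .
  qed
  moreover have "c \<le> a" using \<open>c \<le> b\<close> b by simp
  ultimately show ?case using \<open>0 \<le> K\<close> \<open>0 < c\<close> by blast
qed

text \<open>The list of factors is taken such that their product vanishes; then the condition on the
  product in \<open>forced_decay\<close> is trivial.\<close>

lemma hurwitz_decay:
  fixes M :: "real^'n^'n"
  assumes "hurwitz M" and "0 < a"
  obtains K b where "0 \<le> K" "0 < b" "b \<le> a"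
    and "\<And>y g C t. 0 \<le> C \<Longrightarrow> continuous_on {0..} y \<Longrightarrow>
      (\<And>t. 0 < t \<Longrightarrow> (y has_vector_derivative (M *v y t + g t)) (at t)) \<Longrightarrow>
      (\<And>t. 0 < t \<Longrightarrow> norm (g t) \<le> C * exp (- a * t)) \<Longrightarrow> 0 \<le> t \<Longrightarrow>
      norm (y t) \<le> K * (norm (y 0) + C) * exp (- b * t)"
proof -
  let ?M = "map_matrix complex_of_real M"
  obtain ls where ls: "\<And>v. shifts ?M ls v = 0" "\<And>l. l \<in> set ls \<Longrightarrow> Re l < 0"
    using hurwitz_annihilating_shifts[OF assms(1)] by blast
  obtain K b where K: "0 \<le> K" "0 < b" "b \<le> a" and decay: "forced_decay ?M ls a K b"
  proof -
    have "\<exists>K\<ge>0. \<exists>b>0. b \<le> a \<and> forced_decay ?M ls a K b"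
      by (rule shifts_decay[OF _ assms(2)]) (rule ls(2))
    then show ?thesis using that by blast
  qed
  define cv :: "real^'n \<Rightarrow> complex^'n" where "cv v = (\<chi> i. of_real (v $ i))" for v
  have cv_norm: "norm (cv v) = norm v" for v
    by (simp add: cv_def norm_vec_def)
  have cv_add: "cv (v + w) = cv v + cv w" for v w by (simp add: cv_def vec_eq_iff)
  have "cv (c *\<^sub>R v) = c *\<^sub>R cv v" for c v
    by (simp add: cv_def vec_eq_iff scaleR_conv_of_real[of c "of_real _ :: complex"])
  then have bl: "bounded_linear cv"
    by (intro linear_conv_bounded_linear[THEN iffD1] linearI cv_add)
  have cv_mult: "cv (M *v v) = ?M *v cv v" for v
    by (simp add: cv_def vec_eq_iff matrix_vector_mult_def)
  have "norm (y t) \<le> K * (norm (y 0) + C) * exp (- b * t)"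
    if C: "0 \<le> C" and y: "continuous_on {0..} y"
      and y': "\<And>t. 0 < t \<Longrightarrow> (y has_vector_derivative (M *v y t + g t)) (at t)"
      and g: "\<And>t. 0 < t \<Longrightarrow> norm (g t) \<le> C * exp (- a * t)" and "0 \<le> t" for y g C t
  proof -
    have "norm (cv (y t)) \<le> K * (norm (cv (y 0)) + C) * exp (- b * t)"
    proof (rule forced_decayD[OF decay C, where y = "\<lambda>t. cv (y t)" and g = "\<lambda>t. cv (g t)"])
      show "continuous_on {0..} (\<lambda>t. cv (y t))" by (rule bounded_linear.continuous_on[OF bl y])
      show "((\<lambda>t. cv (y t)) has_vector_derivative ?M *v cv (y t) + cv (g t)) (at t)" if "0 < t" for t
        using bounded_linear.has_vector_derivative[OF bl y'[OF that]] by (simp add: cv_add cv_mult)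
      show "norm (cv (g t)) \<le> C * exp (- a * t)" if "0 < t" for t using g[OF that] by (simp add: cv_norm)
      show "norm (shifts ?M ls (cv (y t))) \<le> C * exp (- a * t)" for t using C by (simp add: ls)
    qed fact
    then show ?thesis by (simp add: cv_norm)
  qed
  then show ?thesis using that[OF K] by blast
qed

section \<open>The kernel profiles\<close>

lemma matpow_0 [simp]: "matpow M 0 = mat 1"
  by (simp add: matpow_def)

lemma matpow_Suc: "matpow M (Suc k) = M ** matpow M k"
  by (simp add: matpow_def)

lemma matpow_Suc_right: "matpow M (Suc k) = matpow M k ** M"
proof (induction k)
  case 0
  show ?case by (simp add: matpow_Suc)
next
  case (Suc k)
  have "matpow M (Suc (Suc k)) = M ** (matpow M k ** M)"
    using Suc.IH by (simp add: matpow_Suc[of M "Suc k"])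
  also have "\<dots> = matpow M (Suc k) ** M"
    by (simp add: matrix_mul_assoc matpow_Suc)
  finally show ?case .
qed

lemma matpow_scaleR: "matpow (x *\<^sub>R M) k = x ^ k *\<^sub>R matpow M k"
  by (induction k) (simp_all add: matpow_Suc scalar_matrix_assoc matrix_scalar_ac mult.commute)

text \<open>The sum of the moduli of all entries is a submultiplicative norm. It dominates the entries
  of the exponential series by a scalar exponential series.\<close>

lemma matpow_entry_bound:
  fixes M :: "real^'n^'n"
  shows "\<bar>matpow M k $ i $ j\<bar> \<le> (\<Sum>i\<in>UNIV. \<Sum>j\<in>UNIV. \<bar>M $ i $ j\<bar>) ^ k"
proof (induction k arbitrary: i)
  case 0
  show ?case by (simp add: mat_def)
next
  case (Suc k)
  let ?b = "\<Sum>i\<in>UNIV. \<Sum>j\<in>UNIV. \<bar>M $ i $ j\<bar>"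
  have b: "0 \<le> ?b" by (intro sum_nonneg) auto
  have "\<bar>matpow M (Suc k) $ i $ j\<bar> \<le> (\<Sum>l\<in>UNIV. \<bar>M $ i $ l * matpow M k $ l $ j\<bar>)"
    by (simp add: matpow_Suc matrix_matrix_mult_def)
  also have "\<dots> \<le> (\<Sum>l\<in>UNIV. \<bar>M $ i $ l\<bar> * ?b ^ k)"
    using Suc.IH by (intro sum_mono) (simp add: abs_mult mult_left_mono)
  also have "\<dots> = (\<Sum>l\<in>UNIV. \<bar>M $ i $ l\<bar>) * ?b ^ k"
    by (simp add: sum_distrib_right)
  also have "\<dots> \<le> ?b * ?b ^ k"
    using b by (intro mult_right_mono member_le_sum[where f = "\<lambda>i. \<Sum>l\<in>UNIV. \<bar>M $ i $ l\<bar>"])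
      (auto intro: sum_nonneg)
  finally show ?case by simp
qed

lemma mexp_entry_summable:
  fixes M :: "real^'n^'n"
  shows "summable (\<lambda>k. matpow M k $ i $ j / fact k * x ^ k)"
proof (rule summable_comparison_test)
  let ?b = "\<Sum>i\<in>UNIV. \<Sum>j\<in>UNIV. \<bar>M $ i $ j\<bar>"
  show "summable (\<lambda>k. (?b * \<bar>x\<bar>) ^ k /\<^sub>R fact k)" by (rule summable_exp_generic)
  have "norm (matpow M k $ i $ j / fact k * x ^ k) \<le> (?b * \<bar>x\<bar>) ^ k /\<^sub>R fact k" for k
  proof -
    have "\<bar>matpow M k $ i $ j\<bar> * (\<bar>x\<bar> ^ k / fact k) \<le> ?b ^ k * (\<bar>x\<bar> ^ k / fact k)"
      by (intro mult_right_mono matpow_entry_bound) auto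
    then show ?thesis by (simp add: abs_mult power_mult_distrib power_abs divide_inverse mult_ac)
  qed
  then show "\<exists>N. \<forall>k\<ge>N. norm (matpow M k $ i $ j / fact k * x ^ k) \<le> (?b * \<bar>x\<bar>) ^ k /\<^sub>R fact k"
    by blast
qed

text \<open>Entries of the exponential are ordinary power series in \<open>x\<close>, which can be differentiated
  term by term.\<close>

lemma mexp_scaleR_entry:
  fixes M :: "real^'n^'n"
  shows "mexp (x *\<^sub>R M) $ i $ j = (\<Sum>k. matpow M k $ i $ j / fact k * x ^ k)"
proof -
  define E :: "real^'n^'n" where "E = (\<chi> i j. \<Sum>k. matpow M k $ i $ j / fact k * x ^ k)"
  have "(\<lambda>n. \<Sum>k<n. (1 / fact k) *\<^sub>R matpow (x *\<^sub>R M) k) \<longlonglongrightarrow> E"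
  proof (intro vec_tendstoI)
    fix i j
    have "(\<lambda>n. \<Sum>k<n. matpow M k $ i $ j / fact k * x ^ k) \<longlonglongrightarrow> E $ i $ j"
      using summable_LIMSEQ[OF mexp_entry_summable[of M i j x]] by (simp add: E_def)
    moreover have "(\<Sum>k<n. (1 / fact k) *\<^sub>R matpow (x *\<^sub>R M) k) $ i $ j
        = (\<Sum>k<n. matpow M k $ i $ j / fact k * x ^ k)" for n
      by (simp add: matpow_scaleR mult.commute)
    ultimately show "(\<lambda>n. (\<Sum>k<n. (1 / fact k) *\<^sub>R matpow (x *\<^sub>R M) k) $ i $ j) \<longlonglongrightarrow> E $ i $ j"
      by simp
  qed
  then have "mexp (x *\<^sub>R M) = E"
    unfolding mexp_def by (intro sums_unique[symmetric]) (simp add: sums_def)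
  then show ?thesis by (simp add: E_def)
qed

lemma mexp_0: "mexp 0 = mat 1"
proof -
  have "mexp (0 *\<^sub>R (0 :: real^'a^'a)) $ i $ j = (mat 1 :: real^'a^'a) $ i $ j" for i j
    unfolding mexp_scaleR_entry by (subst powser_zero) simp
  then show ?thesis by (simp add: vec_eq_iff)
qed

lemma mexp_entry_DERIV:
  fixes M :: "real^'n^'n"
  shows "((\<lambda>x. mexp (x *\<^sub>R M) $ i $ j) has_real_derivative (mexp (x *\<^sub>R M) ** M) $ i $ j) (at x)"
proof -
  let ?c = "\<lambda>l j k. matpow M k $ l $ j / fact k"
  have "((\<lambda>x. \<Sum>k. ?c i j k * x ^ k) has_real_derivative (\<Sum>k. diffs (?c i j) k * x ^ k)) (at x)"
    by (rule termdiffs_strong_converges_everywhere) (rule mexp_entry_summable)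
  moreover have "diffs (?c i j) k * x ^ k = (\<Sum>l\<in>UNIV. (?c i l k * x ^ k) * M $ l $ j)" for k
  proof -
    have "diffs (?c i j) k = matpow M (Suc k) $ i $ j / fact k"
      by (simp add: diffs_def del: of_nat_Suc)
    also have "\<dots> = (\<Sum>l\<in>UNIV. ?c i l k * M $ l $ j)"
      by (simp add: matpow_Suc_right matrix_matrix_mult_def sum_divide_distrib)
    finally show ?thesis by (simp add: sum_distrib_left mult_ac)
  qed
  then have "(\<Sum>k. diffs (?c i j) k * x ^ k) = (\<Sum>k. \<Sum>l\<in>UNIV. (?c i l k * x ^ k) * M $ l $ j)"
    by (simp only:)
  also have "\<dots> = (\<Sum>l\<in>UNIV. \<Sum>k. (?c i l k * x ^ k) * M $ l $ j)"
    by (intro suminf_sum summable_mult2 mexp_entry_summable)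
  also have "\<dots> = (\<Sum>l\<in>UNIV. (\<Sum>k. ?c i l k * x ^ k) * M $ l $ j)"
    by (intro sum.cong refl suminf_mult2[symmetric] mexp_entry_summable)
  also have "\<dots> = (mexp (x *\<^sub>R M) ** M) $ i $ j"
    by (simp add: matrix_matrix_mult_def mexp_scaleR_entry)
  ultimately show ?thesis by (simp add: mexp_scaleR_entry)
qed

lemma row_mexp_DERIV:
  fixes M :: "real^'n^'n" and N :: "real^'k^'n"
  shows "((\<lambda>x. (r v* mexp (x *\<^sub>R M) v* N) $ j) has_real_derivative
      (r v* mexp (x *\<^sub>R M) v* (M ** N)) $ j) (at x)"
proof -
  have expand: "(r v* A v* N) $ j = (\<Sum>l\<in>UNIV. (\<Sum>i\<in>UNIV. r $ i * A $ i $ l) * N $ l $ j)"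
    for A :: "real^'n^'n"
    by (simp add: vector_matrix_mult_def mult.commute)
  have "r v* mexp (x *\<^sub>R M) v* (M ** N) = r v* (mexp (x *\<^sub>R M) ** M) v* N"
    by (simp add: vector_matrix_mul_assoc matrix_mul_assoc)
  then show ?thesis
    unfolding expand
    by (simp only: expand) (intro DERIV_sum DERIV_cmult DERIV_cmult_right mexp_entry_DERIV)
qed

lemma has_vector_derivative_vecI:
  fixes f :: "real \<Rightarrow> real^'n"
  assumes "\<And>i. ((\<lambda>x. f x $ i) has_real_derivative f' $ i) (at x within S)"
  shows "(f has_vector_derivative f') (at x within S)"
  unfolding has_vector_derivative_def
proof (rule has_derivative_componentwise_within[THEN iffD2], rule ballI)
  fix b :: "real^'n" assume "b \<in> Basis"
  then obtain i where b: "b = axis i 1" by (auto simp: Basis_vec_def)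
  show "((\<lambda>x. f x \<bullet> b) has_derivative (\<lambda>h. (h *\<^sub>R f') \<bullet> b)) (at x within S)"
    using assms[of i] by (simp add: b inner_axis has_field_derivative_def mult_commute_abs)
qed

text \<open>The \<open>i\<close>-th derivative of \<open>x \<mapsto> r exp (x F) [I, 0]\<^sup>T\<close>; every derivative inserts one factor \<open>F\<close>.
  Both \<open>\<vartheta>\<close> and \<open>\<theta>\<close> are of this form with \<open>i = 0\<close>.\<close>

definition profile :: "real \<Rightarrow> real^'a^'a \<Rightarrow> real^('a + 'a) \<Rightarrow> nat \<Rightarrow> real \<Rightarrow> real^'a" where
  "profile q M r i x = r v* mexp (x *\<^sub>R F_mat q M) v* (matpow (F_mat q M) i ** col_I0)"

lemma profile_DERIV:
  "((\<lambda>x. profile q M r i x $ j) has_real_derivative profile q M r (Suc i) x $ j) (at x)"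
  using row_mexp_DERIV[of r "F_mat q M" "matpow (F_mat q M) i ** col_I0" j x]
  by (simp add: profile_def matpow_Suc matrix_mul_assoc)

lemma profile_has_vector_derivative:
  "(profile q M r i has_vector_derivative profile q M r (Suc i) x) (at x within S)"
  by (intro has_vector_derivative_vecI has_field_derivative_at_within[OF profile_DERIV])

lemma sum_UNIV_Plus:
  fixes f :: "'a::finite + 'b::finite \<Rightarrow> 'c::comm_monoid_add"
  shows "(\<Sum>i\<in>UNIV. f i) = (\<Sum>a\<in>UNIV. f (Inl a)) + (\<Sum>b\<in>UNIV. f (Inr b))"
  by (subst UNIV_Plus_UNIV[symmetric], subst sum.Plus) simp_all

text \<open>This identity is the reason for the shape of \<open>F\<close>: its square is block diagonal with
  blocks \<open>M / q\<close>, which turns the first-order system into \<open>q f'' = f M\<close>.\<close>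

lemma F_mat_square_col: "F_mat q M ** (F_mat q M ** col_I0) = col_I0 ** ((1 / q) *\<^sub>R M)"
proof -
  have "(F_mat q M ** (F_mat q M ** col_I0)) $ i $ j = (col_I0 ** ((1 / q) *\<^sub>R M)) $ i $ j" for i j
    by (cases i) (simp_all add: F_mat_def block_mat_def col_I0_def matrix_matrix_mult_def sum_UNIV_Plus
        mat_def if_distrib if_distribR sum.delta sum.delta' cong: if_cong)
  then show ?thesis by (simp add: vec_eq_iff)
qed

lemma profile_second_derivative: "profile q M r (Suc (Suc 0)) x = profile q M r 0 x v* ((1 / q) *\<^sub>R M)"
  unfolding profile_def matpow_Suc
  by (simp add: vector_matrix_mul_assoc matrix_mul_assoc[symmetric] F_mat_square_col)

lemma join_vec_eq: "join_vec v w = v v* transpose col_I0 + w v* transpose col_0I"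
proof -
  have "join_vec v w $ i = (v v* transpose col_I0 + w v* transpose col_0I) $ i" for i
    by (cases i) (simp_all add: join_vec_def vector_matrix_mult_def col_I0_def col_0I_def transpose_def
        mat_def if_distrib if_distribR sum.delta sum.delta' cong: if_cong)
  then show ?thesis by (simp add: vec_eq_iff)
qed

lemma vector_matrix_add_left: "(v + w) v* A = v v* A + w v* (A :: real^'b^'a)"
  by (simp add: vector_matrix_mult_def vec_eq_iff sum.distrib algebra_simps)

lemma vector_matrix_neg: "(- v) v* A = - (v v* (A :: real^'b^'a))"
  by (simp add: vector_matrix_mult_def vec_eq_iff sum_negf)

lemma profile_at_0: "profile q M (join_vec v w) 0 0 = v"
proof -
  have "profile q M (join_vec v w) 0 0 = join_vec v w v* col_I0"
    by (simp add: profile_def mexp_0)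
  also have "\<dots> = v"
    by (simp add: vec_eq_iff vector_matrix_mult_def col_I0_def join_vec_def sum_UNIV_Plus
        mat_def if_distrib if_distribR sum.delta sum.delta' cong: if_cong)
  finally show ?thesis .
qed

text \<open>With \<open>v = 0\<close>, or with the first summand cancelled by the choice of \<open>w\<close>, a factor \<open>G\<inverse>\<close> in \<open>w\<close>
  prescribes the value at \<open>1\<close>.\<close>

lemma profile_at_1:
  "profile q M (join_vec v w) 0 1
    = v v* (transpose col_I0 ** mexp (F_mat q M) ** col_I0) + w v* G_mat q M"
  by (simp only: profile_def scaleR_one matpow_0 matrix_mul_lid join_vec_eq vector_matrix_add_left
      vector_matrix_mul_assoc G_mat_def matrix_mul_assoc)

lemma vtheta_eq_profile:
  "vtheta q abar = profile q (companion abar) (join_vec 0 (- (C_z v* matrix_inv (G_mat q (companion abar))))) 0"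
  by (rule ext) (simp add: vtheta_def profile_def)

lemma theta_eq_profile:
  "theta q A C_X = profile q A (join_vec (- C_X)
       (C_X v* (transpose col_I0 ** mexp (F_mat q A) ** col_I0) v* matrix_inv (G_mat q A))) 0"
  by (rule ext) (simp add: theta_def profile_def)

lemma matrix_inv_left: "invertible M \<Longrightarrow> matrix_inv M ** M = mat 1"
  unfolding invertible_def matrix_inv_def by (drule someI_ex) blast

lemma vtheta_boundary:
  assumes "invertible (G_mat q (companion abar))"
  shows "vtheta q abar 0 = 0" "vtheta q abar 1 = - C_z"
  using matrix_inv_left[OF assms]
  by (simp_all add: vtheta_eq_profile profile_at_0 profile_at_1 vector_matrix_neg vector_matrix_mul_assoc)

lemma theta_boundary:
  assumes "invertible (G_mat q A)"
  shows "theta q A C_X 0 = - C_X" "theta q A C_X 1 = 0"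
  using matrix_inv_left[OF assms]
  by (simp_all add: theta_eq_profile profile_at_0 profile_at_1 vector_matrix_neg vector_matrix_mul_assoc
      matrix_mul_assoc[symmetric])

section \<open>Weak derivatives and Sobolev norms on the unit interval\<close>

abbreviation unit_lebesgue :: "real measure" where
  "unit_lebesgue \<equiv> lebesgue_on {0<..<1}"

abbreviation unit_integral :: "(real \<Rightarrow> real) \<Rightarrow> real" where
  "unit_integral \<equiv> integral\<^sup>L unit_lebesgue"

lemma finite_measure_unit_lebesgue: "finite_measure unit_lebesgue"
  by (rule finite_measureI) (simp add: emeasure_restrict_space space_restrict_space)

lemma unit_lebesgue_continuous:
  fixes h :: "real \<Rightarrow> real"
  assumes "continuous_on {0..1} h"
  shows "integrable unit_lebesgue h" "unit_integral h = integral {0..1} h"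
proof -
  have "set_integrable lebesgue {0..1} h"
    using continuous_imp_integrable_real[OF assms]
    by (simp add: set_integrable_def integrable_restrict_space)
  then have "set_integrable lebesgue {0<..<1} h"
    by (rule set_integrable_subset) auto
  then show i: "integrable unit_lebesgue h"
    by (simp add: set_integrable_def integrable_restrict_space)
  show "unit_integral h = integral {0..1} h"
    using lebesgue_integral_eq_integral[OF i] by (simp add: integral_open_interval_real)
qed

lemma L2_01_D:
  assumes "f \<in> L2_01"
  shows "f \<in> borel_measurable unit_lebesgue" "integrable unit_lebesgue (\<lambda>x. (f x)\<^sup>2)"
  using assms by (auto simp: L2_01_def)

lemma L2_01_mult_integrable:
  assumes "f \<in> L2_01" "g \<in> L2_01"
  shows "integrable unit_lebesgue (\<lambda>x. f x * g x)"
proof (rule Bochner_Integration.integrable_bound)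
  show "integrable unit_lebesgue (\<lambda>x. (f x)\<^sup>2 + (g x)\<^sup>2)"
    using assms by (intro Bochner_Integration.integrable_add L2_01_D)
  show "(\<lambda>x. f x * g x) \<in> borel_measurable unit_lebesgue"
    using assms by (intro borel_measurable_times L2_01_D)
  have "\<bar>a * b\<bar> \<le> a\<^sup>2 + b\<^sup>2" for a b :: real
  proof -
    have "2 * (\<bar>a\<bar> * \<bar>b\<bar>) \<le> a\<^sup>2 + b\<^sup>2"
      using sum_squares_bound[of "\<bar>a\<bar>" "\<bar>b\<bar>"] by simp
    moreover have "0 \<le> \<bar>a\<bar> * \<bar>b\<bar>" by simp
    ultimately show ?thesis unfolding abs_mult by linarith
  qed
  then show "AE x in unit_lebesgue. norm (f x * g x) \<le> norm ((f x)\<^sup>2 + (g x)\<^sup>2)"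
    by simp
qed

lemma L2_01_continuous:
  assumes "continuous_on {0..1} f"
  shows "f \<in> L2_01"
  using unit_lebesgue_continuous(1)[OF assms] unit_lebesgue_continuous(1)[OF continuous_on_power[OF assms, of 2]]
  by (auto simp: L2_01_def)

lemma L2_01_integrable: "f \<in> L2_01 \<Longrightarrow> integrable unit_lebesgue f"
  using L2_01_mult_integrable[of f "\<lambda>x. 1"] L2_01_continuous[of "\<lambda>x. 1"] by simp

lemma L2_01_lincomb:
  assumes "f \<in> L2_01" "g \<in> L2_01"
  shows "(\<lambda>x. a * f x + b * g x) \<in> L2_01"
proof -
  have "(\<lambda>x. a * f x + b * g x) \<in> borel_measurable unit_lebesgue"
    using assms by (intro borel_measurable_add borel_measurable_times borel_measurable_const) (auto simp: L2_01_def)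
  moreover have "integrable unit_lebesgue (\<lambda>x. a\<^sup>2 * (f x)\<^sup>2 + b\<^sup>2 * (g x)\<^sup>2 + 2 * a * b * (f x * g x))"
    using assms by (intro Bochner_Integration.integrable_add integrable_mult_right L2_01_mult_integrable L2_01_D)
  ultimately show ?thesis
    by (simp add: L2_01_def power2_sum power_mult_distrib mult_ac)
qed

lemma L2_norm_nonneg: "0 \<le> L2_norm f"
  by (simp add: L2_norm_def)

lemma L2_norm_square: "(L2_norm f)\<^sup>2 = unit_integral (\<lambda>x. (f x)\<^sup>2)"
  by (simp add: L2_norm_def)

lemma L2_norm_scale: "L2_norm (\<lambda>x. c * f x) = \<bar>c\<bar> * L2_norm f"
  by (simp add: L2_norm_def power_mult_distrib real_sqrt_mult)

lemma L2_norm_cong_AE: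
  assumes "f \<in> L2_01" "g \<in> L2_01" "AE x in unit_lebesgue. f x = g x"
  shows "L2_norm f = L2_norm g"
proof -
  have "unit_integral (\<lambda>x. (f x)\<^sup>2) = unit_integral (\<lambda>x. (g x)\<^sup>2)"
    using assms by (intro integral_cong_AE) (auto simp: L2_01_def)
  then show ?thesis by (simp add: L2_norm_def)
qed

text \<open>The quadratic form \<open>\<integral> (s f + t g)\<^sup>2\<close> in \<open>s\<close> and \<open>t\<close> is nonnegative, which bounds its mixed
  coefficient.\<close>

lemma L2_cauchy_schwarz:
  assumes f: "f \<in> L2_01" and g: "g \<in> L2_01"
  shows "\<bar>unit_integral (\<lambda>x. f x * g x)\<bar> \<le> L2_norm f * L2_norm g"
proof -
  let ?a = "unit_integral (\<lambda>x. (f x)\<^sup>2)"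
  let ?b = "unit_integral (\<lambda>x. f x * g x)"
  let ?c = "unit_integral (\<lambda>x. (g x)\<^sup>2)"
  have quad: "0 \<le> s\<^sup>2 * ?a + 2 * s * t * ?b + t\<^sup>2 * ?c" for s t
  proof -
    have "0 \<le> unit_integral (\<lambda>x. (s * f x + t * g x)\<^sup>2)" by simp
    also have "(\<lambda>x. (s * f x + t * g x)\<^sup>2)
        = (\<lambda>x. s\<^sup>2 * (f x)\<^sup>2 + 2 * s * t * (f x * g x) + t\<^sup>2 * (g x)\<^sup>2)"
      by (simp add: power2_sum power_mult_distrib algebra_simps)
    also have "unit_integral \<dots> = s\<^sup>2 * ?a + 2 * s * t * ?b + t\<^sup>2 * ?c"
      using L2_01_D[OF f] L2_01_D[OF g] L2_01_mult_integrable[OF f g] by simp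
    finally show ?thesis .
  qed
  have "?b\<^sup>2 \<le> ?a * ?c"
  proof (cases "?c = 0")
    case True
    have "0 \<le> ?a + 2 * t * ?b" for t using quad[of 1 t] True by simp
    from this[of "- (?a + 1) / (2 * ?b)"] have "?b = 0"
      by (cases "?b = 0") (auto simp: field_simps)
    then show ?thesis using True by simp
  next
    case False
    then have "0 < ?c" by (simp add: less_le)
    have "0 \<le> ?c\<^sup>2 * ?a + 2 * ?c * (- ?b) * ?b + (- ?b)\<^sup>2 * ?c" by (rule quad)
    also have "\<dots> = ?c * (?a * ?c - ?b\<^sup>2)" by (simp add: power2_eq_square algebra_simps)
    finally show ?thesis using \<open>0 < ?c\<close> by (simp add: zero_le_mult_iff)
  qed
  then have "sqrt (?b\<^sup>2) \<le> sqrt (?a * ?c)" by (rule real_sqrt_le_mono)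
  then show ?thesis by (simp add: L2_norm_def real_sqrt_mult)
qed

lemma L2_norm_triangle:
  assumes f: "f \<in> L2_01" and g: "g \<in> L2_01"
  shows "L2_norm (\<lambda>x. f x + g x) \<le> L2_norm f + L2_norm g"
proof (rule power2_le_imp_le)
  have "(L2_norm (\<lambda>x. f x + g x))\<^sup>2
      = unit_integral (\<lambda>x. (f x)\<^sup>2 + (g x)\<^sup>2 + 2 * (f x * g x))"
    by (simp add: L2_norm_square power2_sum mult.assoc)
  also have "\<dots> = (L2_norm f)\<^sup>2 + (L2_norm g)\<^sup>2 + 2 * unit_integral (\<lambda>x. f x * g x)"
    using L2_01_D[OF f] L2_01_D[OF g] L2_01_mult_integrable[OF f g] by (simp add: L2_norm_square)
  also have "\<dots> \<le> (L2_norm f + L2_norm g)\<^sup>2"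
    using L2_cauchy_schwarz[OF f g] by (simp add: power2_sum)
  finally show "(L2_norm (\<lambda>x. f x + g x))\<^sup>2 \<le> (L2_norm f + L2_norm g)\<^sup>2" .
qed (simp add: L2_norm_nonneg)

text \<open>A function that rises from \<open>0\<close> on the negative axis towards \<open>1\<close>; squaring the positive part makes
  it continuously differentiable. Products of scaled ramps are the test functions that approximate
  the indicator of an interval.\<close>

definition ramp :: "real \<Rightarrow> real" where
  "ramp y = (max 0 y)\<^sup>2 / (1 + (max 0 y)\<^sup>2)"

definition ramp' :: "real \<Rightarrow> real" where
  "ramp' y = 2 * max 0 y / (1 + (max 0 y)\<^sup>2)\<^sup>2"

lemma DERIV_max_square: "((\<lambda>y. (max 0 y)\<^sup>2) has_real_derivative 2 * max 0 y) (at (y::real))"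
proof (cases "y = 0")
  case False
  show ?thesis
  proof (cases "y > 0")
    case True
    have "((\<lambda>y. y\<^sup>2) has_real_derivative 2 * max 0 y) (at y)"
      using True by (auto intro!: derivative_eq_intros)
    then show ?thesis
      by (rule has_field_derivative_transform_within_open[where S = "{0<..}"]) (use True in auto)
  next
    case f: False
    have "((\<lambda>y. 0) has_real_derivative 2 * max 0 y) (at y)"
      using f by (auto intro!: derivative_eq_intros)
    then show ?thesis
      by (rule has_field_derivative_transform_within_open[where S = "{..<0}"]) (use f False in auto)
  qed
next
  case True
  have "((\<lambda>h. ((max 0 (0 + h))\<^sup>2 - (max 0 0)\<^sup>2) / h) \<longlongrightarrow> 0) (at (0::real))"
  proof (rule Lim_null_comparison[where g = "\<lambda>h. \<bar>h\<bar>"])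
    show "\<forall>\<^sub>F h in at (0::real). norm (((max 0 (0 + h))\<^sup>2 - (max 0 0)\<^sup>2) / h) \<le> \<bar>h\<bar>"
      by (intro always_eventually) (auto simp: max_def power2_eq_square)
    show "((\<lambda>h. \<bar>h\<bar>) \<longlongrightarrow> 0) (at (0::real))"
      using tendsto_rabs[OF tendsto_ident_at[of "0::real"]] by simp
  qed
  then show ?thesis using True by (simp add: DERIV_def)
qed

lemma one_plus_square_pos: "0 < 1 + (z::real)\<^sup>2" "1 + z\<^sup>2 \<noteq> 0"
  by (auto simp: add_pos_nonneg add_nonneg_eq_0_iff)

lemma DERIV_ramp: "(ramp has_real_derivative ramp' y) (at y)"
proof -
  have "((\<lambda>y. (max 0 y)\<^sup>2 / (1 + (max 0 y)\<^sup>2)) has_real_derivative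
     (2 * max 0 y * (1 + (max 0 y)\<^sup>2) - (max 0 y)\<^sup>2 * (0 + 2 * max 0 y)) / ((1 + (max 0 y)\<^sup>2) * (1 + (max 0 y)\<^sup>2))) (at y)"
    by (intro DERIV_divide DERIV_add DERIV_const DERIV_max_square one_plus_square_pos)
  moreover have "(2 * max 0 y * (1 + (max 0 y)\<^sup>2) - (max 0 y)\<^sup>2 * (0 + 2 * max 0 y)) / ((1 + (max 0 y)\<^sup>2) * (1 + (max 0 y)\<^sup>2)) = ramp' y"
    unfolding ramp'_def by (simp add: power2_eq_square algebra_simps)
  ultimately show ?thesis by (simp add: ramp_def[abs_def])
qed

lemma continuous_on_ramp': "continuous_on S ramp'"
  unfolding ramp'_def by (intro continuous_intros) (auto simp: one_plus_square_pos)

lemma ramp_bounds: "0 \<le> ramp y" "ramp y \<le> 1"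
  by (auto simp: ramp_def divide_le_eq_1 add_pos_nonneg)

lemma ramp_nonpos: "y \<le> 0 \<Longrightarrow> ramp y = 0"
  by (simp add: ramp_def)

lemma ramp_scaled_tendsto:
  assumes "0 < y"
  shows "(\<lambda>n. ramp (real n * y)) \<longlonglongrightarrow> 1"
proof -
  have "(\<lambda>n. 1 - inverse (1 + (real n * y)\<^sup>2)) \<longlonglongrightarrow> 1 - 0"
  proof (intro tendsto_diff tendsto_const tendsto_inverse_0_at_top)
    have "filterlim (\<lambda>n. y * real n) at_top sequentially"
      using assms by (intro filterlim_tendsto_pos_mult_at_top[OF tendsto_const] filterlim_real_sequentially)
    then have "filterlim (\<lambda>n. (real n * y)\<^sup>2) at_top sequentially"
      by (intro filterlim_pow_at_top) (auto simp: mult.commute)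
    then show "filterlim (\<lambda>n. 1 + (real n * y)\<^sup>2) at_top sequentially"
      by (rule filterlim_tendsto_add_at_top[OF tendsto_const])
  qed
  moreover have "ramp (real n * y) = 1 - inverse (1 + (real n * y)\<^sup>2)" for n
    using assms one_plus_square_pos[of "real n * y"]
    by (simp add: ramp_def max_def field_simps)
  ultimately show ?thesis by simp
qed

definition bump :: "real \<Rightarrow> real \<Rightarrow> nat \<Rightarrow> real \<Rightarrow> real" where
  "bump a b n x = ramp (real n * (x - a)) * ramp (real n * (b - x))"

definition bump' :: "real \<Rightarrow> real \<Rightarrow> nat \<Rightarrow> real \<Rightarrow> real" where
  "bump' a b n x = real n * ramp' (real n * (x - a)) * ramp (real n * (b - x))
     - ramp (real n * (x - a)) * (real n * ramp' (real n * (b - x)))"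

lemma DERIV_bump: "(bump a b n has_real_derivative bump' a b n x) (at x)"
proof -
  have l: "((\<lambda>x. ramp (real n * (x - a))) has_real_derivative real n * ramp' (real n * (x - a))) (at x)"
    by (rule DERIV_chain2[OF DERIV_ramp, of "\<lambda>x. real n * (x - a)" "real n", THEN DERIV_cong])
       (auto intro!: derivative_eq_intros)
  have r: "((\<lambda>x. ramp (real n * (b - x))) has_real_derivative - (real n * ramp' (real n * (b - x)))) (at x)"
    by (rule DERIV_chain2[OF DERIV_ramp, of "\<lambda>x. real n * (b - x)" "- real n", THEN DERIV_cong])
       (auto intro!: derivative_eq_intros)
  show ?thesis
    using DERIV_mult[OF l r] by (simp add: bump_def[abs_def] bump'_def algebra_simps)
qed

lemma continuous_on_bump': "continuous_on S (bump' a b n)"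
proof -
  have r: "continuous_on A ramp" for A
    by (intro DERIV_continuous_on[of _ _ ramp'] has_field_derivative_at_within[OF DERIV_ramp])
  have "continuous_on S (\<lambda>x. ramp (real n * (x - a)))" "continuous_on S (\<lambda>x. ramp (real n * (b - x)))"
    "continuous_on S (\<lambda>x. ramp' (real n * (x - a)))" "continuous_on S (\<lambda>x. ramp' (real n * (b - x)))"
    by (rule continuous_on_compose2[OF r[of UNIV]] continuous_on_compose2[OF continuous_on_ramp'[of UNIV]];
        auto intro!: continuous_intros)+
  then show ?thesis unfolding bump'_def by (intro continuous_intros)
qed

lemma borel_measurable_indicator_unit:
  "A \<in> sets borel \<Longrightarrow> (indicator A :: real \<Rightarrow> real) \<in> borel_measurable unit_lebesgue"
  by (intro measurable_restrict_space1 borel_measurable_indicator) simp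

text \<open>The bumps are admissible test functions, are bounded by \<open>1\<close>, and converge pointwise to
  the indicator of the open interval; dominated convergence gives the claim.\<close>

lemma test_function_zero_imp_interval_zero:
  assumes g: "g \<in> L2_01"
    and test: "\<And>\<phi> \<phi>' a b. 0 < a \<Longrightarrow> a < b \<Longrightarrow> b < 1 \<Longrightarrow> (\<And>x. x \<notin> {a..b} \<Longrightarrow> \<phi> x = 0) \<Longrightarrow>
        (\<And>x. (\<phi> has_real_derivative \<phi>' x) (at x)) \<Longrightarrow> continuous_on UNIV \<phi>' \<Longrightarrow>
        unit_integral (\<lambda>x. g x * \<phi> x) = 0"
    and ab: "0 < a" "a < b" "b < 1"
  shows "unit_integral (\<lambda>x. indicator {a<..<b} x * g x) = 0"
proof -
  have "(\<lambda>n. unit_integral (\<lambda>x. bump a b n x * g x))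
      \<longlonglongrightarrow> unit_integral (\<lambda>x. indicator {a<..<b} x * g x)"
  proof (rule integral_dominated_convergence)
    show "integrable unit_lebesgue (\<lambda>x. norm (g x))"
      using L2_01_integrable[OF g] by simp
    have "continuous_on UNIV (bump a b n)" for n
      by (intro DERIV_continuous_on[of _ _ "bump' a b n"] has_field_derivative_at_within[OF DERIV_bump])
    then have "bump a b n \<in> borel_measurable borel" for n
      by (rule borel_measurable_continuous_onI)
    then show "(\<lambda>x. bump a b n x * g x) \<in> borel_measurable unit_lebesgue" for n
      using L2_01_D(1)[OF g]
      by (intro borel_measurable_times) (auto simp: measurable_restrict_space1 measurable_completion)
    show "(\<lambda>x. indicator {a<..<b} x * g x) \<in> borel_measurable unit_lebesgue"
      using L2_01_D(1)[OF g]
      by (intro borel_measurable_times borel_measurable_indicator_unit) auto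
    show "AE x in unit_lebesgue. (\<lambda>n. bump a b n x * g x) \<longlonglongrightarrow> indicator {a<..<b} x * g x"
    proof (rule AE_I2, rule tendsto_mult[OF _ tendsto_const])
      fix x :: real
      show "(\<lambda>n. bump a b n x) \<longlonglongrightarrow> indicator {a<..<b} x"
      proof (cases "x \<in> {a<..<b}")
        case True
        then have "(\<lambda>n. bump a b n x) \<longlonglongrightarrow> 1 * 1"
          unfolding bump_def by (intro tendsto_mult ramp_scaled_tendsto) auto
        then show ?thesis using True by simp
      next
        case False
        then have "bump a b n x = 0" for n
          by (auto simp: bump_def ramp_nonpos mult_nonneg_nonpos not_less)
        then show ?thesis using False by simp
      qed
    qed
    show "AE x in unit_lebesgue. norm (bump a b n x * g x) \<le> norm (g x)" for n
    proof (rule AE_I2)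
      fix x :: real
      have "0 \<le> bump a b n x" "bump a b n x \<le> 1"
        unfolding bump_def by (intro mult_nonneg_nonneg mult_le_one ramp_bounds)+
      then show "norm (bump a b n x * g x) \<le> norm (g x)"
        by (simp add: abs_mult mult_left_le_one_le)
    qed
  qed
  moreover have "unit_integral (\<lambda>x. bump a b n x * g x) = 0" for n
  proof -
    have "unit_integral (\<lambda>x. g x * bump a b n x) = 0"
    proof (rule test[OF ab])
      show "bump a b n x = 0" if "x \<notin> {a..b}" for x
        using that by (auto simp: bump_def ramp_nonpos mult_nonneg_nonpos not_le less_imp_le)
    qed (rule DERIV_bump, rule continuous_on_bump')
    then show ?thesis by (simp add: mult.commute)
  qed
  ultimately show ?thesis by (simp add: LIMSEQ_const_iff)
qed

text \<open>Test functions have their support inside the open unit interval, so intervals that touch an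
  end point are reached by exhaustion from inside.\<close>

lemma interval_zero_closed:
  assumes g: "g \<in> L2_01"
    and int: "\<And>a b. 0 < a \<Longrightarrow> a < b \<Longrightarrow> b < 1 \<Longrightarrow>
        unit_integral (\<lambda>x. indicator {a<..<b} x * g x) = 0"
    and ab: "0 \<le> a" "a < b" "b \<le> 1"
  shows "unit_integral (\<lambda>x. indicator {a<..<b} x * g x) = 0"
proof -
  \<comment> \<open>The summand \<open>3\<close> keeps the shrunken intervals nonempty.\<close>
  define c where "c n = (b - a) * inverse (real (n + 3))" for n
  have c_lim: "c \<longlonglongrightarrow> 0"
  proof -
    have "(\<lambda>n. inverse (real (n + 3))) \<longlonglongrightarrow> 0"
      using LIMSEQ_ignore_initial_segment[OF lim_inverse_n, of 3] by simp
    from tendsto_mult_right_zero[OF this, of "b - a"] show ?thesis by (simp add: c_def[abs_def])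
  qed
  have c: "0 < c n" "2 * c n < b - a" for n
  proof -
    have "0 < (b - a) * inverse (real (n + 3))" using ab by simp
    moreover have "(b - a) * (2 * inverse (real (n + 3))) < (b - a) * 1"
      using ab by (intro mult_strict_left_mono) (auto simp: field_simps)
    moreover have "2 * c n = (b - a) * (2 * inverse (real (n + 3)))"
      unfolding c_def by (rule mult.left_commute)
    ultimately show "0 < c n" "2 * c n < b - a" by (simp_all only: c_def mult_1_right)
  qed
  have meas: "(\<lambda>x. indicator {a<..<b} x * g x) \<in> borel_measurable unit_lebesgue" for a b
    using L2_01_D(1)[OF g]
    by (intro borel_measurable_times borel_measurable_indicator_unit) auto
  have "(\<lambda>n. unit_integral (\<lambda>x. indicator {a + c n<..<b - c n} x * g x))
      \<longlonglongrightarrow> unit_integral (\<lambda>x. indicator {a<..<b} x * g x)"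
  proof (rule integral_dominated_convergence)
    show "integrable unit_lebesgue (\<lambda>x. norm (g x))"
      using L2_01_integrable[OF g] by simp
    show "(\<lambda>x. indicator {a<..<b} x * g x) \<in> borel_measurable unit_lebesgue"
      "\<And>n. (\<lambda>x. indicator {a + c n<..<b - c n} x * g x) \<in> borel_measurable unit_lebesgue"
      by (rule meas)+
    show "AE x in unit_lebesgue. (\<lambda>n. indicator {a + c n<..<b - c n} x * g x) \<longlonglongrightarrow> indicator {a<..<b} x * g x"
    proof (rule AE_I2, rule tendsto_mult[OF _ tendsto_const], rule tendsto_eventually)
      fix x :: real
      show "\<forall>\<^sub>F n in sequentially. indicator {a + c n<..<b - c n} x = (indicator {a<..<b} x :: real)"
      proof (cases "x \<in> {a<..<b}")
        case True
        have "\<forall>\<^sub>F n in sequentially. c n < min (x - a) (b - x)"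
          by (rule order_tendstoD[OF c_lim]) (use True in auto)
        then show ?thesis by eventually_elim (use True in \<open>auto simp: indicator_def\<close>)
      next
        case False
        then have "x \<notin> {a + c n<..<b - c n}" for n using c(1)[of n] by auto
        then show ?thesis using False by simp
      qed
    qed
    show "AE x in unit_lebesgue. norm (indicator {a + c n<..<b - c n} x * g x) \<le> norm (g x)" for n
      by (rule AE_I2) (auto simp: indicator_def)
  qed
  moreover have "unit_integral (\<lambda>x. indicator {a + c n<..<b - c n} x * g x) = 0" for n
    using c[of n] ab by (intro int) auto
  ultimately show ?thesis by (simp add: LIMSEQ_const_iff)
qed

text \<open>Open intervals generate the Borel sets and are closed under intersection, so the integral
  vanishes over every Borel set; Lebesgue sets differ from Borel sets by null sets.\<close>

lemma L2_01_zero_if_intervals_zero: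
  assumes g: "g \<in> L2_01"
    and int: "\<And>a b. 0 \<le> a \<Longrightarrow> a < b \<Longrightarrow> b \<le> 1 \<Longrightarrow>
        unit_integral (\<lambda>x. indicator {a<..<b} x * g x) = 0"
  shows "AE x in unit_lebesgue. g x = 0"
proof -
  interpret finite_measure unit_lebesgue by (rule finite_measure_unit_lebesgue)
  show ?thesis
  proof (rule density_zero)
  show gi: "integrable unit_lebesgue g" by (rule L2_01_integrable[OF g])
  have borel_set: "(LINT x:A|unit_lebesgue. g x) = 0" if "A \<in> sets borel" for A
  proof -
    define G where "G = range (\<lambda>(a, b). box a b :: real set)"
    have sb: "sets borel = sigma_sets UNIV G"
      unfolding borel_eq_box G_def by (rule sets_measure_of) simp
    then have AG: "A \<in> sigma_sets UNIV G" using that by simp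
    have "Int_stable G"
      unfolding G_def Int_stable_def
      by (auto simp: image_iff)
    from this subset_UNIV[of G, folded Pow_UNIV] AG show ?thesis
    proof (induction rule: sigma_sets_induct_disjoint[of G UNIV])
      case (basic A)
      then obtain a b where A: "A = {a<..<b}" by (auto simp: G_def)
      define a' b' where "a' = max 0 a" and "b' = min 1 b"
      have "(LINT x:A|unit_lebesgue. g x) = unit_integral (\<lambda>x. indicator {a'<..<b'} x * g x)"
        unfolding set_lebesgue_integral_def
        by (intro Bochner_Integration.integral_cong)
           (auto simp: A a'_def b'_def indicator_def)
      also have "\<dots> = 0"
      proof (cases "a' < b'")
        case True
        then show ?thesis by (intro int) (auto simp: a'_def b'_def)
      qed simp
      finally show ?case .
    next
      case (compl A)
      have "A \<in> sets borel" using compl(1) by (simp add: sb)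
      then have A: "A \<inter> {0<..<1} \<in> sets unit_lebesgue"
        by (auto simp: sets_restrict_space)
      have ia: "integrable unit_lebesgue (\<lambda>x. indicator A x * g x)"
        using \<open>A \<in> sets borel\<close> L2_01_D(1)[OF g]
        by (intro Bochner_Integration.integrable_bound[OF gi] borel_measurable_times borel_measurable_indicator_unit)
           (auto simp: indicator_def)
      have "(LINT x:UNIV - A|unit_lebesgue. g x)
          = unit_integral (\<lambda>x. g x - indicator A x * g x)"
        unfolding set_lebesgue_integral_def
        by (intro Bochner_Integration.integral_cong) (auto simp: indicator_def)
      also have "\<dots> = unit_integral g - unit_integral (\<lambda>x. indicator A x * g x)"
        by (rule Bochner_Integration.integral_diff[OF gi ia])
      also have "unit_integral g = unit_integral (\<lambda>x. indicator {0<..<1} x * g x)"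
        by (intro Bochner_Integration.integral_cong) (auto simp: indicator_def)
      also have "\<dots> = 0" by (intro int) auto
      finally show ?case using compl(2) by (simp add: set_lebesgue_integral_def)
    next
      case (union A)
      have A: "A i \<in> sets borel" for i
        using union(2) by (auto simp: sb)
      have eq: "(LINT x:B|unit_lebesgue. g x) = (LINT x:B \<inter> {0<..<1}|unit_lebesgue. g x)" for B
        unfolding set_lebesgue_integral_def
        by (intro Bochner_Integration.integral_cong) (auto simp: indicator_def)
      have "(LINT x:(\<Union>i. A i \<inter> {0<..<1})|unit_lebesgue. g x) = (\<Sum>i. LINT x:A i \<inter> {0<..<1}|unit_lebesgue. g x)"
      proof (rule lebesgue_integral_countable_add)
        show "A i \<inter> {0<..<1} \<in> sets unit_lebesgue" for i
          using A[of i] by (auto simp: sets_restrict_space)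
        show "(A i \<inter> {0<..<1}) \<inter> (A j \<inter> {0<..<1}) = {}" if "i \<noteq> j" for i j
          using union(1) that by (auto simp: disjoint_family_on_def)
        have "(\<Union>i. A i \<inter> {0<..<1}) \<in> sets borel" using A by auto
        then show "set_integrable unit_lebesgue (\<Union>i. A i \<inter> {0<..<1}) g"
          unfolding set_integrable_def using L2_01_D(1)[OF g]
          by (intro Bochner_Integration.integrable_bound[OF gi] borel_measurable_scaleR borel_measurable_indicator_unit)
             (auto simp: indicator_def)
      qed
      also have "\<dots> = 0" using union(3) by (simp add: eq[symmetric])
      finally show ?case by (subst eq) (simp add: Int_UN_distrib2)
    qed (auto simp: set_lebesgue_integral_def)
  qed
  fix A assume A: "A \<in> sets unit_lebesgue"
  then have "A \<in> sets lebesgue" by (auto simp: sets_restrict_space)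
  then obtain S N N' where SN: "A = S \<union> N" "N \<subseteq> N'" "N' \<in> null_sets lborel" "S \<in> sets lborel"
    by (rule sets_completionE)
  have "AE x in lebesgue. x \<notin> N'"
    using SN(3) by (intro AE_completion AE_not_in)
  then have "AE x in unit_lebesgue. x \<notin> N'"
    by (subst AE_restrict_space_iff) auto
  then have ae: "AE x in unit_lebesgue. indicator A x *\<^sub>R g x = indicator S x *\<^sub>R g x"
    by eventually_elim (use SN in \<open>auto simp: indicator_def\<close>)
  have "(LINT x:A|unit_lebesgue. g x) = (LINT x:S|unit_lebesgue. g x)"
    unfolding set_lebesgue_integral_def
    using A SN(4) L2_01_D(1)[OF g]
    by (intro integral_cong_AE ae borel_measurable_scaleR borel_measurable_indicator_unit borel_measurable_indicator) auto
  then show "(LINT x:A|unit_lebesgue. g x) = 0"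
    using borel_set[of S] SN(4) by simp
  qed
qed

text \<open>The fundamental lemma of the calculus of variations. It makes the norms below independent of
  the choice of representatives.\<close>

lemma weak_deriv_unique:
  assumes g: "g \<in> L2_01" "is_weak_deriv f g" and h: "h \<in> L2_01" "is_weak_deriv f h"
  shows "AE x in unit_lebesgue. g x = h x"
proof -
  define d where "d = (\<lambda>x. 1 * g x + (-1) * h x)"
  have d: "d \<in> L2_01" unfolding d_def by (intro L2_01_lincomb g h)
  have "AE x in unit_lebesgue. d x = 0"
  proof (rule L2_01_zero_if_intervals_zero[OF d], rule interval_zero_closed[OF d],
      rule test_function_zero_imp_interval_zero[OF d])
    fix \<phi> \<phi>' :: "real \<Rightarrow> real" and a b :: real
    assume ab: "0 < a" "a < b" "b < 1" and supp: "\<And>x. x \<notin> {a..b} \<Longrightarrow> \<phi> x = 0"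
      and \<phi>: "\<And>x. (\<phi> has_real_derivative \<phi>' x) (at x)" and \<phi>': "continuous_on UNIV \<phi>'"
    have "\<phi> \<in> L2_01"
      by (intro L2_01_continuous DERIV_continuous_on[of _ _ \<phi>'] has_field_derivative_at_within[OF \<phi>])
    then have i: "integrable unit_lebesgue (\<lambda>x. g x * \<phi> x)" "integrable unit_lebesgue (\<lambda>x. h x * \<phi> x)"
      using g h by (auto intro: L2_01_mult_integrable)
    have wd: "unit_integral (\<lambda>x. f x * \<phi>' x) = - unit_integral (\<lambda>x. k x * \<phi> x)"
      if "is_weak_deriv f k" for k
      using that ab supp \<phi> \<phi>' unfolding is_weak_deriv_def by blast
    have "unit_integral (\<lambda>x. d x * \<phi> x)
        = unit_integral (\<lambda>x. g x * \<phi> x) - unit_integral (\<lambda>x. h x * \<phi> x)"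
      using i by (simp add: d_def left_diff_distrib)
    then show "unit_integral (\<lambda>x. d x * \<phi> x) = 0"
      using wd[OF g(2)] wd[OF h(2)] by linarith
  qed
  then show ?thesis by (simp add: d_def)
qed

lemma is_weak_deriv_cong_AE:
  assumes "is_weak_deriv f g" "f \<in> L2_01" "f' \<in> L2_01" "AE x in unit_lebesgue. f x = f' x"
  shows "is_weak_deriv f' g"
  unfolding is_weak_deriv_def
proof (intro allI impI)
  fix \<phi> \<phi>' :: "real \<Rightarrow> real" and a b :: real
  assume *: "0 < a \<and> a < b \<and> b < 1 \<and> (\<forall>x. x \<notin> {a..b} \<longrightarrow> \<phi> x = 0) \<and>
    (\<forall>x. (\<phi> has_real_derivative \<phi>' x) (at x)) \<and> continuous_on UNIV \<phi>'"
  then have "\<phi>' \<in> L2_01"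
    by (intro L2_01_continuous) (blast intro: continuous_on_subset)
  then have "unit_integral (\<lambda>x. f' x * \<phi>' x) = unit_integral (\<lambda>x. f x * \<phi>' x)"
    using assms(4) by (intro integral_cong_AE borel_measurable_times L2_01_D assms) auto
  moreover have "unit_integral (\<lambda>x. f x * \<phi>' x) = - unit_integral (\<lambda>x. g x * \<phi> x)"
    using assms(1) * unfolding is_weak_deriv_def by blast
  ultimately show "unit_integral (\<lambda>x. f' x * \<phi>' x) = - unit_integral (\<lambda>x. g x * \<phi> x)"
    by (rule trans)
qed

lemma is_weak_deriv_lincomb:
  assumes "is_weak_deriv f f'" "is_weak_deriv g g'"
    and L2: "f \<in> L2_01" "f' \<in> L2_01" "g \<in> L2_01" "g' \<in> L2_01"
  shows "is_weak_deriv (\<lambda>x. a * f x + b * g x) (\<lambda>x. a * f' x + b * g' x)"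
  unfolding is_weak_deriv_def
proof (intro allI impI)
  fix \<phi> \<phi>' :: "real \<Rightarrow> real" and c d :: real
  assume *: "0 < c \<and> c < d \<and> d < 1 \<and> (\<forall>x. x \<notin> {c..d} \<longrightarrow> \<phi> x = 0) \<and>
    (\<forall>x. (\<phi> has_real_derivative \<phi>' x) (at x)) \<and> continuous_on UNIV \<phi>'"
  then have \<phi>': "\<phi>' \<in> L2_01"
    by (intro L2_01_continuous) (blast intro: continuous_on_subset)
  have \<phi>: "\<phi> \<in> L2_01"
    using * by (intro L2_01_continuous DERIV_continuous_on[of _ _ \<phi>']) (blast intro: has_field_derivative_at_within)
  have lin: "unit_integral (\<lambda>x. (a * u x + b * v x) * p x)
      = a * unit_integral (\<lambda>x. u x * p x) + b * unit_integral (\<lambda>x. v x * p x)"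
    if "u \<in> L2_01" "v \<in> L2_01" "p \<in> L2_01" for u v p
    using L2_01_mult_integrable[OF that(1,3)] L2_01_mult_integrable[OF that(2,3)]
    by (simp add: distrib_right mult.assoc)
  have "unit_integral (\<lambda>x. f x * \<phi>' x) = - unit_integral (\<lambda>x. f' x * \<phi> x)"
    "unit_integral (\<lambda>x. g x * \<phi>' x) = - unit_integral (\<lambda>x. g' x * \<phi> x)"
    using assms(1,2) * unfolding is_weak_deriv_def by blast+
  then show "unit_integral (\<lambda>x. (a * f x + b * g x) * \<phi>' x)
      = - unit_integral (\<lambda>x. (a * f' x + b * g' x) * \<phi> x)"
    using lin[OF L2(1,3) \<phi>'] lin[OF L2(2,4) \<phi>] by simp
qed

lemma is_weak_deriv_classical:
  assumes f: "continuous_on {0..1} f" and f': "continuous_on {0..1} f'"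
    and deriv: "\<And>x. 0 < x \<Longrightarrow> x < 1 \<Longrightarrow> (f has_real_derivative f' x) (at x)"
  shows "is_weak_deriv f f'"
  unfolding is_weak_deriv_def
proof (intro allI impI)
  fix \<phi> \<phi>' :: "real \<Rightarrow> real" and a b :: real
  assume *: "0 < a \<and> a < b \<and> b < 1 \<and> (\<forall>x. x \<notin> {a..b} \<longrightarrow> \<phi> x = 0) \<and>
    (\<forall>x. (\<phi> has_real_derivative \<phi>' x) (at x)) \<and> continuous_on UNIV \<phi>'"
  then have \<phi>': "continuous_on {0..1} \<phi>'" and D\<phi>: "\<And>x. (\<phi> has_real_derivative \<phi>' x) (at x)"
    and "\<phi> 0 = 0" "\<phi> 1 = 0"
    by (auto intro: continuous_on_subset)
  have \<phi>: "continuous_on {0..1} \<phi>"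
    by (intro DERIV_continuous_on[of _ _ \<phi>'] has_field_derivative_at_within[OF D\<phi>])
  note c1 = continuous_on_mult[OF f \<phi>'] and c2 = continuous_on_mult[OF f' \<phi>]
  have "((\<lambda>x. f' x * \<phi> x + f x * \<phi>' x) has_integral f 1 * \<phi> 1 - f 0 * \<phi> 0) {0..1}"
  proof (rule fundamental_theorem_of_calculus_interior)
    show "continuous_on {0..1} (\<lambda>x. f x * \<phi> x)" by (intro continuous_on_mult f \<phi>)
    fix x :: real assume "x \<in> {0<..<1}"
    then have "((\<lambda>x. f x * \<phi> x) has_real_derivative f' x * \<phi> x + \<phi>' x * f x) (at x)"
      by (intro DERIV_mult deriv D\<phi>) auto
    then show "((\<lambda>x. f x * \<phi> x) has_vector_derivative f' x * \<phi> x + f x * \<phi>' x) (at x)"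
      by (simp add: has_real_derivative_iff_has_vector_derivative mult.commute)
  qed simp
  then have "integral {0..1} (\<lambda>x. f' x * \<phi> x + f x * \<phi>' x) = 0"
    using \<open>\<phi> 0 = 0\<close> \<open>\<phi> 1 = 0\<close> by (simp add: integral_unique)
  then have "integral {0..1} (\<lambda>x. f' x * \<phi> x) + integral {0..1} (\<lambda>x. f x * \<phi>' x) = 0"
    using integrable_continuous_real[OF c1] integrable_continuous_real[OF c2] by (simp add: integral_add)
  then show "unit_integral (\<lambda>x. f x * \<phi>' x) = - unit_integral (\<lambda>x. f' x * \<phi> x)"
    by (simp add: unit_lebesgue_continuous(2)[OF c1] unit_lebesgue_continuous(2)[OF c2])
qed

text \<open>The successive weak derivatives of \<open>D 0\<close> as an explicit sequence. The constant
  \<^const>\<open>weak_deriv\<close> selects representatives by choice, which do not respect sums; the sequences do, and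
  \<open>weak_chain_weak_deriv\<close> returns to the selected representatives.\<close>

definition weak_chain :: "nat \<Rightarrow> (nat \<Rightarrow> real \<Rightarrow> real) \<Rightarrow> bool" where
  "weak_chain k D \<longleftrightarrow> (\<forall>j\<le>k. D j \<in> L2_01) \<and> (\<forall>j<k. is_weak_deriv (D j) (D (Suc j)))"

lemma H_sp_imp_weak_chain:
  "f \<in> H_sp k \<Longrightarrow> \<exists>D. weak_chain k D \<and> D 0 = f"
proof (induction k arbitrary: f)
  case 0
  then show ?case by (intro exI[of _ "\<lambda>_. f"]) (simp add: weak_chain_def)
next
  case (Suc k)
  then obtain g where f: "f \<in> L2_01" and "g \<in> H_sp k" and fg: "is_weak_deriv f g" by auto
  then obtain D where D: "weak_chain k D" "D 0 = g" using Suc.IH by blast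
  show ?case
  proof (intro exI[of _ "case_nat f D"] conjI)
    show "weak_chain (Suc k) (case_nat f D)"
      using D f fg by (auto simp: weak_chain_def split: nat.split)
  qed simp
qed

lemma weak_chain_imp_H_sp: "weak_chain k D \<Longrightarrow> D 0 \<in> H_sp k"
proof (induction k arbitrary: D)
  case (Suc k)
  then have "weak_chain k (\<lambda>j. D (Suc j))" by (simp add: weak_chain_def)
  from Suc.IH[OF this] Suc.prems show ?case by (auto simp: weak_chain_def)
qed (simp add: weak_chain_def)

lemma weak_chain_weak_deriv:
  assumes D: "weak_chain k D" and "i \<le> k"
  shows "(weak_deriv ^^ i) (D 0) \<in> L2_01 \<and> (AE x in unit_lebesgue. (weak_deriv ^^ i) (D 0) x = D i x)"
  using \<open>i \<le> k\<close>
proof (induction i)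
  case 0
  then show ?case using D by (simp add: weak_chain_def)
next
  case (Suc i)
  let ?F = "(weak_deriv ^^ i) (D 0)"
  have F: "?F \<in> L2_01" "AE x in unit_lebesgue. ?F x = D i x" using Suc by auto
  have Di: "D i \<in> L2_01" "D (Suc i) \<in> L2_01" "is_weak_deriv (D i) (D (Suc i))"
    using D Suc.prems by (auto simp: weak_chain_def)
  have "AE x in unit_lebesgue. D i x = ?F x" using F(2) by eventually_elim simp
  then have wd: "is_weak_deriv ?F (D (Suc i))"
    by (rule is_weak_deriv_cong_AE[OF Di(3) Di(1) F(1)])
  have "weak_deriv ?F \<in> L2_01 \<and> is_weak_deriv ?F (weak_deriv ?F)"
    unfolding weak_deriv_def[of ?F] by (rule someI[where x = "D (Suc i)"]) (intro conjI Di(2) wd)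
  then have F': "weak_deriv ?F \<in> L2_01" "is_weak_deriv ?F (weak_deriv ?F)" by blast+
  have "(weak_deriv ^^ Suc i) (D 0) = weak_deriv ?F" by simp
  then show ?case using F'(1) weak_deriv_unique[OF F' Di(2) wd] by (simp only: simp_thms)
qed

lemma weak_chain_lincomb:
  assumes "weak_chain k D" "weak_chain k E"
  shows "weak_chain k (\<lambda>j x. a * D j x + b * E j x)"
  unfolding weak_chain_def
proof (intro conjI allI impI)
  show "(\<lambda>x. a * D j x + b * E j x) \<in> L2_01" if "j \<le> k" for j
    by (rule L2_01_lincomb) (use assms that in \<open>auto simp: weak_chain_def\<close>)
  show "is_weak_deriv (\<lambda>x. a * D j x + b * E j x) (\<lambda>x. a * D (Suc j) x + b * E (Suc j) x)" if "j < k" for j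
    by (rule is_weak_deriv_lincomb) (use assms that in \<open>auto simp: weak_chain_def\<close>)
qed

lemma weak_chain_classical:
  assumes "\<And>j. j \<le> k \<Longrightarrow> continuous_on {0..1} (D j)"
    and "\<And>j x. j < k \<Longrightarrow> 0 < x \<Longrightarrow> x < 1 \<Longrightarrow> (D j has_real_derivative D (Suc j) x) (at x)"
  shows "weak_chain k D"
  unfolding weak_chain_def
proof (intro conjI allI impI)
  show "D j \<in> L2_01" if "j \<le> k" for j
    by (rule L2_01_continuous) (use assms that in auto)
  show "is_weak_deriv (D j) (D (Suc j))" if "j < k" for j
    by (rule is_weak_deriv_classical) (use assms that in auto)
qed

lemma weak_chain_norm:
  assumes "weak_chain k D" "i \<le> k"
  shows "L2_norm ((weak_deriv ^^ i) (D 0)) = L2_norm (D i)"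
  using weak_chain_weak_deriv[OF assms] assms
  by (intro L2_norm_cong_AE) (auto simp: weak_chain_def)

lemma weak_chain_H_norm:
  assumes "weak_chain k D"
  shows "H_norm k (D 0) = L2_set (\<lambda>i. L2_norm (D i)) {..k}"
  unfolding H_norm_def L2_set_def
  by (intro arg_cong[of _ _ sqrt] sum.cong refl) (simp add: weak_chain_norm[OF assms])

lemma H_norm_nonneg: "0 \<le> H_norm k f"
  by (simp add: H_norm_def sum_nonneg)

lemma H_sp_lincomb:
  assumes "f \<in> H_sp k" "g \<in> H_sp k"
  shows "(\<lambda>x. a * f x + b * g x) \<in> H_sp k"
proof -
  obtain D E where D: "weak_chain k D" "D 0 = f" and E: "weak_chain k E" "E 0 = g"
    using assms H_sp_imp_weak_chain by meson
  from weak_chain_imp_H_sp[OF weak_chain_lincomb[OF D(1) E(1), of a b]] show ?thesis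
    by (simp add: D E)
qed

lemma H_norm_lincomb_le:
  assumes "f \<in> H_sp k" "g \<in> H_sp k"
  shows "H_norm k (\<lambda>x. a * f x + b * g x) \<le> \<bar>a\<bar> * H_norm k f + \<bar>b\<bar> * H_norm k g"
proof -
  obtain D E where D: "weak_chain k D" "D 0 = f" and E: "weak_chain k E" "E 0 = g"
    using assms H_sp_imp_weak_chain by meson
  have "H_norm k (\<lambda>x. a * f x + b * g x) = L2_set (\<lambda>i. L2_norm (\<lambda>x. a * D i x + b * E i x)) {..k}"
    using weak_chain_H_norm[OF weak_chain_lincomb[OF D(1) E(1), of a b]] by (simp add: D E)
  also have "\<dots> \<le> L2_set (\<lambda>i. \<bar>a\<bar> * L2_norm (D i) + \<bar>b\<bar> * L2_norm (E i)) {..k}"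
  proof (rule L2_set_mono)
    fix i assume i: "i \<in> {..k}"
    have "(\<lambda>x. a * D i x) \<in> L2_01" "(\<lambda>x. b * E i x) \<in> L2_01"
      using L2_01_lincomb[of "D i" "D i" a 0] L2_01_lincomb[of "E i" "E i" b 0] D E i
      by (auto simp: weak_chain_def)
    from L2_norm_triangle[OF this]
    show "L2_norm (\<lambda>x. a * D i x + b * E i x) \<le> \<bar>a\<bar> * L2_norm (D i) + \<bar>b\<bar> * L2_norm (E i)"
      by (simp add: L2_norm_scale)
  qed (rule L2_norm_nonneg)
  also have "\<dots> \<le> L2_set (\<lambda>i. \<bar>a\<bar> * L2_norm (D i)) {..k} + L2_set (\<lambda>i. \<bar>b\<bar> * L2_norm (E i)) {..k}"
    by (rule L2_set_triangle_ineq)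
  also have "\<dots> = \<bar>a\<bar> * H_norm k f + \<bar>b\<bar> * H_norm k g"
    using weak_chain_H_norm[OF D(1)] weak_chain_H_norm[OF E(1)]
    by (simp add: D E L2_set_right_distrib)
  finally show ?thesis .
qed

section \<open>The maximum principle\<close>

text \<open>The first derivative vanishes at the maximum; a positive second derivative would make it
  positive, and the function increasing, to the right.\<close>

lemma second_derivative_nonpos_at_max:
  fixes g :: "real \<Rightarrow> real"
  assumes "0 < d"
    and g: "\<And>y. \<bar>y - x\<bar> < d \<Longrightarrow> (g has_real_derivative g' y) (at y)"
    and g': "(g' has_real_derivative l) (at x)"
    and max: "\<And>y. \<bar>y - x\<bar> < d \<Longrightarrow> g y \<le> g x"
  shows "l \<le> 0"
proof (rule ccontr)
  assume "\<not> l \<le> 0"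
  then have "0 < l" by simp
  have "g' x = 0"
    using DERIV_local_max[OF g[of x] \<open>0 < d\<close>] max \<open>0 < d\<close> by (simp add: abs_minus_commute)
  obtain e where "0 < e" and e: "\<And>h. 0 < h \<Longrightarrow> h < e \<Longrightarrow> g' x < g' (x + h)"
    using DERIV_pos_inc_right[OF g' \<open>0 < l\<close>] by auto
  define h where "h = min d e / 2"
  have h: "0 < h" "h < d" "h < e"
    using \<open>0 < d\<close> \<open>0 < e\<close> by (auto simp: h_def)
  have "g x < g (x + h)"
  proof (rule DERIV_pos_imp_increasing_open[of x "x + h"])
    show "x < x + h" using h by simp
    fix y assume "x < y" "y < x + h"
    moreover from this have "0 < g' y"
      using e[of "y - x"] h \<open>g' x = 0\<close> by simp
    ultimately show "\<exists>l. DERIV g y :> l \<and> l > 0"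
      using g[of y] h by auto
  next
    show "continuous_on {x..x + h} g"
    proof (intro continuous_at_imp_continuous_on ballI)
      fix y assume "y \<in> {x..x + h}"
      then have "\<bar>y - x\<bar> < d" using h by auto
      then show "isCont g y" using g DERIV_isCont by blast
    qed
  qed
  then show False using max[of "x + h"] h by simp
qed

text \<open>Subtracting \<open>e t\<close> makes the inequality strict: at an interior maximum of \<open>v - e t\<close> the time
  derivative of \<open>v\<close> is at least \<open>e > 0\<close> while \<open>v\<^sub>x\<^sub>x \<le> 0\<close>. Then \<open>e \<rightarrow> 0\<close>.\<close>

lemma heat_maximum_principle:
  fixes v vx vxx :: "real \<Rightarrow> real \<Rightarrow> real"
  assumes "q > 0"
    and cont: "continuous_on ({0..1} \<times> {0..T}) (\<lambda>(x, t). v x t)"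
    and vx: "\<And>x t. 0 < x \<Longrightarrow> x < 1 \<Longrightarrow> 0 < t \<Longrightarrow> t \<le> T \<Longrightarrow>
        ((\<lambda>y. v y t) has_real_derivative vx x t) (at x)"
    and vxx: "\<And>x t. 0 < x \<Longrightarrow> x < 1 \<Longrightarrow> 0 < t \<Longrightarrow> t \<le> T \<Longrightarrow>
        ((\<lambda>y. vx y t) has_real_derivative vxx x t) (at x)"
    and vt: "\<And>x t. 0 < x \<Longrightarrow> x < 1 \<Longrightarrow> 0 < t \<Longrightarrow> t \<le> T \<Longrightarrow>
        ((\<lambda>s. v x s) has_real_derivative q * vxx x t) (at t)"
    and bdry: "\<And>t. 0 \<le> t \<Longrightarrow> t \<le> T \<Longrightarrow> v 0 t \<le> M \<and> v 1 t \<le> M"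
    and init: "\<And>x. 0 \<le> x \<Longrightarrow> x \<le> 1 \<Longrightarrow> v x 0 \<le> M"
    and x: "0 \<le> x" "x \<le> 1" and t: "0 \<le> t" "t \<le> T"
  shows "v x t \<le> M"
proof -
  have approx: "v x t \<le> M + e * T" if "0 < e" for e
  proof -
    define z where "z = (\<lambda>(x, t). v x t - e * t)"
    have "continuous_on ({0..1} \<times> {0..T}) z"
      using cont unfolding z_def split_beta by (auto intro!: continuous_intros)
    moreover have "compact ({0..1::real} \<times> {0..T})"
      by (intro compact_Times compact_Icc)
    moreover have "{0..1::real} \<times> {0..T} \<noteq> {}" using t by auto
    ultimately obtain p where p: "p \<in> {0..1} \<times> {0..T}"
      and zmax: "\<And>r. r \<in> {0..1} \<times> {0..T} \<Longrightarrow> z r \<le> z p"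
      using continuous_attains_sup by metis
    obtain x0 t0 where pe: "p = (x0, t0)" by (cases p)
    have x0: "0 \<le> x0" "x0 \<le> 1" and t0: "0 \<le> t0" "t0 \<le> T" using p pe by auto
    have zp: "v y s - e * s \<le> v x0 t0 - e * t0"
      if "0 \<le> y" "y \<le> 1" "0 \<le> s" "s \<le> T" for y s
      using zmax[of "(y, s)"] that by (simp add: z_def pe)
    have "v x0 t0 \<le> M"
    proof (cases "0 < x0 \<and> x0 < 1 \<and> 0 < t0")
      case False
      then have "x0 = 0 \<or> x0 = 1 \<or> t0 = 0" using x0 t0 by linarith
      then show ?thesis using bdry[OF t0] init[OF x0] by auto
    next
      case True
      define d where "d = min x0 (1 - x0)"
      have "vxx x0 t0 \<le> 0"
      proof (rule second_derivative_nonpos_at_max)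
        show "0 < d" using True by (simp add: d_def)
        show "((\<lambda>y. v y t0) has_real_derivative vx y t0) (at y)" if "\<bar>y - x0\<bar> < d" for y
          using that True t0 by (intro vx) (auto simp: d_def)
        show "v y t0 \<le> v x0 t0" if "\<bar>y - x0\<bar> < d" for y
          using zp[of y t0] t0 that by (auto simp: d_def)
        show "((\<lambda>y. vx y t0) has_real_derivative vxx x0 t0) (at x0)"
          using True t0 by (intro vxx) auto
      qed
      moreover have "0 \<le> q * vxx x0 t0 - e"
      proof (rule ccontr)
        assume neg: "\<not> 0 \<le> q * vxx x0 t0 - e"
        have "((\<lambda>s. v x0 s - e * s) has_real_derivative q * vxx x0 t0 - e) (at t0)"
          using vt[of x0 t0] True t0 by (auto intro!: derivative_eq_intros)
        from DERIV_neg_dec_left[OF this] neg obtain h where "0 < h"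
          and h: "\<And>k. 0 < k \<Longrightarrow> k < h \<Longrightarrow> v x0 t0 - e * t0 < v x0 (t0 - k) - e * (t0 - k)"
          by auto
        define k where "k = min h t0 / 2"
        have "0 < k" "k < h" "k < t0" using \<open>0 < h\<close> True by (auto simp: k_def)
        then show False using h[of k] zp[of x0 "t0 - k"] x0 t0 by auto
      qed
      ultimately show ?thesis
        using \<open>q > 0\<close> \<open>0 < e\<close> mult_nonneg_nonpos[of q "vxx x0 t0"] by linarith
    qed
    moreover have "v x t - e * t \<le> v x0 t0 - e * t0" by (intro zp x t)
    moreover have "e * t \<le> e * T" "0 \<le> e * t0" using t t0 that by auto
    ultimately show ?thesis by linarith
  qed
  show ?thesis
  proof (rule ccontr)
    assume "\<not> v x t \<le> M"
    then have lt: "0 < v x t - M" by simp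
    define e where "e = (v x t - M) / (2 * (T + 1))"
    have "0 < e" using lt t by (simp add: e_def)
    moreover have "e * T < v x t - M"
    proof -
      have "e * T \<le> e * (T + 1)" using \<open>0 < e\<close> by simp
      also have "e * (T + 1) = (v x t - M) / 2" using t unfolding e_def by (simp add: divide_simps)
      finally show ?thesis using lt by simp
    qed
    ultimately show False using approx[of e] by linarith
  qed
qed

section \<open>Sine series\<close>

definition sine_polynomial :: "(real \<Rightarrow> real) \<Rightarrow> bool" where
  "sine_polynomial f \<longleftrightarrow> (\<exists>N b. f = (\<lambda>x. \<Sum>k\<le>N. b k * sin (real k * pi * x)))"

lemma sine_polynomial_sin: "sine_polynomial (\<lambda>x. sin (real k * pi * x))"
  unfolding sine_polynomial_def
proof (intro exI ext)
  fix x :: real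
  have "(\<Sum>i\<le>k. (if i = k then 1 else 0) * sin (real i * pi * x)) = (\<Sum>i\<le>k. if i = k then sin (real i * pi * x) else 0)"
    by (intro sum.cong) auto
  also have "\<dots> = sin (real k * pi * x)" by (simp add: sum.delta)
  finally show "sin (real k * pi * x) = (\<Sum>i\<le>k. (if i = k then 1 else 0) * sin (real i * pi * x))" ..
qed

lemma sine_polynomial_scale: "sine_polynomial f \<Longrightarrow> sine_polynomial (\<lambda>x. c * f x)"
proof -
  assume "sine_polynomial f"
  then obtain N b where "f = (\<lambda>x. \<Sum>k\<le>N. b k * sin (real k * pi * x))"
    unfolding sine_polynomial_def by blast
  then have "(\<lambda>x. c * f x) = (\<lambda>x. \<Sum>k\<le>N. (c * b k) * sin (real k * pi * x))"
    by (simp add: sum_distrib_left mult.assoc)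
  then show ?thesis unfolding sine_polynomial_def by (intro exI)
qed

lemma sine_polynomial_add:
  assumes "sine_polynomial f" "sine_polynomial g"
  shows "sine_polynomial (\<lambda>x. f x + g x)"
proof -
  obtain N b where f: "f = (\<lambda>x. \<Sum>k\<le>N. b k * sin (real k * pi * x))"
    using assms unfolding sine_polynomial_def by blast
  obtain M c where g: "g = (\<lambda>x. \<Sum>k\<le>M. c k * sin (real k * pi * x))"
    using assms unfolding sine_polynomial_def by blast
  have pad: "(\<Sum>k\<le>N. b k * sin (real k * pi * x))
      = (\<Sum>k\<le>K. (if k \<le> N then b k else 0) * sin (real k * pi * x))"
    if "N \<le> K" for N K b x
    using that by (intro sum.mono_neutral_cong_left) auto
  have "f x + g x = (\<Sum>k\<le>max N M. ((if k \<le> N then b k else 0) + (if k \<le> M then c k else 0))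
      * sin (real k * pi * x))" for x
    unfolding f g distrib_right sum.distrib by (intro arg_cong2[of _ _ _ _ "(+)"] pad) auto
  then show ?thesis unfolding sine_polynomial_def by (intro exI ext)
qed

lemma sine_polynomial_sum:
  assumes "\<And>i. i \<in> I \<Longrightarrow> sine_polynomial (f i)" "finite I"
  shows "sine_polynomial (\<lambda>x. \<Sum>i\<in>I. f i x)"
  using assms(2,1)
proof (induction I rule: finite_induct)
  case empty
  show ?case using sine_polynomial_scale[OF sine_polynomial_sin[of 0], of 0] by simp
next
  case (insert i I)
  then show ?case by (simp add: sine_polynomial_add)
qed

text \<open>Multiplication by \<open>cos (\<pi> x)\<close> shifts frequencies by one, and at frequency \<open>0\<close> nothing is
  left because the sine vanishes there. So \<open>sin (\<pi> x)\<close> times a polynomial in \<open>cos (\<pi> x)\<close> is a sine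
  polynomial.\<close>

lemma sine_polynomial_sin_cos_power:
  "sine_polynomial (\<lambda>x. sin (real k * pi * x) * cos (pi * x) ^ i)"
proof (induction i arbitrary: k)
  case 0
  show ?case by (simp add: sine_polynomial_sin)
next
  case (Suc i)
  show ?case
  proof (cases k)
    case 0
    then show ?thesis using sine_polynomial_sin[of 0] by simp
  next
    case (Suc j)
    have "sin (real k * pi * x) * cos (pi * x) ^ Suc i
        = (1/2) * (sin (real (Suc k) * pi * x) * cos (pi * x) ^ i
          + sin (real j * pi * x) * cos (pi * x) ^ i)" for x
    proof -
      have *: "real (Suc k) * pi * x = real k * pi * x + pi * x"
        "real j * pi * x = real k * pi * x - pi * x"
        unfolding Suc by (simp_all add: algebra_simps)
      show ?thesis unfolding * sin_add sin_diff by (simp add: algebra_simps)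
    qed
    then show ?thesis
      by (simp only:) (intro sine_polynomial_scale sine_polynomial_add Suc.IH)
  qed
qed

text \<open>Dividing \<open>f\<close> by \<open>sin (\<pi> x)\<close> and approximating the quotient by polynomials in \<open>cos (\<pi> x)\<close> would
  suffice, but the quotient need not be bounded at the end points. The regularised quotient
  \<open>h = f sin / (sin\<^sup>2 + d)\<close> is continuous, and \<open>f - sin h = f d / (sin\<^sup>2 + d)\<close> is small: near the end
  points because \<open>f\<close> is, elsewhere because \<open>d\<close> is.\<close>

lemma sine_polynomials_dense:
  fixes f :: "real \<Rightarrow> real"
  assumes f: "continuous_on {0..1} f" and "f 0 = 0" "f 1 = 0" and "0 < e"
  obtains N b where "\<And>x. x \<in> {0..1} \<Longrightarrow> \<bar>f x - (\<Sum>k\<le>N. b k * sin (real k * pi * x))\<bar> < e"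
proof -
  have bd: "compact (f ` {0..1})" by (intro compact_continuous_image f compact_Icc)
  then obtain K where "0 < K" and K: "\<And>x. x \<in> {0..1} \<Longrightarrow> \<bar>f x\<bar> \<le> K"
    using compact_imp_bounded[OF bd] unfolding bounded_pos by force
  have "\<exists>m>0. \<forall>x\<in>{0..1}. \<bar>f x\<bar> \<ge> e / 3 \<longrightarrow> m \<le> (sin (pi * x))\<^sup>2"
  proof (cases "\<exists>x\<in>{0..1}. \<bar>f x\<bar> \<ge> e / 3")
    case False
    then show ?thesis by (intro exI[of _ 1]) auto
  next
    case True
    define S where "S = {0..1} \<inter> (\<lambda>x. \<bar>f x\<bar>) -` {e / 3..}"
    have "closed S" unfolding S_def
      by (intro continuous_closed_preimage continuous_intros f)
    then have "compact S"
      by (auto simp: compact_eq_bounded_closed S_def intro: bounded_subset[of "{0..1}"])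
    moreover have "S \<noteq> {}" using True by (auto simp: S_def)
    moreover have "continuous_on S (\<lambda>x. (sin (pi * x))\<^sup>2)" by (intro continuous_intros)
    ultimately obtain y where y: "y \<in> S" "\<And>x. x \<in> S \<Longrightarrow> (sin (pi * y))\<^sup>2 \<le> (sin (pi * x))\<^sup>2"
      using continuous_attains_inf by metis
    have "y \<noteq> 0" "y \<noteq> 1" using y(1) assms by (auto simp: S_def)
    then have "0 < y" "y < 1" using y(1) by (auto simp: S_def)
    then have "0 < sin (pi * y)" by (intro sin_gt_zero) auto
    then have "0 < (sin (pi * y))\<^sup>2" by simp
    then show ?thesis using y(2)
      by (intro exI[of _ "(sin (pi * y))\<^sup>2"]) (auto simp: S_def)
  qed
  then obtain m where "0 < m"
    and m: "\<And>x. x \<in> {0..1} \<Longrightarrow> \<bar>f x\<bar> \<ge> e / 3 \<Longrightarrow> m \<le> (sin (pi * x))\<^sup>2" by blast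
  \<comment> \<open>Chosen such that \<open>K d / m = e / 3\<close> where \<open>\<bar>f\<bar> \<ge> e / 3\<close>.\<close>
  define d where "d = e * m / (3 * K)"
  have "0 < d" using \<open>0 < e\<close> \<open>0 < m\<close> \<open>0 < K\<close> by (simp add: d_def)
  have den: "0 < (sin y)\<^sup>2 + d" for y using \<open>0 < d\<close> by (simp add: add_nonneg_pos)
  define h where "h = (\<lambda>x. f x * sin (pi * x) / ((sin (pi * x))\<^sup>2 + d))"
  have h: "continuous_on {0..1} h"
    unfolding h_def using den by (intro continuous_intros f) (auto simp: less_le)
  have fh: "\<bar>f x - sin (pi * x) * h x\<bar> \<le> e / 3" if x: "x \<in> {0..1}" for x
  proof -
    define s where "s = (sin (pi * x))\<^sup>2"
    have s: "0 \<le> s" "0 < s + d" using den by (auto simp: s_def)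
    have "f x - sin (pi * x) * h x = f x * (d / (s + d))"
      using s(2) unfolding h_def s_def by (simp add: field_simps power2_eq_square)
    then have eq: "\<bar>f x - sin (pi * x) * h x\<bar> = \<bar>f x\<bar> * (d / (s + d))"
      using s \<open>0 < d\<close> by (simp add: abs_mult)
    show ?thesis
    proof (cases "\<bar>f x\<bar> \<ge> e / 3")
      case True
      have "d / (s + d) \<le> d / m"
        using m[OF x True] s \<open>0 < d\<close> \<open>0 < m\<close> by (intro divide_left_mono) (auto simp: s_def)
      then have "\<bar>f x\<bar> * (d / (s + d)) \<le> K * (d / m)"
        using K[OF x] s \<open>0 < d\<close> \<open>0 < K\<close> by (intro mult_mono) auto
      also have "\<dots> = e / 3" using \<open>0 < m\<close> \<open>0 < K\<close> by (simp add: d_def)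
      finally show ?thesis using eq by simp
    next
      case False
      have "d / (s + d) \<le> 1" using s by simp
      then have "\<bar>f x\<bar> * (d / (s + d)) \<le> e / 3 * 1"
        using False s \<open>0 < d\<close> \<open>0 < e\<close> by (intro mult_mono) auto
      then show ?thesis using eq by simp
    qed
  qed
  \<comment> \<open>In the variable \<open>y = cos (\<pi> x)\<close> the algebraic Weierstrass theorem applies.\<close>
  have "continuous_on {-1..1} (\<lambda>y. h (arccos y / pi))"
    by (rule continuous_on_compose2[OF h])
      (auto intro!: continuous_intros simp: arccos_lbound arccos_ubound)
  then obtain g where g: "real_polynomial_function g"
    and hg: "\<And>y. y \<in> {-1..1} \<Longrightarrow> \<bar>h (arccos y / pi) - g y\<bar> < e / 3"
    using Stone_Weierstrass_real_polynomial_function[of "{-1..1}" _ "e / 3"] \<open>0 < e\<close> by auto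
  obtain a n where a: "g = (\<lambda>y. \<Sum>i\<le>n. a i * y ^ i)"
    using g unfolding real_polynomial_function_iff_sum by blast
  define p where "p = (\<lambda>x. sin (pi * x) * g (cos (pi * x)))"
  have "sine_polynomial (\<lambda>x. \<Sum>i\<le>n. a i * (sin (real 1 * pi * x) * cos (pi * x) ^ i))"
    by (intro sine_polynomial_sum sine_polynomial_scale sine_polynomial_sin_cos_power) auto
  also have "(\<lambda>x. \<Sum>i\<le>n. a i * (sin (real 1 * pi * x) * cos (pi * x) ^ i)) = p"
    by (simp add: p_def a sum_distrib_left algebra_simps)
  finally obtain N b where p: "p = (\<lambda>x. \<Sum>k\<le>N. b k * sin (real k * pi * x))"
    unfolding sine_polynomial_def by blast
  have "\<bar>f x - p x\<bar> < e" if x: "x \<in> {0..1}" for x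
  proof -
    have ac: "arccos (cos (pi * x)) = pi * x"
      using x by (intro arccos_cos) (auto simp: mult_le_cancel_left2)
    have "\<bar>h x - g (cos (pi * x))\<bar> < e / 3"
      using hg[of "cos (pi * x)"] unfolding ac by simp
    then have "\<bar>sin (pi * x)\<bar> * \<bar>h x - g (cos (pi * x))\<bar> \<le> 1 * (e / 3)"
      by (intro mult_mono) auto
    then have "\<bar>sin (pi * x) * h x - p x\<bar> \<le> e / 3"
      by (simp add: p_def abs_mult flip: right_diff_distrib)
    then show ?thesis using fh[OF x] \<open>0 < e\<close> by linarith
  qed
  then show ?thesis using that[where N = N and b = b] by (simp add: p)
qed

lemma has_integral_cos_int_pi:
  fixes n :: int
  assumes "n \<noteq> 0"
  shows "((\<lambda>x. cos (of_int n * pi * x + real i * pi)) has_integral 0) {0..1}"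
proof -
  have "((\<lambda>x. cos (of_int n * pi * x + real i * pi)) has_integral
      (sin (of_int n * pi * 1 + real i * pi) / (of_int n * pi)
        - sin (of_int n * pi * 0 + real i * pi) / (of_int n * pi))) {0..1}"
  proof (rule fundamental_theorem_of_calculus)
    fix x :: real
    have "((\<lambda>x. sin (of_int n * pi * x + real i * pi) / (of_int n * pi)) has_real_derivative
        cos (of_int n * pi * x + real i * pi)) (at x within {0..1})"
      using assms by (auto intro!: derivative_eq_intros)
    then show "((\<lambda>x. sin (of_int n * pi * x + real i * pi) / (of_int n * pi)) has_vector_derivative
        cos (of_int n * pi * x + real i * pi)) (at x within {0..1})"
      by (simp add: has_real_derivative_iff_has_vector_derivative)
  qed simp
  moreover have "sin (of_int n * pi * 1 + real i * pi) = 0"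
    by (simp add: sin_add sin_npi sin_times_pi_eq_0)
  moreover have "sin (of_int n * pi * 0 + real i * pi) = 0"
    by (simp add: sin_npi)
  ultimately show ?thesis by simp
qed

text \<open>The phase \<open>i \<pi> / 2\<close> covers sines and cosines at once, as they occur in the \<open>i\<close>-th derivative
  of a sine series.\<close>

lemma sin_phase_orthogonal:
  assumes "j \<noteq> k"
  shows "((\<lambda>x. sin (real j * pi * x + real i * pi / 2) * sin (real k * pi * x + real i * pi / 2))
    has_integral 0) {0..1}"
proof -
  define m n where "m = int j - int k" and "n = int j + int k"
  have "m \<noteq> 0" "n \<noteq> 0" using assms by (auto simp: m_def n_def)
  have "sin (real j * pi * x + real i * pi / 2) * sin (real k * pi * x + real i * pi / 2)
     = (cos (of_int m * pi * x + real 0 * pi) - cos (of_int n * pi * x + real i * pi)) * (1/2)" for x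
  proof -
    have "of_int m * pi * x + real 0 * pi
        = (real j * pi * x + real i * pi / 2) - (real k * pi * x + real i * pi / 2)"
      "of_int n * pi * x + real i * pi
        = (real j * pi * x + real i * pi / 2) + (real k * pi * x + real i * pi / 2)"
      by (simp_all add: m_def n_def algebra_simps)
    then show ?thesis by (simp only: sin_times_sin mult_1_right times_divide_eq_right)
  qed
  moreover have "((\<lambda>x. (cos (of_int m * pi * x + real 0 * pi) - cos (of_int n * pi * x + real i * pi)) * (1/2))
      has_integral (0 - 0) * (1/2)) {0..1}"
    by (intro has_integral_mult_left has_integral_diff has_integral_cos_int_pi) fact+
  ultimately show ?thesis by (simp only: diff_zero mult_zero_left)
qed

lemma sin_square_has_integral:
  assumes "k \<ge> 1"
  shows "((\<lambda>x. sin (real k * pi * x) * sin (real k * pi * x)) has_integral 1/2) {0..1}"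
proof -
  have "sin (real k * pi * x) * sin (real k * pi * x)
     = (1 - cos (of_int (2 * int k) * pi * x + real 0 * pi)) * (1/2)" for x
    unfolding sin_times_sin by (simp add: field_simps)
  moreover have "((\<lambda>x. (1 - cos (of_int (2 * int k) * pi * x + real 0 * pi)) * (1/2))
      has_integral (1 - 0) * (1/2)) {0..1}"
    using has_integral_const_real[of "1::real" 0 1] assms
    by (intro has_integral_mult_left has_integral_diff has_integral_cos_int_pi) auto
  ultimately show ?thesis by (simp only: diff_zero mult_1)
qed

lemma integral_abs_diff_le:
  fixes f g :: "real \<Rightarrow> real"
  assumes "f integrable_on {0..1}" "g integrable_on {0..1}"
    and "\<And>x. x \<in> {0..1} \<Longrightarrow> \<bar>f x - g x\<bar> \<le> e"
  shows "\<bar>integral {0..1} f - integral {0..1} g\<bar> \<le> e"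
proof -
  have "norm (integral {0..1} (\<lambda>x. f x - g x)) \<le> integral {0..1::real} (\<lambda>x. e)"
    by (rule integral_norm_bound_integral) (use assms in \<open>auto intro!: integrable_diff\<close>)
  then show ?thesis using assms by (simp add: integral_diff)
qed

text \<open>If all coefficients vanish, \<open>f\<close> is orthogonal to the sine polynomials that approximate it,
  so \<open>\<integral> f\<^sup>2 = 0\<close>.\<close>

lemma sine_coefficients_determine:
  fixes f :: "real \<Rightarrow> real"
  assumes f: "continuous_on {0..1} f" and "f 0 = 0" "f 1 = 0"
    and coef: "\<And>k. integral {0..1} (\<lambda>x. f x * sin (real k * pi * x)) = 0"
    and x: "x \<in> {0..1}"
  shows "f x = 0"
proof -
  obtain K where "0 < K" and K: "\<And>x. x \<in> {0..1} \<Longrightarrow> \<bar>f x\<bar> \<le> K"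
    using compact_imp_bounded[OF compact_continuous_image[OF f compact_Icc]]
    unfolding bounded_pos by force
  have small: "integral {0..1} (\<lambda>x. (f x)\<^sup>2) \<le> K * e" if "0 < e" for e
  proof -
    obtain N b where b: "\<And>x. x \<in> {0..1} \<Longrightarrow> \<bar>f x - (\<Sum>k\<le>N. b k * sin (real k * pi * x))\<bar> < e"
      using sine_polynomials_dense[OF assms(1-3) \<open>0 < e\<close>] by metis
    define p where "p = (\<lambda>x. \<Sum>k\<le>N. b k * sin (real k * pi * x))"
    have p: "continuous_on {0..1} p" unfolding p_def by (intro continuous_intros)
    have "integral {0..1} (\<lambda>x. f x * p x)
        = integral {0..1} (\<lambda>x. \<Sum>k\<le>N. b k * (f x * sin (real k * pi * x)))"
      by (simp add: p_def sum_distrib_left algebra_simps)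
    also have "\<dots> = (\<Sum>k\<le>N. integral {0..1} (\<lambda>x. b k * (f x * sin (real k * pi * x))))"
      by (intro integral_sum integrable_continuous_real continuous_intros f) auto
    also have "\<dots> = 0" by (simp add: coef)
    finally have "integral {0..1} (\<lambda>x. f x * p x) = 0" .
    moreover have "\<bar>integral {0..1} (\<lambda>x. (f x)\<^sup>2) - integral {0..1} (\<lambda>x. f x * p x)\<bar> \<le> K * e"
    proof (rule integral_abs_diff_le)
      fix x :: real assume x: "x \<in> {0..1}"
      have "\<bar>(f x)\<^sup>2 - f x * p x\<bar> = \<bar>f x\<bar> * \<bar>f x - p x\<bar>"
        by (simp add: power2_eq_square abs_mult flip: right_diff_distrib)
      also have "\<dots> \<le> K * e" using K[OF x] b[OF x] \<open>0 < K\<close>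
        by (intro mult_mono) (auto simp: p_def less_imp_le)
      finally show "\<bar>(f x)\<^sup>2 - f x * p x\<bar> \<le> K * e" .
    qed (intro integrable_continuous_real continuous_intros f p)+
    ultimately show ?thesis by simp
  qed
  have "integral {0..1} (\<lambda>x. (f x)\<^sup>2) \<le> 0"
  proof (rule field_le_epsilon)
    fix e :: real assume "0 < e"
    then show "integral {0..1} (\<lambda>x. (f x)\<^sup>2) \<le> 0 + e"
      using small[of "e / K"] \<open>0 < K\<close> by simp
  qed
  moreover have "0 \<le> integral {0..1} (\<lambda>x. (f x)\<^sup>2)"
    using continuous_on_power[OF f, of 2] by (auto intro: integral_nonneg integrable_continuous_real)
  ultimately have "integral {0..1} (\<lambda>x. (f x)\<^sup>2) = 0" by linarith
  then have "\<forall>x\<in>{0..1}. (f x)\<^sup>2 = 0"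
    using integral_eq_0_iff[of 0 1 "\<lambda>x. (f x)\<^sup>2"] continuous_on_power[OF f, of 2] by simp
  then show ?thesis using x by auto
qed

text \<open>Makes the sine series differentiable term by term any number of times.\<close>

definition rapidly_decreasing :: "(nat \<Rightarrow> real) \<Rightarrow> bool" where
  "rapidly_decreasing a \<longleftrightarrow> (\<forall>i. summable (\<lambda>k. \<bar>a k\<bar> * (real k * pi) ^ i))"

text \<open>The \<open>i\<close>-th derivative of \<open>\<Sum>\<^sub>k a\<^sub>k sin (k \<pi> x)\<close>. Since each derivative of a sine is a shift of the
  phase by \<open>\<pi> / 2\<close>, one formula serves all orders.\<close>

definition sine_series :: "(nat \<Rightarrow> real) \<Rightarrow> nat \<Rightarrow> real \<Rightarrow> real" where
  "sine_series a i x = (\<Sum>k. a k * (real k * pi) ^ i * sin (real k * pi * x + real i * pi / 2))"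

lemma sine_series_uniform_limit:
  assumes "rapidly_decreasing a"
  shows "uniform_limit S (\<lambda>n x. \<Sum>k<n. a k * (real k * pi) ^ i * sin (real k * pi * x + real i * pi / 2))
    (sine_series a i) sequentially"
  unfolding sine_series_def
proof (rule Weierstrass_m_test)
  show "summable (\<lambda>k. \<bar>a k\<bar> * (real k * pi) ^ i)"
    using assms by (auto simp: rapidly_decreasing_def)
  fix k x
  have "\<bar>a k\<bar> * (real k * pi) ^ i * \<bar>sin (real k * pi * x + real i * pi / 2)\<bar>
      \<le> \<bar>a k\<bar> * (real k * pi) ^ i * 1"
    by (intro mult_left_mono) auto
  then show "norm (a k * (real k * pi) ^ i * sin (real k * pi * x + real i * pi / 2))
      \<le> \<bar>a k\<bar> * (real k * pi) ^ i"
    by (simp add: abs_mult)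
qed

lemma sine_series_DERIV:
  assumes "rapidly_decreasing a"
  shows "(sine_series a i has_real_derivative sine_series a (Suc i) x) (at x)"
proof -
  let ?t = "\<lambda>i k x. a k * (real k * pi) ^ i * sin (real k * pi * x + real i * pi / 2)"
  have "((\<lambda>x. \<Sum>k. ?t i k x) has_field_derivative (\<Sum>k. ?t (Suc i) k x)) (at x)"
  proof (rule has_field_derivative_series'(2)[where S = UNIV and ?x0.0 = 0])
    show "(?t i k has_real_derivative ?t (Suc i) k y) (at y within UNIV)" for k y
    proof -
      have "sin (real k * pi * y + real (Suc i) * pi / 2) = cos (real k * pi * y + real i * pi / 2)"
      proof -
        have "real k * pi * y + real (Suc i) * pi / 2 = (real k * pi * y + real i * pi / 2) + pi / 2"
          by (simp add: field_simps)
        then show ?thesis by (simp only: sin_add cos_pi_half sin_pi_half)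
      qed
      then show ?thesis by (auto intro!: derivative_eq_intros)
    qed
    show "uniformly_convergent_on UNIV (\<lambda>n x. \<Sum>k<n. ?t (Suc i) k x)"
      using sine_series_uniform_limit[OF assms] uniformly_convergentI by blast
    have "uniform_limit UNIV (\<lambda>n x. \<Sum>k<n. ?t i k x) (sine_series a i) sequentially"
      by (rule sine_series_uniform_limit[OF assms])
    then have "(\<lambda>n. \<Sum>k<n. ?t i k 0) \<longlonglongrightarrow> sine_series a i 0"
      by (rule tendsto_uniform_limitI) simp
    then show "summable (\<lambda>k. ?t i k 0)" by (auto simp: summable_def sums_def)
  qed auto
  then show ?thesis by (simp add: sine_series_def[abs_def])
qed

lemma sine_series_continuous:
  "rapidly_decreasing a \<Longrightarrow> continuous_on S (sine_series a i)"
  by (intro DERIV_continuous_on[of _ _ "sine_series a (Suc i)"] has_field_derivative_at_within[OF sine_series_DERIV])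

text \<open>Parseval's identity, as a limit of partial sums. The integrals of the squares are left
  unevaluated: only their sign matters later.\<close>

lemma sine_series_square_integral_tendsto:
  assumes "rapidly_decreasing a"
  shows "(\<lambda>n. \<Sum>k<n. (a k * (real k * pi) ^ i)\<^sup>2
        * integral {0..1} (\<lambda>x. sin (real k * pi * x + real i * pi / 2) * sin (real k * pi * x + real i * pi / 2)))
    \<longlonglongrightarrow> integral {0..1} (\<lambda>x. (sine_series a i x)\<^sup>2)"
proof -
  let ?s = "\<lambda>k x. sin (real k * pi * x + real i * pi / 2)"
  let ?p = "\<lambda>n x. \<Sum>k<n. a k * (real k * pi) ^ i * ?s k x"
  have ul: "uniform_limit {0..1} ?p (sine_series a i) sequentially"
    by (rule sine_series_uniform_limit[OF assms])
  have "bounded (sine_series a i ` {0..1})"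
    by (intro compact_imp_bounded compact_continuous_image sine_series_continuous assms compact_Icc)
  then have ul2: "uniform_limit {0..1} (\<lambda>n x. ?p n x * ?p n x) (\<lambda>x. sine_series a i x * sine_series a i x) sequentially"
    by (intro uniform_lim_mult ul)
  have cont: "continuous_on {0..1} (\<lambda>x. ?p n x * ?p n x)" for n
    by (intro continuous_intros)
  obtain I J where I: "\<And>n. ((\<lambda>x. ?p n x * ?p n x) has_integral I n) {0..1}"
    and J: "((\<lambda>x. sine_series a i x * sine_series a i x) has_integral J) {0..1}"
    and lim: "I \<longlonglongrightarrow> J"
    by (rule uniform_limit_integral[OF ul2 cont sequentially_bot]) blast
  have "I n = (\<Sum>k<n. (a k * (real k * pi) ^ i)\<^sup>2 * integral {0..1} (\<lambda>x. ?s k x * ?s k x))" for n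
  proof -
    let ?c = "\<lambda>k. a k * (real k * pi) ^ i"
    have "((\<lambda>x. \<Sum>j<n. \<Sum>k<n. ?c j * ?c k * (?s j x * ?s k x)) has_integral
        (\<Sum>j<n. \<Sum>k<n. ?c j * ?c k * (if j = k then integral {0..1} (\<lambda>x. ?s k x * ?s k x) else 0))) {0..1}"
    proof (intro has_integral_sum has_integral_mult_right)
      fix j k
      show "((\<lambda>x. ?s j x * ?s k x) has_integral
          (if j = k then integral {0..1} (\<lambda>x. ?s k x * ?s k x) else 0)) {0..1}"
        using sin_phase_orthogonal[of j k i]
        by (auto intro!: integrable_integral integrable_continuous_real continuous_intros)
    qed auto
    also have "(\<lambda>x. \<Sum>j<n. \<Sum>k<n. ?c j * ?c k * (?s j x * ?s k x)) = (\<lambda>x. ?p n x * ?p n x)"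
      by (simp add: sum_product mult_ac)
    also have "(\<Sum>j<n. \<Sum>k<n. ?c j * ?c k * (if j = k then integral {0..1} (\<lambda>x. ?s k x * ?s k x) else 0))
        = (\<Sum>j<n. \<Sum>k<n. if j = k then (?c j)\<^sup>2 * integral {0..1} (\<lambda>x. ?s j x * ?s j x) else 0)"
      by (intro sum.cong refl) (simp add: power2_eq_square)
    also have "\<dots> = (\<Sum>k<n. (?c k)\<^sup>2 * integral {0..1} (\<lambda>x. ?s k x * ?s k x))"
      by (intro sum.cong refl) (simp add: sum.delta')
    finally show ?thesis using I has_integral_unique by blast
  qed
  then have "I = (\<lambda>n. \<Sum>k<n. (a k * (real k * pi) ^ i)\<^sup>2 * integral {0..1} (\<lambda>x. ?s k x * ?s k x))"
    by (intro ext)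
  then show ?thesis using lim J by (simp add: integral_unique power2_eq_square)
qed

lemma sine_series_square_integral_mono:
  assumes a: "rapidly_decreasing a" and b: "rapidly_decreasing b"
    and "0 \<le> r" and ba: "\<And>k. \<bar>b k\<bar> \<le> r * \<bar>a k\<bar>"
  shows "integral {0..1} (\<lambda>x. (sine_series b i x)\<^sup>2) \<le> r\<^sup>2 * integral {0..1} (\<lambda>x. (sine_series a i x)\<^sup>2)"
proof (rule LIMSEQ_le)
  let ?s = "\<lambda>k x. sin (real k * pi * x + real i * pi / 2)"
  let ?I = "\<lambda>k. integral {0..1} (\<lambda>x. ?s k x * ?s k x)"
  show "(\<lambda>n. \<Sum>k<n. (b k * (real k * pi) ^ i)\<^sup>2 * ?I k)
      \<longlonglongrightarrow> integral {0..1} (\<lambda>x. (sine_series b i x)\<^sup>2)"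
    by (rule sine_series_square_integral_tendsto[OF b])
  show "(\<lambda>n. r\<^sup>2 * (\<Sum>k<n. (a k * (real k * pi) ^ i)\<^sup>2 * ?I k))
      \<longlonglongrightarrow> r\<^sup>2 * integral {0..1} (\<lambda>x. (sine_series a i x)\<^sup>2)"
    by (intro tendsto_mult tendsto_const sine_series_square_integral_tendsto[OF a])
  have "(\<Sum>k<n. (b k * (real k * pi) ^ i)\<^sup>2 * ?I k)
      \<le> r\<^sup>2 * (\<Sum>k<n. (a k * (real k * pi) ^ i)\<^sup>2 * ?I k)" for n
    unfolding sum_distrib_left
  proof (rule sum_mono)
    fix k
    have "(b k)\<^sup>2 \<le> r\<^sup>2 * (a k)\<^sup>2"
      using power_mono[OF ba[of k], of 2] by (simp add: power_mult_distrib)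
    then have "(b k)\<^sup>2 * ((real k * pi) ^ i)\<^sup>2 \<le> r\<^sup>2 * (a k)\<^sup>2 * ((real k * pi) ^ i)\<^sup>2"
      by (rule mult_right_mono) simp
    then have "(b k * (real k * pi) ^ i)\<^sup>2 \<le> r\<^sup>2 * (a k * (real k * pi) ^ i)\<^sup>2"
      by (simp only: power_mult_distrib mult.assoc)
    moreover have "0 \<le> ?I k"
      by (intro integral_nonneg integrable_continuous_real continuous_intros) auto
    ultimately show "(b k * (real k * pi) ^ i)\<^sup>2 * ?I k
        \<le> r\<^sup>2 * ((a k * (real k * pi) ^ i)\<^sup>2 * ?I k)"
      by (simp only: mult.assoc[symmetric] mult_right_mono)
  qed
  then show "\<exists>N. \<forall>n\<ge>N. (\<Sum>k<n. (b k * (real k * pi) ^ i)\<^sup>2 * ?I k)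
      \<le> r\<^sup>2 * (\<Sum>k<n. (a k * (real k * pi) ^ i)\<^sup>2 * ?I k)"
    by blast
qed

lemma sine_series_coefficient:
  assumes a: "rapidly_decreasing a" and a0: "a 0 = 0"
  shows "integral {0..1} (\<lambda>x. sine_series a 0 x * sin (real j * pi * x)) = a j / 2"
proof -
  let ?s = "\<lambda>k x. sin (real k * pi * x)"
  let ?p = "\<lambda>n x. \<Sum>k<n. a k * ?s k x"
  have ul: "uniform_limit {0..1} ?p (sine_series a 0) sequentially"
    using sine_series_uniform_limit[OF a, where i = 0 and S = "{0..1}"] by simp
  have "bounded (sine_series a 0 ` {0..1})"
    by (intro compact_imp_bounded compact_continuous_image sine_series_continuous a compact_Icc)
  moreover have "bounded (?s j ` {0..1})"
    by (intro compact_imp_bounded compact_continuous_image continuous_intros compact_Icc)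
  ultimately have ul2: "uniform_limit {0..1} (\<lambda>n x. ?p n x * ?s j x) (\<lambda>x. sine_series a 0 x * ?s j x) sequentially"
    by (intro uniform_lim_mult ul uniform_limit_const)
  have cont: "continuous_on {0..1} (\<lambda>x. ?p n x * ?s j x)" for n
    by (intro continuous_intros)
  obtain I J where I: "\<And>n. ((\<lambda>x. ?p n x * ?s j x) has_integral I n) {0..1}"
    and J: "((\<lambda>x. sine_series a 0 x * ?s j x) has_integral J) {0..1}"
    and lim: "I \<longlonglongrightarrow> J"
    by (rule uniform_limit_integral[OF ul2 cont sequentially_bot]) blast
  have "I n = a j / 2" if "j < n" for n
  proof -
    have "((\<lambda>x. \<Sum>k<n. a k * (?s k x * ?s j x)) has_integral
        (\<Sum>k<n. a k * (if k = j then integral {0..1} (\<lambda>x. ?s j x * ?s j x) else 0))) {0..1}"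
    proof (intro has_integral_sum has_integral_mult_right)
      fix k
      show "((\<lambda>x. ?s k x * ?s j x) has_integral
          (if k = j then integral {0..1} (\<lambda>x. ?s j x * ?s j x) else 0)) {0..1}"
        using sin_phase_orthogonal[of k j 0]
        by (auto intro!: integrable_integral integrable_continuous_real continuous_intros)
    qed auto
    also have "(\<lambda>x. \<Sum>k<n. a k * (?s k x * ?s j x)) = (\<lambda>x. ?p n x * ?s j x)"
      by (simp add: sum_distrib_right mult.assoc)
    also have "(\<Sum>k<n. a k * (if k = j then integral {0..1} (\<lambda>x. ?s j x * ?s j x) else 0))
        = (\<Sum>k<n. if k = j then a j * integral {0..1} (\<lambda>x. ?s j x * ?s j x) else 0)"
      by (intro sum.cong refl) simp
    also have "\<dots> = a j * integral {0..1} (\<lambda>x. ?s j x * ?s j x)"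
      using that by (simp add: sum.delta)
    also have "\<dots> = a j / 2"
      using a0 integral_unique[OF sin_square_has_integral[of j]] by (cases "j = 0") auto
    finally show ?thesis using I has_integral_unique by blast
  qed
  then have "I \<longlonglongrightarrow> a j / 2"
    by (intro tendsto_eventually eventually_sequentiallyI[of "Suc j"]) auto
  then show ?thesis using lim J LIMSEQ_unique integral_unique by blast
qed

lemma power_over_fact_le_exp:
  fixes x :: real
  assumes "0 \<le> x"
  shows "x ^ i / fact i \<le> exp x"
proof -
  have "(\<Sum>n\<in>{i}. x ^ n /\<^sub>R fact n) \<le> (\<Sum>n. x ^ n /\<^sub>R fact n)"
    using assms by (intro sum_le_suminf summable_exp_generic) auto
  then show ?thesis by (simp add: exp_def divide_inverse mult.commute)
qed

text \<open>Powers of \<open>k\<close> are absorbed by \<open>exp (c k / 2)\<close>, and \<open>k\<^sup>2 \<ge> k\<close> leaves a geometric series.\<close>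

lemma rapidly_decreasing_gaussian:
  assumes "0 < c" and C: "\<And>k. \<bar>a k\<bar> \<le> C * exp (- c * (real k)\<^sup>2)"
  shows "rapidly_decreasing a"
  unfolding rapidly_decreasing_def
proof
  fix i
  \<comment> \<open>With this choice \<open>d k \<pi> = c k / 2\<close>.\<close>
  define d where "d = c / (2 * pi)"
  have "0 < d" using \<open>0 < c\<close> by (simp add: d_def)
  have "0 \<le> C" using C[of 0] by (smt (verit) exp_gt_zero mult_neg_pos)
  show "summable (\<lambda>k. \<bar>a k\<bar> * (real k * pi) ^ i)"
  proof (rule summable_comparison_test)
    show "summable (\<lambda>k. C * (fact i / d ^ i) * exp (- c / 2) ^ k)"
      using \<open>0 < c\<close> by (intro summable_mult summable_geometric) simp
    have "norm (\<bar>a k\<bar> * (real k * pi) ^ i) \<le> C * (fact i / d ^ i) * exp (- c / 2) ^ k" for k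
    proof -
      have eq: "d * (real k * pi) = c / 2 * real k" by (simp add: d_def)
      have "(d * (real k * pi)) ^ i / fact i \<le> exp (c / 2 * real k)"
        unfolding eq using \<open>0 < c\<close> by (intro power_over_fact_le_exp) auto
      then have "(real k * pi) ^ i \<le> (fact i / d ^ i) * exp (c / 2 * real k)"
        unfolding power_mult_distrib[of d] using \<open>0 < d\<close> by (simp add: field_simps)
      then have "\<bar>a k\<bar> * (real k * pi) ^ i
          \<le> (C * exp (- c * (real k)\<^sup>2)) * ((fact i / d ^ i) * exp (c / 2 * real k))"
        using C[of k] \<open>0 \<le> C\<close> by (intro mult_mono) auto
      also have "\<dots> \<le> (C * exp (- c * real k)) * ((fact i / d ^ i) * exp (c / 2 * real k))"
      proof -
        have "real k \<le> (real k)\<^sup>2" by (cases k) (auto simp: power2_eq_square)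
        then have "exp (- c * (real k)\<^sup>2) \<le> exp (- c * real k)" using \<open>0 < c\<close> by simp
        then show ?thesis using \<open>0 \<le> C\<close> \<open>0 < d\<close> by (intro mult_right_mono mult_left_mono) auto
      qed
      also have "\<dots> = C * (fact i / d ^ i) * exp (- c * real k + c / 2 * real k)"
        unfolding exp_add by (simp only: mult_ac)
      also have "- c * real k + c / 2 * real k = real k * (- c / 2)" by (simp add: field_simps)
      also have "exp (real k * (- c / 2)) = exp (- c / 2) ^ k" by (rule exp_of_nat_mult)
      finally show ?thesis by (simp add: abs_mult)
    qed
    then show "\<exists>N. \<forall>k\<ge>N. norm (\<bar>a k\<bar> * (real k * pi) ^ i) \<le> C * (fact i / d ^ i) * exp (- c / 2) ^ k"
      by blast
  qed
qed

section \<open>The heat equation with homogeneous Dirichlet conditions\<close>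

text \<open>A classical solution in the interior for positive times that is continuous up to the
  boundary and up to \<open>t = 0\<close>.\<close>

locale dirichlet_heat =
  fixes q :: real and w wx wxx :: "real \<Rightarrow> real \<Rightarrow> real"
  assumes q_pos: "q > 0"
    and w_continuous: "continuous_on ({0..1} \<times> {0..}) (\<lambda>(x, t). w x t)"
    and wx: "\<And>x t. 0 < x \<Longrightarrow> x < 1 \<Longrightarrow> 0 < t \<Longrightarrow>
        ((\<lambda>y. w y t) has_real_derivative wx x t) (at x)"
    and wxx: "\<And>x t. 0 < x \<Longrightarrow> x < 1 \<Longrightarrow> 0 < t \<Longrightarrow>
        ((\<lambda>y. wx y t) has_real_derivative wxx x t) (at x)"
    and wt: "\<And>x t. 0 < x \<Longrightarrow> x < 1 \<Longrightarrow> 0 < t \<Longrightarrow>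
        ((\<lambda>s. w x s) has_real_derivative q * wxx x t) (at t)"
    and w_0: "\<And>t. 0 \<le> t \<Longrightarrow> w 0 t = 0"
    and w_1: "\<And>t. 0 \<le> t \<Longrightarrow> w 1 t = 0"
begin

definition mode_decay :: "nat \<Rightarrow> real \<Rightarrow> real" where
  "mode_decay k t = exp (- q * (real k * pi)\<^sup>2 * t)"

definition sine_coef :: "nat \<Rightarrow> real \<Rightarrow> real" where
  "sine_coef k t = integral {0..1} (\<lambda>x. w x t * sin (real k * pi * x))"

lemma w_continuous_x: "0 \<le> t \<Longrightarrow> continuous_on {0..1} (\<lambda>x. w x t)"
  by (rule continuous_on_compose2[OF w_continuous, of _ "\<lambda>x. (x, t)", simplified])
     (auto intro!: continuous_intros)

lemma w_sin_continuous: "0 \<le> t \<Longrightarrow> continuous_on {0..1} (\<lambda>x. w x t * sin (real k * pi * x))"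
  by (rule continuous_on_mult[OF w_continuous_x]) (assumption, intro continuous_intros)

text \<open>The maximum principle propagates a uniform approximation of the initial value to all later
  times, since finite sine sums evolve explicitly and vanish on the boundary.\<close>

lemma sine_sum_approximation:
  assumes "0 < e"
  obtains N b where "\<And>x t. x \<in> {0..1} \<Longrightarrow> 0 \<le> t \<Longrightarrow>
      \<bar>w x t - (\<Sum>k\<le>N. b k * mode_decay k t * sin (real k * pi * x))\<bar> \<le> e"
proof -
  obtain N b where b: "\<And>x. x \<in> {0..1} \<Longrightarrow> \<bar>w x 0 - (\<Sum>k\<le>N. b k * sin (real k * pi * x))\<bar> < e"
    using sine_polynomials_dense[OF w_continuous_x w_0 w_1 \<open>0 < e\<close>, OF order_refl order_refl order_refl]
    by metis
  define S where "S = (\<lambda>x t. \<Sum>k\<le>N. b k * mode_decay k t * sin (real k * pi * x))"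
  define Sx where "Sx = (\<lambda>x t. \<Sum>k\<le>N. b k * mode_decay k t * (real k * pi * cos (real k * pi * x)))"
  define Sxx where "Sxx = (\<lambda>x t. \<Sum>k\<le>N. b k * mode_decay k t * (- ((real k * pi)\<^sup>2) * sin (real k * pi * x)))"
  have Sx: "((\<lambda>y. S y t) has_real_derivative Sx x t) (at x)" for x t
    unfolding S_def Sx_def
  proof (rule DERIV_sum)
    fix k
    show "((\<lambda>y. b k * mode_decay k t * sin (real k * pi * y)) has_real_derivative
        b k * mode_decay k t * (real k * pi * cos (real k * pi * x))) (at x)"
      by (rule derivative_eq_intros refl | simp)+
  qed
  have Sxx: "((\<lambda>y. Sx y t) has_real_derivative Sxx x t) (at x)" for x t
    unfolding Sx_def Sxx_def
  proof (rule DERIV_sum)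
    fix k
    show "((\<lambda>y. b k * mode_decay k t * (real k * pi * cos (real k * pi * y))) has_real_derivative
        b k * mode_decay k t * (- ((real k * pi)\<^sup>2) * sin (real k * pi * x))) (at x)"
      by (rule derivative_eq_intros refl | simp add: power2_eq_square)+
  qed
  have St: "((\<lambda>s. S x s) has_real_derivative q * Sxx x t) (at t)" for x t
    unfolding S_def Sxx_def mode_decay_def sum_distrib_left
  proof (rule DERIV_sum)
    fix k
    show "((\<lambda>s. b k * exp (- q * (real k * pi)\<^sup>2 * s) * sin (real k * pi * x)) has_real_derivative
        q * (b k * exp (- q * (real k * pi)\<^sup>2 * t) * (- ((real k * pi)\<^sup>2) * sin (real k * pi * x)))) (at t)"
      by (rule derivative_eq_intros refl | simp)+
  qed
  have S_cont: "continuous_on A (\<lambda>(x, t). S x t)" for A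
    unfolding S_def mode_decay_def split_beta by (intro continuous_intros)
  have S_bdry: "S 0 t = 0" "S 1 t = 0" for t
    unfolding S_def by (auto simp: sin_npi intro!: sum.neutral)
  have S_0: "S x 0 = (\<Sum>k\<le>N. b k * sin (real k * pi * x))" for x
    by (simp add: S_def mode_decay_def)
  \<comment> \<open>The factor \<open>c\<close> yields the upper and the lower bound from the one-sided maximum principle.\<close>
  have bound: "c * (w x t - S x t) \<le> e" if c: "c = 1 \<or> c = -1" and x: "x \<in> {0..1}" and t: "0 \<le> t" for c x t
  proof (rule heat_maximum_principle[OF q_pos, where T = t and vx = "\<lambda>x t. c * (wx x t - Sx x t)"
        and vxx = "\<lambda>x t. c * (wxx x t - Sxx x t)" and v = "\<lambda>x t. c * (w x t - S x t)"])
    show "continuous_on ({0..1} \<times> {0..t}) (\<lambda>(x, t). c * (w x t - S x t))"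
    proof -
      have "continuous_on ({0..1} \<times> {0..t}) (\<lambda>(x, t). w x t)"
        by (rule continuous_on_subset[OF w_continuous]) auto
      then show ?thesis
        using S_cont[of "{0..1} \<times> {0..t}"] unfolding split_beta
        by (intro continuous_on_mult continuous_on_const continuous_on_diff)
    qed
    show "((\<lambda>y. c * (w y s - S y s)) has_real_derivative c * (wx y s - Sx y s)) (at y)"
      if "0 < y" "y < 1" "0 < s" "s \<le> t" for y s
      using that by (intro DERIV_cmult DERIV_diff wx Sx)
    show "((\<lambda>y. c * (wx y s - Sx y s)) has_real_derivative c * (wxx y s - Sxx y s)) (at y)"
      if "0 < y" "y < 1" "0 < s" "s \<le> t" for y s
      using that by (intro DERIV_cmult DERIV_diff wxx Sxx)
    show "((\<lambda>s. c * (w y s - S y s)) has_real_derivative q * (c * (wxx y s - Sxx y s))) (at s)"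
      if "0 < y" "y < 1" "0 < s" "s \<le> t" for y s
    proof -
      have "((\<lambda>s. c * (w y s - S y s)) has_real_derivative c * (q * wxx y s - q * Sxx y s)) (at s)"
        using that by (intro DERIV_cmult DERIV_diff wt St)
      then show ?thesis by (simp add: algebra_simps)
    qed
    show "c * (w 0 s - S 0 s) \<le> e \<and> c * (w 1 s - S 1 s) \<le> e" if "0 \<le> s" "s \<le> t" for s
      using that \<open>0 < e\<close> by (simp add: w_0 w_1 S_bdry)
    show "c * (w y 0 - S y 0) \<le> e" if "0 \<le> y" "y \<le> 1" for y
      using b[of y] that c by (auto simp: S_0 abs_less_iff)
  qed (use x t in auto)
  have "\<bar>w x t - S x t\<bar> \<le> e" if "x \<in> {0..1}" "0 \<le> t" for x t
    using bound[of 1 x t] bound[of "-1" x t] that by (simp add: abs_le_iff)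
  then show ?thesis using that[where N = N and b = b] by (simp add: S_def)
qed

text \<open>This holds exactly for the approximating sums, and coefficients depend continuously on the
  function in the uniform norm. No differentiation under the integral sign is involved, for which
  the pointwise equation would give no dominating function.\<close>

lemma sine_coef_decay:
  assumes t: "0 \<le> t"
  shows "sine_coef k t = mode_decay k t * sine_coef k 0"
proof -
  have approx: "\<bar>sine_coef k t - mode_decay k t * sine_coef k 0\<bar> \<le> 0 + e" if "0 < e" for e
  proof -
    obtain N b where b: "\<And>x t. x \<in> {0..1} \<Longrightarrow> 0 \<le> t \<Longrightarrow>
        \<bar>w x t - (\<Sum>k\<le>N. b k * mode_decay k t * sin (real k * pi * x))\<bar> \<le> e / 2"
      using sine_sum_approximation[OF half_gt_zero[OF \<open>0 < e\<close>]] by metis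
    define S where "S = (\<lambda>x t. \<Sum>k\<le>N. b k * mode_decay k t * sin (real k * pi * x))"
    define c where "c s = integral {0..1} (\<lambda>x. S x s * sin (real k * pi * x))" for s
    have S_cont: "continuous_on {0..1} (\<lambda>x. S x s * sin (real k * pi * x))" for s
      unfolding S_def by (intro continuous_intros)
    have near: "\<bar>sine_coef k s - c s\<bar> \<le> e / 2" if "0 \<le> s" for s
      unfolding sine_coef_def c_def
    proof (rule integral_abs_diff_le)
      show "(\<lambda>x. w x s * sin (real k * pi * x)) integrable_on {0..1}"
        by (intro integrable_continuous_real w_sin_continuous that)
      show "(\<lambda>x. S x s * sin (real k * pi * x)) integrable_on {0..1}"
        by (intro integrable_continuous_real S_cont)
      fix x :: real assume x: "x \<in> {0..1}"
      have "\<bar>w x s - S x s\<bar> * \<bar>sin (real k * pi * x)\<bar> \<le> (e / 2) * 1"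
        using b[OF x that] \<open>0 < e\<close> by (intro mult_mono) (auto simp: S_def)
      then show "\<bar>w x s * sin (real k * pi * x) - S x s * sin (real k * pi * x)\<bar> \<le> e / 2"
        by (simp add: abs_mult flip: left_diff_distrib)
    qed
    have c_eq: "c s = (b k * mode_decay k s * (if k \<le> N then 1 else 0))
        * integral {0..1} (\<lambda>x. sin (real k * pi * x) * sin (real k * pi * x))" for s
    proof -
      let ?o = "integral {0..1} (\<lambda>x. sin (real k * pi * x) * sin (real k * pi * x))"
      have "((\<lambda>x. \<Sum>j\<le>N. (b j * mode_decay j s) * (sin (real j * pi * x) * sin (real k * pi * x)))
          has_integral (\<Sum>j\<le>N. (b j * mode_decay j s) * (if j = k then ?o else 0))) {0..1}"
      proof (intro has_integral_sum has_integral_mult_right)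
        fix j
        show "((\<lambda>x. sin (real j * pi * x) * sin (real k * pi * x)) has_integral (if j = k then ?o else 0)) {0..1}"
          using sin_phase_orthogonal[of j k 0]
          by (auto intro!: integrable_integral integrable_continuous_real continuous_intros)
      qed auto
      also have "(\<lambda>x. \<Sum>j\<le>N. (b j * mode_decay j s) * (sin (real j * pi * x) * sin (real k * pi * x)))
          = (\<lambda>x. S x s * sin (real k * pi * x))"
        by (simp add: S_def sum_distrib_right mult.assoc)
      also have "(\<Sum>j\<le>N. (b j * mode_decay j s) * (if j = k then ?o else 0))
          = (\<Sum>j\<le>N. if j = k then b k * mode_decay k s * ?o else 0)"
        by (intro sum.cong) auto
      also have "\<dots> = (b k * mode_decay k s * (if k \<le> N then 1 else 0)) * ?o"
        by (simp add: sum.delta)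
      finally show ?thesis unfolding c_def by (rule integral_unique)
    qed
    have "c t = mode_decay k t * c 0"
      unfolding c_eq by (simp add: mode_decay_def)
    moreover have "0 \<le> mode_decay k t" "mode_decay k t \<le> 1"
      using q_pos t by (auto simp: mode_decay_def)
    then have "\<bar>mode_decay k t * (sine_coef k 0 - c 0)\<bar> \<le> 1 * (e / 2)"
      unfolding abs_mult using near[of 0] by (intro mult_mono) auto
    moreover have "sine_coef k t - mode_decay k t * sine_coef k 0
        = (sine_coef k t - c t) - mode_decay k t * (sine_coef k 0 - c 0) + (c t - mode_decay k t * c 0)"
      by (simp add: algebra_simps)
    ultimately show ?thesis using near[OF t] by linarith
  qed
  have "\<bar>sine_coef k t - mode_decay k t * sine_coef k 0\<bar> \<le> 0"
    by (rule field_le_epsilon) (rule approx)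
  then show ?thesis by simp
qed

definition series_coef :: "real \<Rightarrow> nat \<Rightarrow> real" where
  "series_coef t k = 2 * sine_coef k t"

lemma series_coef_rapidly_decreasing:
  assumes "0 < t"
  shows "rapidly_decreasing (series_coef t)"
proof -
  obtain K where "0 < K" and K: "\<And>x. x \<in> {0..1} \<Longrightarrow> \<bar>w x 0\<bar> \<le> K"
    using compact_imp_bounded[OF compact_continuous_image[OF w_continuous_x[of 0] compact_Icc]]
    unfolding bounded_pos by force
  have coef_le: "\<bar>sine_coef k 0\<bar> \<le> K" for k
  proof -
    have "\<bar>sine_coef k 0 - integral {0..1::real} (\<lambda>x. 0)\<bar> \<le> K"
      unfolding sine_coef_def
    proof (rule integral_abs_diff_le)
      show "(\<lambda>x. w x 0 * sin (real k * pi * x)) integrable_on {0..1}"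
        by (intro integrable_continuous_real w_sin_continuous order_refl)
      fix x :: real assume "x \<in> {0..1}"
      then have "\<bar>w x 0\<bar> * \<bar>sin (real k * pi * x)\<bar> \<le> K * 1"
        using K \<open>0 < K\<close> by (intro mult_mono) auto
      then show "\<bar>w x 0 * sin (real k * pi * x) - 0\<bar> \<le> K" by (simp add: abs_mult)
    qed (rule integrable_0)
    then show ?thesis by simp
  qed
  show ?thesis
  proof (rule rapidly_decreasing_gaussian)
    show "0 < q * pi\<^sup>2 * t" using q_pos \<open>0 < t\<close> by simp
    fix k
    have "\<bar>series_coef t k\<bar> = 2 * mode_decay k t * \<bar>sine_coef k 0\<bar>"
      using \<open>0 < t\<close> by (simp add: series_coef_def sine_coef_decay[of t k] abs_mult mode_decay_def)
    also have "\<dots> \<le> 2 * mode_decay k t * K"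
      using coef_le by (intro mult_left_mono) (auto simp: mode_decay_def)
    also have "\<dots> = (2 * K) * exp (- (q * pi\<^sup>2 * t) * (real k)\<^sup>2)"
      by (simp add: mode_decay_def power_mult_distrib mult_ac)
    finally show "\<bar>series_coef t k\<bar> \<le> (2 * K) * exp (- (q * pi\<^sup>2 * t) * (real k)\<^sup>2)" .
  qed
qed

lemma series_coef_0: "series_coef t 0 = 0"
  by (simp add: series_coef_def sine_coef_def)

text \<open>For \<open>t > 0\<close> the coefficients decay like a Gaussian, so the series converges uniformly; it has
  the same sine coefficients as \<open>w(\<cdot>,t)\<close>.\<close>

lemma w_eq_sine_series:
  assumes t: "0 < t" and x: "x \<in> {0..1}"
  shows "w x t = sine_series (series_coef t) 0 x"
proof -
  let ?S = "sine_series (series_coef t) 0"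
  note rd = series_coef_rapidly_decreasing[OF t]
  have wc: "continuous_on {0..1} (\<lambda>x. w x t)" and Sc: "continuous_on {0..1} ?S"
    using t by (auto intro: w_continuous_x sine_series_continuous[OF rd])
  have "w x t - ?S x = 0"
  proof (rule sine_coefficients_determine[OF _ _ _ _ x])
    show "continuous_on {0..1} (\<lambda>x. w x t - ?S x)" by (intro continuous_on_diff wc Sc)
    show "w 0 t - ?S 0 = 0" "w 1 t - ?S 1 = 0"
      using t by (auto simp: w_0 w_1 sine_series_def sin_npi)
    fix k
    have "integral {0..1} (\<lambda>x. (w x t - ?S x) * sin (real k * pi * x))
        = integral {0..1} (\<lambda>x. w x t * sin (real k * pi * x)) - integral {0..1} (\<lambda>x. ?S x * sin (real k * pi * x))"
      unfolding left_diff_distrib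
      by (intro integral_diff integrable_continuous_real w_sin_continuous less_imp_le[OF t] continuous_on_mult[OF Sc])
        (intro continuous_intros)
    also have "integral {0..1} (\<lambda>x. ?S x * sin (real k * pi * x)) = sine_coef k t"
      by (simp add: sine_series_coefficient[OF rd series_coef_0] series_coef_def[of t k])
    also have "integral {0..1} (\<lambda>x. w x t * sin (real k * pi * x)) - sine_coef k t = 0"
      by (simp add: sine_coef_def)
    finally show "integral {0..1} (\<lambda>x. (w x t - ?S x) * sin (real k * pi * x)) = 0" .
  qed
  then show ?thesis by simp
qed

text \<open>Each mode \<open>k \<ge> 1\<close> decays at least as fast as the first one.\<close>

lemma derivative_square_integral_decay:
  assumes "0 < s" "s \<le> t"
  shows "integral {0..1} (\<lambda>x. (sine_series (series_coef t) i x)\<^sup>2)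
    \<le> (exp (- (q * pi\<^sup>2) * (t - s)))\<^sup>2 * integral {0..1} (\<lambda>x. (sine_series (series_coef s) i x)\<^sup>2)"
proof (rule sine_series_square_integral_mono)
  show "rapidly_decreasing (series_coef s)" "rapidly_decreasing (series_coef t)"
    using assms by (auto intro: series_coef_rapidly_decreasing)
  fix k
  show "\<bar>series_coef t k\<bar> \<le> exp (- (q * pi\<^sup>2) * (t - s)) * \<bar>series_coef s k\<bar>"
  proof (cases "k = 0")
    case False
    then have "1 \<le> (real k)\<^sup>2" by simp
    then have "q * pi\<^sup>2 * (t - s) * 1 \<le> q * pi\<^sup>2 * (t - s) * (real k)\<^sup>2"
      using q_pos assms by (intro mult_left_mono) auto
    then have "exp (- q * (real k * pi)\<^sup>2 * (t - s)) \<le> exp (- (q * pi\<^sup>2) * (t - s))"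
      by (simp add: power_mult_distrib mult_ac)
    then have "exp (- q * (real k * pi)\<^sup>2 * (t - s)) * \<bar>series_coef s k\<bar>
        \<le> exp (- (q * pi\<^sup>2) * (t - s)) * \<bar>series_coef s k\<bar>"
      by (intro mult_right_mono) auto
    moreover have "series_coef t k = exp (- q * (real k * pi)\<^sup>2 * (t - s)) * series_coef s k"
    proof -
      have "mode_decay k t = exp (- q * (real k * pi)\<^sup>2 * (t - s)) * mode_decay k s"
        unfolding mode_decay_def by (simp add: algebra_simps flip: exp_add)
      then show ?thesis using assms by (simp add: series_coef_def sine_coef_decay[of t k] sine_coef_decay[of s k])
    qed
    ultimately show ?thesis by (simp add: abs_mult)
  qed (simp add: series_coef_0)
qed simp

end

lemma L2_norm_continuous:
  assumes "continuous_on {0..1} f"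
  shows "L2_norm f = sqrt (integral {0..1} (\<lambda>x. (f x)\<^sup>2))"
  unfolding L2_norm_def by (simp add: unit_lebesgue_continuous(2)[OF continuous_on_power[OF assms]])

lemma L2_norm_le_bound:
  assumes f: "continuous_on {0..1} f" and c: "0 \<le> c" "\<And>x. x \<in> {0..1} \<Longrightarrow> \<bar>f x\<bar> \<le> c"
  shows "L2_norm f \<le> c"
proof -
  have "integral {0..1} (\<lambda>x. (f x)\<^sup>2) \<le> integral {0..1::real} (\<lambda>x. c\<^sup>2)"
  proof (rule integral_le)
    show "(\<lambda>x. (f x)\<^sup>2) integrable_on {0..1}"
      by (intro integrable_continuous_real continuous_on_power f)
    show "(f x)\<^sup>2 \<le> c\<^sup>2" if "x \<in> {0..1}" for x
      using power_mono[OF c(2)[OF that], of 2] by simp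
  qed (intro integrable_continuous_real continuous_on_const)
  then have "integral {0..1} (\<lambda>x. (f x)\<^sup>2) \<le> c\<^sup>2" by simp
  from real_sqrt_le_mono[OF this] show ?thesis
    using c(1) by (simp add: L2_norm_continuous[OF f])
qed

lemma integral_abs_le_L2_norm:
  assumes f: "continuous_on {0..1} f"
  shows "integral {0..1} (\<lambda>x. \<bar>f x\<bar>) \<le> L2_norm f"
proof -
  have af: "continuous_on {0..1} (\<lambda>x. \<bar>f x\<bar>)" by (intro continuous_on_rabs f)
  have "\<bar>unit_integral (\<lambda>x. \<bar>f x\<bar> * 1)\<bar> \<le> L2_norm (\<lambda>x. \<bar>f x\<bar>) * L2_norm (\<lambda>x. 1)"
    by (intro L2_cauchy_schwarz L2_01_continuous af continuous_on_const)
  moreover have "L2_norm (\<lambda>x. \<bar>f x\<bar>) = L2_norm f" by (simp add: L2_norm_def)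
  moreover have "L2_norm (\<lambda>x. 1) = 1" by (simp add: L2_norm_continuous)
  ultimately show ?thesis by (simp add: unit_lebesgue_continuous(2)[OF af])
qed

text \<open>Average \<open>f 0 = f x - \<integral>\<^sub>0\<^sup>x f'\<close> over \<open>x\<close> in the unit interval.\<close>

lemma trace_le_L2_norms:
  assumes f: "continuous_on {0..1} f" and f': "continuous_on {0..1} f'"
    and deriv: "\<And>x. 0 < x \<Longrightarrow> x < 1 \<Longrightarrow> (f has_real_derivative f' x) (at x)"
  shows "\<bar>f 0\<bar> \<le> L2_norm f + L2_norm f'"
proof -
  have af: "continuous_on {0..1} (\<lambda>x. \<bar>f x\<bar>)" and af': "continuous_on {0..1} (\<lambda>x. \<bar>f' x\<bar>)"
    by (intro continuous_on_rabs f f')+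
  define c where "c = integral {0..1} (\<lambda>x. \<bar>f' x\<bar>)"
  have "\<bar>f 0\<bar> \<le> \<bar>f x\<bar> + c" if x: "x \<in> {0..1}" for x
  proof -
    have sub: "{0..x} \<subseteq> {0..1}" using x by auto
    have "(f' has_integral f x - f 0) {0..x}"
    proof (rule fundamental_theorem_of_calculus_interior)
      show "continuous_on {0..x} f" by (rule continuous_on_subset[OF f sub])
      show "(f has_vector_derivative f' y) (at y)" if "y \<in> {0<..<x}" for y
        using deriv[of y] that x by (auto simp: has_real_derivative_iff_has_vector_derivative)
    qed (use x in auto)
    then have i: "f x - f 0 = integral {0..x} f'" by (simp add: integral_unique)
    have "norm (integral {0..x} f') \<le> integral {0..x} (\<lambda>y. \<bar>f' y\<bar>)"
      by (rule integral_norm_bound_integral)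
        (auto intro!: integrable_continuous_real continuous_on_subset[OF f' sub] continuous_on_subset[OF af' sub])
    also have "\<dots> \<le> c" unfolding c_def
      by (rule integral_subset_le[OF sub])
        (auto intro!: integrable_continuous_real continuous_on_subset[OF af' sub] af')
    finally show ?thesis using i by (simp add: abs_le_iff) linarith
  qed
  then have "integral {0..1::real} (\<lambda>x. \<bar>f 0\<bar>) \<le> integral {0..1} (\<lambda>x. \<bar>f x\<bar> + c)"
    by (intro integral_le integrable_continuous_real continuous_on_add af continuous_on_const)
  also have "\<dots> = integral {0..1} (\<lambda>x. \<bar>f x\<bar>) + c"
    using integral_add[OF integrable_continuous_real[OF af]
        integrable_continuous_real[OF continuous_on_const[of "{0..1}" c]]] by simp
  finally show ?thesis
    using integral_abs_le_L2_norm[OF f] integral_abs_le_L2_norm[OF f'] by (simp add: c_def)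
qed

context dirichlet_heat
begin

text \<open>The case \<open>i = 0\<close> is separated because the series represents \<open>w\<close> only on the unit interval,
  whereas the sequence of weak derivatives has to start with the function \<open>w(\<cdot>,t)\<close> itself.\<close>

definition w_deriv :: "real \<Rightarrow> nat \<Rightarrow> real \<Rightarrow> real" where
  "w_deriv t i = (if i = 0 then (\<lambda>x. w x t) else sine_series (series_coef t) i)"

lemma w_deriv_eq: "0 < t \<Longrightarrow> x \<in> {0..1} \<Longrightarrow> w_deriv t i x = sine_series (series_coef t) i x"
  by (simp add: w_deriv_def w_eq_sine_series)

lemma w_deriv_continuous: "0 < t \<Longrightarrow> continuous_on {0..1} (w_deriv t i)"
  using sine_series_continuous[OF series_coef_rapidly_decreasing, of t "{0..1}" i]
  by (subst continuous_on_cong[OF refl w_deriv_eq]) auto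

lemma w_deriv_chain:
  assumes t: "0 < t"
  shows "weak_chain k (w_deriv t)"
proof (rule weak_chain_classical)
  show "continuous_on {0..1} (w_deriv t j)" for j by (rule w_deriv_continuous[OF t])
  fix j and x :: real assume x: "0 < x" "x < 1"
  have "(sine_series (series_coef t) j has_real_derivative w_deriv t (Suc j) x) (at x)"
    using sine_series_DERIV[OF series_coef_rapidly_decreasing[OF t]] by (simp add: w_deriv_def)
  then show "(w_deriv t j has_real_derivative w_deriv t (Suc j) x) (at x)"
    by (rule has_field_derivative_transform_within_open[where S = "{0<..<1}"])
      (use x in \<open>auto simp: w_deriv_eq[OF t]\<close>)
qed

lemma w_deriv_L2_norm:
  assumes "0 < t"
  shows "L2_norm (w_deriv t i) = sqrt (integral {0..1} (\<lambda>x. (sine_series (series_coef t) i x)\<^sup>2))"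
proof -
  have "integral {0..1} (\<lambda>x. (w_deriv t i x)\<^sup>2) = integral {0..1} (\<lambda>x. (sine_series (series_coef t) i x)\<^sup>2)"
    by (rule integral_cong) (simp add: w_deriv_eq[OF assms])
  then show ?thesis by (simp add: L2_norm_continuous[OF w_deriv_continuous[OF assms]])
qed

lemma H_norm_w: "0 < t \<Longrightarrow> H_norm k (\<lambda>x. w x t) = L2_set (\<lambda>i. L2_norm (w_deriv t i)) {..k}"
  using weak_chain_H_norm[OF w_deriv_chain, of t k] by (simp add: w_deriv_def)

lemma H_norm_decay_positive_times:
  assumes "0 < s" "s \<le> t"
  shows "H_norm k (\<lambda>x. w x t) \<le> exp (- (q * pi\<^sup>2) * (t - s)) * H_norm k (\<lambda>x. w x s)"
proof -
  let ?r = "exp (- (q * pi\<^sup>2) * (t - s))"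
  have "L2_norm (w_deriv t i) \<le> ?r * L2_norm (w_deriv s i)" for i
  proof -
    have "L2_norm (w_deriv t i)
        \<le> sqrt (?r\<^sup>2 * integral {0..1} (\<lambda>x. (sine_series (series_coef s) i x)\<^sup>2))"
      unfolding w_deriv_L2_norm[OF order_less_le_trans[OF assms]]
      by (rule real_sqrt_le_mono[OF derivative_square_integral_decay[OF assms]])
    also have "\<dots> = ?r * L2_norm (w_deriv s i)"
      unfolding w_deriv_L2_norm[OF assms(1)] by (simp add: real_sqrt_mult)
    finally show ?thesis .
  qed
  then have "H_norm k (\<lambda>x. w x t) \<le> L2_set (\<lambda>i. ?r * L2_norm (w_deriv s i)) {..k}"
    using assms by (subst H_norm_w) (auto intro!: L2_set_mono L2_norm_nonneg)
  also have "\<dots> = ?r * H_norm k (\<lambda>x. w x s)"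
    using assms by (simp add: H_norm_w L2_set_right_distrib)
  finally show ?thesis .
qed

text \<open>Letting \<open>s \<rightarrow> 0\<close> in \<open>H_norm_decay_positive_times\<close>. The series at time \<open>0\<close> need not be
  differentiable term by term, so the norm at time \<open>0\<close> enters only through continuity in \<open>H\<^sup>k\<close>.\<close>

lemma H_norm_decay:
  assumes H: "\<And>t. 0 \<le> t \<Longrightarrow> (\<lambda>x. w x t) \<in> H_sp k"
    and cont: "((\<lambda>s. H_norm k (\<lambda>x. w x s - w x 0)) \<longlongrightarrow> 0) (at_right 0)"
    and t: "0 \<le> t"
  shows "H_norm k (\<lambda>x. w x t) \<le> exp (- (q * pi\<^sup>2) * t) * H_norm k (\<lambda>x. w x 0)"
proof (cases "t = 0")
  case False
  with t have "0 < t" by simp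
  have "H_norm k (\<lambda>x. w x s) \<le> H_norm k (\<lambda>x. w x 0) + H_norm k (\<lambda>x. w x s - w x 0)" if "0 \<le> s" for s
  proof -
    have d: "(\<lambda>x. w x s - w x 0) \<in> H_sp k"
      using H_sp_lincomb[OF H[OF that] H[OF order_refl], of 1 "-1"] by simp
    show ?thesis using H_norm_lincomb_le[OF H[OF order_refl] d, of 1 1] by simp
  qed
  then have "H_norm k (\<lambda>x. w x t) \<le> exp (- (q * pi\<^sup>2) * (t - s))
      * (H_norm k (\<lambda>x. w x 0) + H_norm k (\<lambda>x. w x s - w x 0))" if "0 < s" "s \<le> t" for s
    using that by (intro order_trans[OF H_norm_decay_positive_times[OF that]] mult_left_mono) auto
  then have ev: "\<forall>\<^sub>F s in at_right 0. H_norm k (\<lambda>x. w x t) \<le> exp (- (q * pi\<^sup>2) * (t - s))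
      * (H_norm k (\<lambda>x. w x 0) + H_norm k (\<lambda>x. w x s - w x 0))"
    using \<open>0 < t\<close> by (auto simp: eventually_at_right_field intro!: exI[of _ t])
  have "((\<lambda>s. exp (- (q * pi\<^sup>2) * (t - s)) * (H_norm k (\<lambda>x. w x 0) + H_norm k (\<lambda>x. w x s - w x 0)))
      \<longlongrightarrow> exp (- (q * pi\<^sup>2) * (t - 0)) * (H_norm k (\<lambda>x. w x 0) + 0)) (at_right 0)"
    by (intro tendsto_intros cont)
  from tendsto_lowerbound[OF this ev] show ?thesis by simp
qed simp

text \<open>The forcing of the finite-dimensional part is controlled by two derivatives of \<open>w\<close>.\<close>

lemma w_deriv_trace:
  assumes t: "0 < t" and k: "2 \<le> k"
  shows "\<bar>w_deriv t 1 0\<bar> \<le> 2 * H_norm k (\<lambda>x. w x t)"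
proof -
  have "\<bar>w_deriv t 1 0\<bar> \<le> L2_norm (w_deriv t 1) + L2_norm (w_deriv t 2)"
    by (rule trace_le_L2_norms[OF w_deriv_continuous w_deriv_continuous, OF t t])
      (use sine_series_DERIV[OF series_coef_rapidly_decreasing[OF t], of 1] in
        \<open>simp add: w_deriv_def numeral_2_eq_2\<close>)
  moreover have le: "L2_norm (w_deriv t i) \<le> H_norm k (\<lambda>x. w x t)" if "i \<le> k" for i
    unfolding H_norm_w[OF t] using that by (intro member_le_L2_set) auto
  ultimately show ?thesis using le[of 1] le[of 2] k by linarith
qed

lemma w_DERIV_at_0:
  assumes t: "0 < t"
  shows "((\<lambda>x. w x t) has_real_derivative w_deriv t 1 0) (at 0 within {0..1})"
proof -
  have "(sine_series (series_coef t) 0 has_real_derivative w_deriv t 1 0) (at 0 within {0..1})"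
    using sine_series_DERIV[OF series_coef_rapidly_decreasing[OF t], of 0 0]
    by (simp add: w_deriv_def has_field_derivative_at_within)
  then show ?thesis
    by (rule has_field_derivative_transform_within[where d = 1])
      (auto simp: w_eq_sine_series[OF t])
qed

end

section \<open>Decay of the observer error\<close>

lemma profile_inner_chain: "weak_chain k (\<lambda>i x. profile q M r i x \<bullet> z)"
proof (rule weak_chain_classical)
  show d: "((\<lambda>x. profile q M r j x \<bullet> z) has_real_derivative profile q M r (Suc j) x \<bullet> z) (at x)" for j x
    unfolding has_real_derivative_iff_has_vector_derivative
    by (rule bounded_linear.has_vector_derivative[OF bounded_linear_inner_left profile_has_vector_derivative])
  show "continuous_on {0..1} (\<lambda>x. profile q M r j x \<bullet> z)" for j
    by (rule DERIV_continuous_on[OF has_field_derivative_at_within[OF d]])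
qed

lemma profile_continuous: "continuous_on S (profile q M r i)"
  by (intro continuous_at_imp_continuous_on ballI has_vector_derivative_continuous[OF profile_has_vector_derivative])

text \<open>The profiles are smooth, so all their derivatives up to order \<open>k\<close> are bounded on the unit
  interval.\<close>

lemma profile_inner_H_norm_bound:
  obtains K where "0 \<le> K" "\<And>z. H_norm k (\<lambda>x. profile q M r 0 x \<bullet> z) \<le> K * norm z"
proof -
  have "\<exists>B\<ge>0. \<forall>x\<in>{0..1}. norm (profile q M r i x) \<le> B" for i
  proof -
    have "bounded (profile q M r i ` {0..1})"
      by (intro compact_imp_bounded compact_continuous_image profile_continuous compact_Icc)
    then obtain B where "0 < B" "\<forall>y\<in>profile q M r i ` {0..1}. norm y \<le> B"
      unfolding bounded_pos by blast
    then show ?thesis by (intro exI[of _ B]) auto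
  qed
  then obtain B where B0: "\<And>i. 0 \<le> B i" and B: "\<And>i x. x \<in> {0..1} \<Longrightarrow> norm (profile q M r i x) \<le> B i"
    by metis
  have "H_norm k (\<lambda>x. profile q M r 0 x \<bullet> z) \<le> (\<Sum>i\<le>k. B i) * norm z" for z
  proof -
    have le: "L2_norm (\<lambda>x. profile q M r i x \<bullet> z) \<le> B i * norm z" for i
    proof (rule L2_norm_le_bound)
      show "continuous_on {0..1} (\<lambda>x. profile q M r i x \<bullet> z)"
        by (intro continuous_on_inner profile_continuous continuous_on_const)
      show "0 \<le> B i * norm z" using B0 by simp
      show "\<bar>profile q M r i x \<bullet> z\<bar> \<le> B i * norm z" if "x \<in> {0..1}" for x
        using Cauchy_Schwarz_ineq2[of "profile q M r i x" z] mult_right_mono[OF B[OF that], of "norm z" i]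
        by simp
    qed
    have "H_norm k (\<lambda>x. profile q M r 0 x \<bullet> z) = L2_set (\<lambda>i. L2_norm (\<lambda>x. profile q M r i x \<bullet> z)) {..k}"
      by (rule weak_chain_H_norm[OF profile_inner_chain])
    also have "\<dots> \<le> (\<Sum>i\<le>k. L2_norm (\<lambda>x. profile q M r i x \<bullet> z))"
      by (rule L2_set_le_sum) (rule L2_norm_nonneg)
    also have "\<dots> \<le> (\<Sum>i\<le>k. B i * norm z)" by (intro sum_mono le)
    finally show ?thesis by (simp add: sum_distrib_right)
  qed
  moreover have "0 \<le> (\<Sum>i\<le>k. B i)" by (intro sum_nonneg B0)
  ultimately show ?thesis using that by blast
qed

lemma join_vec_nth [simp]: "join_vec v w $ Inl a = v $ a" "join_vec v w $ Inr b = w $ b"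
  by (simp_all add: join_vec_def)

lemma inner_join_vec: "join_vec v w \<bullet> join_vec v' w' = v \<bullet> v' + w \<bullet> w'"
  by (simp add: inner_vec_def sum_UNIV_Plus)

lemma norm_join_vec: "(norm (join_vec v w))\<^sup>2 = (norm v)\<^sup>2 + (norm w)\<^sup>2"
  by (simp add: power2_norm_eq_inner inner_join_vec)

lemma block_diag_mult_join_vec: "block_mat P 0 0 S *v join_vec v w = join_vec (P *v v) (S *v w)"
proof -
  have "(block_mat P 0 0 S *v join_vec v w) $ i = join_vec (P *v v) (S *v w) $ i" for i
    by (cases i) (simp_all add: block_mat_def matrix_vector_mult_def sum_UNIV_Plus)
  then show ?thesis by (simp add: vec_eq_iff)
qed

lemma outer_mult: "outer v w *v y = (w \<bullet> y) *\<^sub>R v"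
  by (simp add: outer_def vec_eq_iff matrix_vector_mult_def inner_vec_def sum_distrib_left mult_ac)

lemma has_vector_derivative_join_vec:
  assumes "(f has_vector_derivative f') (at x within S)" "(g has_vector_derivative g') (at x within S)"
  shows "((\<lambda>x. join_vec (f x) (g x)) has_vector_derivative join_vec f' g') (at x within S)"
proof (rule has_vector_derivative_vecI)
  fix i
  show "((\<lambda>x. join_vec (f x) (g x) $ i) has_real_derivative join_vec f' g' $ i) (at x within S)"
    using bounded_linear.has_vector_derivative[OF bounded_linear_vec_nth assms(1)]
      bounded_linear.has_vector_derivative[OF bounded_linear_vec_nth assms(2)]
    by (cases i) (simp_all add: has_real_derivative_iff_has_vector_derivative)
qed

lemma Dx_DERIV:
  assumes "(\<lambda>y. u y t) differentiable (at x within {0..1})"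
  shows "((\<lambda>y. u y t) has_real_derivative Dx u x t) (at x within {0..1})"
  using assms unfolding Dx_def has_real_derivative_iff_has_vector_derivative
  by (simp add: vector_derivative_works)

lemma DERIV_interior:
  fixes f :: "real \<Rightarrow> real"
  assumes "(f has_real_derivative d) (at x within {0..1})" "0 < x" "x < 1"
  shows "(f has_real_derivative d) (at x)"
  using assms at_within_interior[of x "{0..1::real}"] by simp

lemma profile_inner_DERIV:
  "((\<lambda>x. profile q M r j x \<bullet> z) has_real_derivative profile q M r (Suc j) x \<bullet> z) (at x within S)"
  unfolding has_real_derivative_iff_has_vector_derivative
  by (rule bounded_linear.has_vector_derivative[OF bounded_linear_inner_left profile_has_vector_derivative])

text \<open>The differential equation of the profile, in the form in which it enters the time derivative
  of the transformed error.\<close>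

lemma inner_mult_profile:
  assumes "q \<noteq> 0"
  shows "profile q M r 0 x \<bullet> (M *v y) = q * (profile q M r 2 x \<bullet> y)"
proof -
  have "profile q M r 2 x = (1 / q) *\<^sub>R (profile q M r 0 x v* M)"
    using profile_second_derivative[of q M r x]
    by (simp add: numeral_2_eq_2 vec_eq_iff vector_matrix_mult_def sum_divide_distrib)
  then show ?thesis using assms by (simp add: dot_lmul_matrix)
qed

lemma profile_inner_H_sp: "(\<lambda>x. profile q M r 0 x \<bullet> z) \<in> H_sp k"
  using weak_chain_imp_H_sp[OF profile_inner_chain] .

lemma norm_le_norm_join_vec: "norm v \<le> norm (join_vec v w)" "norm w \<le> norm (join_vec v w)"
  by (rule power2_le_imp_le; simp add: norm_join_vec)+

lemma correction_H_norm_bound: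
  obtains \<kappa> where "0 \<le> \<kappa>"
    and "\<And>z y. H_norm k (\<lambda>x. vtheta q abar x \<bullet> z + theta q A C_X x \<bullet> y) \<le> \<kappa> * norm (join_vec z y)"
proof -
  obtain K1 where "0 \<le> K1" and K1: "\<And>z. H_norm k (\<lambda>x. vtheta q abar x \<bullet> z) \<le> K1 * norm z"
    unfolding vtheta_eq_profile using profile_inner_H_norm_bound by blast
  obtain K2 where "0 \<le> K2" and K2: "\<And>y. H_norm k (\<lambda>x. theta q A C_X x \<bullet> y) \<le> K2 * norm y"
    unfolding theta_eq_profile using profile_inner_H_norm_bound by blast
  have "H_norm k (\<lambda>x. vtheta q abar x \<bullet> z + theta q A C_X x \<bullet> y) \<le> (K1 + K2) * norm (join_vec z y)" for z y
  proof -
    have "(\<lambda>x. vtheta q abar x \<bullet> z) \<in> H_sp k" "(\<lambda>x. theta q A C_X x \<bullet> y) \<in> H_sp k"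
      unfolding vtheta_eq_profile theta_eq_profile by (rule profile_inner_H_sp)+
    from H_norm_lincomb_le[OF this, of 1 1]
    have "H_norm k (\<lambda>x. vtheta q abar x \<bullet> z + theta q A C_X x \<bullet> y) \<le> K1 * norm z + K2 * norm y"
      using K1[of z] K2[of y] by simp
    also have "\<dots> \<le> K1 * norm (join_vec z y) + K2 * norm (join_vec z y)"
      using \<open>0 \<le> K1\<close> \<open>0 \<le> K2\<close> by (intro add_mono mult_left_mono norm_le_norm_join_vec)
    finally show ?thesis by (simp add: distrib_right)
  qed
  then show ?thesis using that[of "K1 + K2"] \<open>0 \<le> K1\<close> \<open>0 \<le> K2\<close> by simp
qed

text \<open>A pair of solutions of plant and observer that share the input \<open>U\<close>. The constants of the final
  estimate are fixed outside this context, since they must not depend on the pair.\<close>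

locale observer_error =
  fixes q :: real and A :: "real^'n^'n" and B C_X P0 :: "real^'n"
    and abar P2 :: "real^'m::{finite,linorder}"
    and U :: "real \<Rightarrow> real" and X Xh :: "real \<Rightarrow> real^'n" and u uh :: "real \<Rightarrow> real \<Rightarrow> real"
    and Z Zh :: "real \<Rightarrow> real^'m::{finite,linorder}"
  assumes q: "q > 0"
    and inv_z: "invertible (G_mat q (companion abar))"
    and inv_x: "invertible (G_mat q A)"
    and plant: "plant_solution q A B C_X abar U X u Z"
    and observer: "observer_solution q A B C_X abar P2 P0 U (Dx u 0) Xh uh Zh"
begin

definition ue :: "real \<Rightarrow> real \<Rightarrow> real" where "ue = (\<lambda>x t. u x t - uh x t)"
definition Xe :: "real \<Rightarrow> real^'n" where "Xe = (\<lambda>t. X t - Xh t)"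
definition Ze :: "real \<Rightarrow> real^('m::{finite,linorder})" where "Ze = (\<lambda>t. Z t - Zh t)"
text \<open>The measured error \<open>v\<^sub>x(0,t)\<close> that is fed back into the observer.\<close>

definition innovation :: "real \<Rightarrow> real" where "innovation t = Dx u 0 t - Dx uh 0 t"

abbreviation vth :: "nat \<Rightarrow> real \<Rightarrow> real^('m::{finite,linorder})" where
  "vth \<equiv> profile q (companion abar) (join_vec 0 (- (C_z v* matrix_inv (G_mat q (companion abar)))))"

abbreviation th :: "nat \<Rightarrow> real \<Rightarrow> real^'n" where
  "th \<equiv> profile q A (join_vec (- C_X)
     (C_X v* (transpose col_I0 ** mexp (F_mat q A) ** col_I0) v* matrix_inv (G_mat q A)))"

text \<open>The transformed error, whose equation no longer involves the ODE states.\<close>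

definition w :: "real \<Rightarrow> real \<Rightarrow> real" where
  "w x t = ue x t + vth 0 x \<bullet> Ze t + th 0 x \<bullet> Xe t"

definition wx :: "real \<Rightarrow> real \<Rightarrow> real" where
  "wx x t = Dx u x t - Dx uh x t + vth 1 x \<bullet> Ze t + th 1 x \<bullet> Xe t"

definition wxx :: "real \<Rightarrow> real \<Rightarrow> real" where
  "wxx x t = Dx (Dx u) x t - Dx (Dx uh) x t + vth 2 x \<bullet> Ze t + th 2 x \<bullet> Xe t"

lemma H_curves: "H_curve (2 * CARD('m)) u" "H_curve (2 * CARD('m)) uh"
  using plant observer by (auto simp: plant_solution_def observer_solution_def)

lemma Dx_at:
  assumes "0 \<le> t" "x \<in> {0..1}"
  shows "((\<lambda>y. u y t) has_real_derivative Dx u x t) (at x within {0..1})"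
    "((\<lambda>y. uh y t) has_real_derivative Dx uh x t) (at x within {0..1})"
  using H_curves assms by (auto simp: H_curve_def intro!: Dx_DERIV)

lemma Ze_derivative:
  assumes "0 \<le> t"
  shows "(Ze has_vector_derivative (companion abar *v Ze t - innovation t *\<^sub>R P2)) (at t within {0..})"
proof -
  have "(Z has_vector_derivative (companion abar *v Z t + U t *\<^sub>R B_z)) (at t within {0..})"
    "(Zh has_vector_derivative
        (companion abar *v Zh t + U t *\<^sub>R B_z + (Dx u 0 t - Dx uh 0 t) *\<^sub>R P2)) (at t within {0..})"
    using plant observer assms by (auto simp: plant_solution_def observer_solution_def)
  from has_vector_derivative_diff[OF this] show ?thesis
    by (simp add: Ze_def innovation_def matrix_vector_mult_diff_distrib algebra_simps)
qed

lemma Xe_derivative: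
  assumes "0 \<le> t"
  shows "(Xe has_vector_derivative (A *v Xe t - innovation t *\<^sub>R P0)) (at t within {0..})"
proof -
  have "(X has_vector_derivative (A *v X t + Dx u 0 t *\<^sub>R B)) (at t within {0..})"
    "(Xh has_vector_derivative
        (A *v Xh t + Dx u 0 t *\<^sub>R B + (Dx u 0 t - Dx uh 0 t) *\<^sub>R P0)) (at t within {0..})"
    using plant observer assms by (auto simp: plant_solution_def observer_solution_def)
  from has_vector_derivative_diff[OF this] show ?thesis
    by (simp add: Xe_def innovation_def matrix_vector_mult_diff_distrib algebra_simps)
qed

lemma Ze_continuous: "continuous_on {0..} Ze"
  and Xe_continuous: "continuous_on {0..} Xe"
  by (auto simp: continuous_on_eq_continuous_within
      intro: has_vector_derivative_continuous Ze_derivative Xe_derivative)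

lemma at_within_halfline: "0 < t \<Longrightarrow> at t within {0..} = at (t::real)"
  by (rule at_within_interior) simp

lemma p1_eq: "p1 q A C_X abar P2 P0 x = - (vth 0 x \<bullet> P2) - th 0 x \<bullet> P0"
  by (simp add: p1_def vtheta_eq_profile theta_eq_profile)

sublocale heat: dirichlet_heat q w wx wxx
proof
  show "q > 0" by (rule q)
  show "continuous_on ({0..1} \<times> {0..}) (\<lambda>(x, t). w x t)"
  proof -
    have uc: "continuous_on ({0..1} \<times> {0..}) (\<lambda>(x, t). u x t)"
      "continuous_on ({0..1} \<times> {0..}) (\<lambda>(x, t). uh x t)"
      using H_curves by (auto simp: H_curve_def)
    have Zc: "continuous_on ({0..1::real} \<times> {0..}) (\<lambda>p. Ze (snd p))"
      and Xc: "continuous_on ({0..1::real} \<times> {0..}) (\<lambda>p. Xe (snd p))"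
      by (rule continuous_on_compose2[OF Ze_continuous] continuous_on_compose2[OF Xe_continuous];
          auto intro!: continuous_intros)+
    have pc: "continuous_on ({0..1::real} \<times> {0..}) (\<lambda>p :: real \<times> real. profile q' M r 0 (fst p))" for q' M r
      by (rule continuous_on_compose2[OF profile_continuous[of UNIV]]) (auto intro!: continuous_intros)
    have "continuous_on ({0..1} \<times> {0..})
        (\<lambda>p. (case p of (x, t) \<Rightarrow> u x t) - (case p of (x, t) \<Rightarrow> uh x t)
          + vth 0 (fst p) \<bullet> Ze (snd p) + th 0 (fst p) \<bullet> Xe (snd p))"
      by (intro continuous_on_add continuous_on_diff continuous_on_inner uc Zc Xc pc)
    then show ?thesis by (simp add: w_def ue_def split_beta)
  qed
next
  fix x t :: real assume x: "0 < x" "x < 1" and t: "0 < t"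
  have heat: "(\<lambda>y. Dx u y t) differentiable (at x)"
    "((\<lambda>s. u x s) has_real_derivative (q * Dx (Dx u) x t + 0)) (at t)"
    "(\<lambda>y. Dx uh y t) differentiable (at x)"
    "((\<lambda>s. uh x s) has_real_derivative (q * Dx (Dx uh) x t + p1 q A C_X abar P2 P0 x * innovation t)) (at t)"
    using plant observer x t
    by (auto simp: plant_solution_def observer_solution_def heat_eq_def innovation_def)
  have D1: "((\<lambda>y. u y t) has_real_derivative Dx u x t) (at x)"
    "((\<lambda>y. uh y t) has_real_derivative Dx uh x t) (at x)"
    using Dx_at[of t x] x t by (auto intro: DERIV_interior)
  have D2: "((\<lambda>y. Dx u y t) has_real_derivative Dx (Dx u) x t) (at x)"
    "((\<lambda>y. Dx uh y t) has_real_derivative Dx (Dx uh) x t) (at x)"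
    using heat(1,3) x by (auto intro!: DERIV_interior Dx_DERIV differentiable_at_withinI)
  show "((\<lambda>y. w y t) has_real_derivative wx x t) (at x)"
    unfolding w_def wx_def ue_def One_nat_def by (intro DERIV_add DERIV_diff D1 profile_inner_DERIV)
  show "((\<lambda>y. wx y t) has_real_derivative wxx x t) (at x)"
    unfolding wx_def wxx_def One_nat_def numeral_2_eq_2 by (intro DERIV_add DERIV_diff D2 profile_inner_DERIV)
  have Zd: "((\<lambda>s. vth 0 x \<bullet> Ze s) has_real_derivative
      vth 0 x \<bullet> (companion abar *v Ze t - innovation t *\<^sub>R P2)) (at t)"
    unfolding has_real_derivative_iff_has_vector_derivative
    using Ze_derivative[of t] t
    by (intro bounded_linear.has_vector_derivative[OF bounded_linear_inner_right]) (simp add: at_within_halfline)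
  have Xd: "((\<lambda>s. th 0 x \<bullet> Xe s) has_real_derivative
      th 0 x \<bullet> (A *v Xe t - innovation t *\<^sub>R P0)) (at t)"
    unfolding has_real_derivative_iff_has_vector_derivative
    using Xe_derivative[of t] t
    by (intro bounded_linear.has_vector_derivative[OF bounded_linear_inner_right]) (simp add: at_within_halfline)
  have "((\<lambda>s. w x s) has_real_derivative
      (q * Dx (Dx u) x t + 0) - (q * Dx (Dx uh) x t + p1 q A C_X abar P2 P0 x * innovation t)
      + vth 0 x \<bullet> (companion abar *v Ze t - innovation t *\<^sub>R P2)
      + th 0 x \<bullet> (A *v Xe t - innovation t *\<^sub>R P0)) (at t)"
    unfolding w_def ue_def by (intro DERIV_add DERIV_diff heat(2) heat(4) Zd Xd)
  also have "(q * Dx (Dx u) x t + 0) - (q * Dx (Dx uh) x t + p1 q A C_X abar P2 P0 x * innovation t)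
      + vth 0 x \<bullet> (companion abar *v Ze t - innovation t *\<^sub>R P2)
      + th 0 x \<bullet> (A *v Xe t - innovation t *\<^sub>R P0) = q * wxx x t"
    using q by (simp add: p1_eq wxx_def inner_diff_right inner_mult_profile algebra_simps)
  finally show "((\<lambda>s. w x s) has_real_derivative q * wxx x t) (at t)" .
next
  fix t :: real assume t: "0 \<le> t"
  have bc: "u 0 t = C_X \<bullet> X t" "u 1 t = C_z \<bullet> Z t" "uh 0 t = C_X \<bullet> Xh t" "uh 1 t = C_z \<bullet> Zh t"
    using plant observer t by (auto simp: plant_solution_def observer_solution_def)
  show "w 0 t = 0" "w 1 t = 0"
    using vtheta_boundary[OF inv_z] theta_boundary[OF inv_x, of C_X]
    by (simp_all add: w_def ue_def bc Xe_def Ze_def inner_diff_right vtheta_eq_profile theta_eq_profile)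
qed

lemma ue_H_sp: "0 \<le> t \<Longrightarrow> (\<lambda>x. ue x t) \<in> H_sp (2 * CARD('m))"
  using H_curves H_sp_lincomb[of "\<lambda>x. u x t" "2 * CARD('m)" "\<lambda>x. uh x t" 1 "-1"]
  by (simp add: H_curve_def ue_def)

lemma correction_H_sp: "(\<lambda>x. vth 0 x \<bullet> z + th 0 x \<bullet> y) \<in> H_sp k"
  using H_sp_lincomb[OF profile_inner_H_sp profile_inner_H_sp, where a = 1 and b = 1] by simp

lemma w_H_sp: "0 \<le> t \<Longrightarrow> (\<lambda>x. w x t) \<in> H_sp (2 * CARD('m))"
  using H_sp_lincomb[OF ue_H_sp correction_H_sp, of t 1 1 "Ze t" "Xe t"] by (simp add: w_def add.assoc)

definition Ye :: "real \<Rightarrow> real^('m::{finite,linorder} + 'n)" where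
  "Ye t = join_vec (Ze t) (Xe t)"

definition correction :: "real^('m::{finite,linorder}) \<Rightarrow> real^'n \<Rightarrow> real \<Rightarrow> real" where
  "correction z y x = vtheta q abar x \<bullet> z + theta q A C_X x \<bullet> y"

lemma correction_in_H_sp: "correction z y \<in> H_sp k"
  using correction_H_sp[of z y k] by (simp add: correction_def[abs_def] vtheta_eq_profile theta_eq_profile)

lemma w_eq_correction: "w x t = ue x t + correction (Ze t) (Xe t) x"
  by (simp add: w_def correction_def vtheta_eq_profile theta_eq_profile)

lemma H_norm_w_ue:
  assumes \<kappa>: "\<And>z y. H_norm (2 * CARD('m)) (correction z y) \<le> \<kappa> * norm (join_vec z y)" and t: "0 \<le> t"
  shows "H_norm (2 * CARD('m)) (\<lambda>x. w x t) \<le> H_norm (2 * CARD('m)) (\<lambda>x. ue x t) + \<kappa> * norm (Ye t)"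
    and "H_norm (2 * CARD('m)) (\<lambda>x. ue x t) \<le> H_norm (2 * CARD('m)) (\<lambda>x. w x t) + \<kappa> * norm (Ye t)"
proof -
  have "H_norm (2 * CARD('m)) (\<lambda>x. 1 * ue x t + 1 * correction (Ze t) (Xe t) x)
      \<le> \<bar>1\<bar> * H_norm (2 * CARD('m)) (\<lambda>x. ue x t) + \<bar>1\<bar> * H_norm (2 * CARD('m)) (correction (Ze t) (Xe t))"
    by (intro H_norm_lincomb_le ue_H_sp t correction_in_H_sp)
  then show "H_norm (2 * CARD('m)) (\<lambda>x. w x t) \<le> H_norm (2 * CARD('m)) (\<lambda>x. ue x t) + \<kappa> * norm (Ye t)"
    using \<kappa>[of "Ze t" "Xe t"] by (simp add: w_eq_correction Ye_def)
  have "H_norm (2 * CARD('m)) (\<lambda>x. 1 * w x t + (-1) * correction (Ze t) (Xe t) x)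
      \<le> \<bar>1\<bar> * H_norm (2 * CARD('m)) (\<lambda>x. w x t) + \<bar>-1\<bar> * H_norm (2 * CARD('m)) (correction (Ze t) (Xe t))"
    by (intro H_norm_lincomb_le w_H_sp t correction_in_H_sp)
  then show "H_norm (2 * CARD('m)) (\<lambda>x. ue x t) \<le> H_norm (2 * CARD('m)) (\<lambda>x. w x t) + \<kappa> * norm (Ye t)"
    using \<kappa>[of "Ze t" "Xe t"] by (simp add: w_eq_correction Ye_def)
qed

lemma join_vec_diff: "join_vec (v - v') (y - y') = join_vec v y - join_vec v' y'"
proof -
  have "join_vec (v - v') (y - y') $ i = (join_vec v y - join_vec v' y') $ i" for i by (cases i) simp_all
  then show ?thesis by (simp add: vec_eq_iff)
qed

lemma Ye_continuous: "continuous_on {0..} Ye"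
proof -
  have "(Ye has_vector_derivative join_vec (companion abar *v Ze t - innovation t *\<^sub>R P2) (A *v Xe t - innovation t *\<^sub>R P0))
      (at t within {0..})" if "0 \<le> t" for t
    unfolding Ye_def by (intro has_vector_derivative_join_vec Ze_derivative Xe_derivative that)
  then show ?thesis
    by (auto simp: continuous_on_eq_continuous_within intro: has_vector_derivative_continuous)
qed

text \<open>The continuity of plant and observer in the Sobolev norm is inherited by \<open>w\<close>, as the
  correction terms are continuous in time.\<close>

lemma w_continuous_at_0:
  assumes \<kappa>: "\<And>z y. H_norm (2 * CARD('m)) (correction z y) \<le> \<kappa> * norm (join_vec z y)"
  shows "((\<lambda>s. H_norm (2 * CARD('m)) (\<lambda>x. w x s - w x 0)) \<longlongrightarrow> 0) (at_right 0)"
proof -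
  let ?k = "2 * CARD('m)"
  let ?du = "\<lambda>s x. u x s - u x 0" and ?duh = "\<lambda>s x. uh x s - uh x 0"
  let ?b = "\<lambda>s. H_norm ?k (?du s) + H_norm ?k (?duh s) + \<kappa> * norm (Ye s - Ye 0)"
  have right: "at_right 0 \<le> at 0 within {0::real..}" by (rule at_le) auto
  have lim: "((\<lambda>s. H_norm ?k (?du s)) \<longlongrightarrow> 0) (at_right 0)" "((\<lambda>s. H_norm ?k (?duh s)) \<longlongrightarrow> 0) (at_right 0)"
    using H_curves by (auto simp: H_curve_def intro: tendsto_mono[OF right])
  have "(Ye \<longlongrightarrow> Ye 0) (at 0 within {0..})" using Ye_continuous by (auto simp: continuous_on_def)
  then have "((\<lambda>s. norm (Ye s - Ye 0)) \<longlongrightarrow> 0) (at_right 0)"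
    by (intro tendsto_norm_zero LIM_zero tendsto_mono[OF right])
  then have "(?b \<longlongrightarrow> 0 + 0 + \<kappa> * 0) (at_right 0)"
    by (intro tendsto_add lim tendsto_mult tendsto_const)
  then have b: "(?b \<longlongrightarrow> 0) (at_right 0)" by simp
  have le: "H_norm ?k (\<lambda>x. w x s - w x 0) \<le> ?b s" if "0 < s" for s
  proof -
    have uH: "(\<lambda>x. u x t) \<in> H_sp ?k" "(\<lambda>x. uh x t) \<in> H_sp ?k" if "0 \<le> t" for t
      using H_curves that by (auto simp: H_curve_def)
    have du: "?du s \<in> H_sp ?k" "?duh s \<in> H_sp ?k"
      using H_sp_lincomb[OF uH(1)[of s] uH(1)[of 0], of 1 "-1"] H_sp_lincomb[OF uH(2)[of s] uH(2)[of 0], of 1 "-1"] that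
      by simp_all
    have "(\<lambda>x. 1 * ?du s x + (-1) * ?duh s x) \<in> H_sp ?k" by (intro H_sp_lincomb du)
    then have "H_norm ?k (\<lambda>x. 1 * (1 * ?du s x + (-1) * ?duh s x) + 1 * correction (Ze s - Ze 0) (Xe s - Xe 0) x)
        \<le> \<bar>1\<bar> * H_norm ?k (\<lambda>x. 1 * ?du s x + (-1) * ?duh s x) + \<bar>1\<bar> * H_norm ?k (correction (Ze s - Ze 0) (Xe s - Xe 0))"
      by (intro H_norm_lincomb_le correction_in_H_sp)
    moreover have "H_norm ?k (\<lambda>x. 1 * ?du s x + (-1) * ?duh s x) \<le> \<bar>1\<bar> * H_norm ?k (?du s) + \<bar>-1\<bar> * H_norm ?k (?duh s)"
      by (intro H_norm_lincomb_le du)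
    moreover have "(\<lambda>x. 1 * (1 * ?du s x + (-1) * ?duh s x) + 1 * correction (Ze s - Ze 0) (Xe s - Xe 0) x)
        = (\<lambda>x. w x s - w x 0)"
      by (simp add: w_eq_correction ue_def correction_def inner_diff_right algebra_simps)
    ultimately show ?thesis
      using \<kappa>[of "Ze s - Ze 0" "Xe s - Xe 0"] by (simp add: join_vec_diff Ye_def)
  qed
  show ?thesis
    by (rule tendsto_sandwich[OF _ _ tendsto_const b])
       (auto simp: eventually_at_right_field H_norm_nonneg intro!: exI[of _ 1] le)
qed

text \<open>Differentiating the transformation at \<open>x = 0\<close>; the one-sided derivative of \<open>w\<close> is unique.\<close>

lemma flux_eq:
  assumes t: "0 < t"
  shows "heat.w_deriv t 1 0 = innovation t + B_a q A C_X abar \<bullet> Ye t"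
proof -
  have Ba: "B_a q A C_X abar = join_vec (vth 1 0) (th 1 0)"
    unfolding B_a_def vtheta_eq_profile theta_eq_profile One_nat_def
    by (simp only: vector_derivative_at[OF profile_has_vector_derivative])
  have "((\<lambda>x. w x t) has_real_derivative wx 0 t) (at 0 within {0..1})"
    unfolding w_def wx_def ue_def One_nat_def using t
    by (intro DERIV_add DERIV_diff Dx_at profile_inner_DERIV) auto
  moreover have "at 0 within {0..1::real} \<noteq> bot"
    by (simp add: at_within_Icc_at_right)
  ultimately have "heat.w_deriv t 1 0 = wx 0 t"
    using heat.w_DERIV_at_0[OF t] vector_derivative_unique_within
    unfolding has_real_derivative_iff_has_vector_derivative by blast
  then show ?thesis by (simp add: wx_def innovation_def Ba Ye_def inner_join_vec)
qed

text \<open>Replacing the measured error by \<open>w\<^sub>x(0,t) - B\<^sub>a Y\<close> turns the output injection into the Hurwitz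
  matrix and leaves the flux of \<open>w\<close> as forcing.\<close>

lemma Ye_derivative:
  assumes t: "0 < t"
  shows "(Ye has_vector_derivative
      ((A_a A abar + outer (join_vec P2 P0) (B_a q A C_X abar)) *v Ye t
        + (- heat.w_deriv t 1 0) *\<^sub>R join_vec P2 P0)) (at t)"
proof -
  have "(Ye has_vector_derivative join_vec (companion abar *v Ze t - innovation t *\<^sub>R P2) (A *v Xe t - innovation t *\<^sub>R P0)) (at t)"
    unfolding Ye_def using Ze_derivative[of t] Xe_derivative[of t] t
    by (intro has_vector_derivative_join_vec) (simp_all add: at_within_halfline)
  moreover have "join_vec (companion abar *v Ze t - innovation t *\<^sub>R P2) (A *v Xe t - innovation t *\<^sub>R P0)
      = A_a A abar *v Ye t - innovation t *\<^sub>R join_vec P2 P0"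
  proof -
    have "c *\<^sub>R join_vec P2 P0 = join_vec (c *\<^sub>R P2) (c *\<^sub>R P0)" for c
    proof -
      have "(c *\<^sub>R join_vec P2 P0) $ i = join_vec (c *\<^sub>R P2) (c *\<^sub>R P0) $ i" for i by (cases i) simp_all
      then show ?thesis by (simp add: vec_eq_iff)
    qed
    then show ?thesis by (simp add: join_vec_diff A_a_def Ye_def block_diag_mult_join_vec)
  qed
  moreover have "(A_a A abar + outer (join_vec P2 P0) (B_a q A C_X abar)) *v Ye t
        + (- heat.w_deriv t 1 0) *\<^sub>R join_vec P2 P0 = A_a A abar *v Ye t - innovation t *\<^sub>R join_vec P2 P0"
    unfolding flux_eq[OF t] by (simp add: matrix_vector_mult_add_rdistrib outer_mult algebra_simps)
  ultimately show ?thesis by simp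
qed

lemma Theta_e_square:
  "(Theta_e ue Ze Xe t)\<^sup>2 = (H_norm (2 * CARD('m)) (\<lambda>x. ue x t))\<^sup>2 + (norm (Ye t))\<^sup>2"
  by (simp add: Theta_e_def H_norm_def norm_join_vec Ye_def sum_nonneg)

lemma Theta_e_bounds:
  "H_norm (2 * CARD('m)) (\<lambda>x. ue x t) \<le> Theta_e ue Ze Xe t" "norm (Ye t) \<le> Theta_e ue Ze Xe t"
  "Theta_e ue Ze Xe t \<le> H_norm (2 * CARD('m)) (\<lambda>x. ue x t) + norm (Ye t)"
proof -
  have nn: "0 \<le> Theta_e ue Ze Xe t" by (simp add: Theta_e_def sum_nonneg)
  show "H_norm (2 * CARD('m)) (\<lambda>x. ue x t) \<le> Theta_e ue Ze Xe t" "norm (Ye t) \<le> Theta_e ue Ze Xe t"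
    by (rule power2_le_imp_le[OF _ nn]; simp add: Theta_e_square)+
  show "Theta_e ue Ze Xe t \<le> H_norm (2 * CARD('m)) (\<lambda>x. ue x t) + norm (Ye t)"
    by (rule power2_le_imp_le) (simp_all add: Theta_e_square power2_sum H_norm_nonneg)
qed

text \<open>The cascade: \<open>w\<close> decays by itself, hence so does the forcing of \<open>Y\<close>, hence \<open>Y\<close>, hence
  \<open>v = w - \<vartheta> Z - \<theta> X\<close>. The constant collects the two changes of variables at time \<open>0\<close> and at time \<open>t\<close>.\<close>

lemma Theta_e_decay:
  assumes "0 \<le> \<kappa>" and \<kappa>: "\<And>z y. H_norm (2 * CARD('m)) (correction z y) \<le> \<kappa> * norm (join_vec z y)"
    and "0 \<le> K" and b: "b \<le> q * pi\<^sup>2"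
    and decay: "\<And>y g C t. 0 \<le> C \<Longrightarrow> continuous_on {0..} y \<Longrightarrow>
      (\<And>t. 0 < t \<Longrightarrow> (y has_vector_derivative
        ((A_a A abar + outer (join_vec P2 P0) (B_a q A C_X abar)) *v y t + g t)) (at t)) \<Longrightarrow>
      (\<And>t. 0 < t \<Longrightarrow> norm (g t) \<le> C * exp (- (q * pi\<^sup>2) * t)) \<Longrightarrow> 0 \<le> t \<Longrightarrow>
      norm (y t) \<le> K * (norm (y 0) + C) * exp (- b * t)"
    and t: "0 \<le> t"
  shows "Theta_e ue Ze Xe t
    \<le> ((1 + \<kappa>) + (1 + \<kappa>) * (K * (1 + 2 * norm (join_vec P2 P0) * (1 + \<kappa>)))) * Theta_e ue Ze Xe 0 * exp (- b * t)"
proof -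
  let ?k = "2 * CARD('m)"
  define T where "T = Theta_e ue Ze Xe 0"
  define p where "p = norm (join_vec P2 P0)"
  define W where "W = H_norm ?k (\<lambda>x. w x 0)"
  have "0 \<le> W" by (simp add: W_def H_norm_nonneg)
  have "W \<le> T + \<kappa> * T"
    using H_norm_w_ue(1)[OF \<kappa> order_refl] Theta_e_bounds(1,2)[of 0]
      mult_left_mono[OF Theta_e_bounds(2)[of 0] \<open>0 \<le> \<kappa>\<close>] unfolding W_def T_def by linarith
  then have W: "W \<le> (1 + \<kappa>) * T" by (simp add: algebra_simps)
  have w_decay: "H_norm ?k (\<lambda>x. w x s) \<le> exp (- (q * pi\<^sup>2) * s) * W" if "0 \<le> s" for s
    unfolding W_def by (rule heat.H_norm_decay[OF w_H_sp w_continuous_at_0[OF \<kappa>] that])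
  have Y: "norm (Ye t) \<le> K * (norm (Ye 0) + 2 * p * W) * exp (- b * t)"
  proof (rule decay[OF _ Ye_continuous Ye_derivative _ t])
    show "0 \<le> 2 * p * W" using \<open>0 \<le> W\<close> by (simp add: p_def)
    fix s :: real assume s: "0 < s"
    \<comment> \<open>The trace estimate needs Sobolev order at least two.\<close>
    have k: "2 \<le> ?k" using zero_less_card_finite[where 'a = 'm] by linarith
    have "\<bar>heat.w_deriv s 1 0\<bar> \<le> 2 * (exp (- (q * pi\<^sup>2) * s) * W)"
      using heat.w_deriv_trace[OF s k] w_decay[OF less_imp_le[OF s]] by linarith
    then have "\<bar>heat.w_deriv s 1 0\<bar> * p \<le> 2 * (exp (- (q * pi\<^sup>2) * s) * W) * p"
      by (intro mult_right_mono) (simp_all add: p_def)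
    then show "norm ((- heat.w_deriv s 1 0) *\<^sub>R join_vec P2 P0) \<le> 2 * p * W * exp (- (q * pi\<^sup>2) * s)"
      by (simp add: p_def mult_ac)
  qed
  have "norm (Ye 0) + 2 * p * W \<le> T + 2 * p * ((1 + \<kappa>) * T)"
    using Theta_e_bounds(2)[of 0] W by (intro add_mono mult_left_mono) (simp_all add: T_def p_def)
  then have "norm (Ye 0) + 2 * p * W \<le> (1 + 2 * p * (1 + \<kappa>)) * T" by (simp add: algebra_simps)
  then have "K * (norm (Ye 0) + 2 * p * W) \<le> K * ((1 + 2 * p * (1 + \<kappa>)) * T)"
    using \<open>0 \<le> K\<close> by (rule mult_left_mono)
  then have "K * (norm (Ye 0) + 2 * p * W) * exp (- b * t) \<le> K * ((1 + 2 * p * (1 + \<kappa>)) * T) * exp (- b * t)"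
    by (rule mult_right_mono) simp
  with Y have Y2: "norm (Ye t) \<le> K * ((1 + 2 * p * (1 + \<kappa>)) * T) * exp (- b * t)" by linarith
  have "exp (- (q * pi\<^sup>2) * t) \<le> exp (- b * t)" using b t by (simp add: mult_right_mono)
  then have "exp (- (q * pi\<^sup>2) * t) * W \<le> exp (- b * t) * ((1 + \<kappa>) * T)"
    using W \<open>0 \<le> W\<close> by (intro mult_mono) auto
  then have "H_norm ?k (\<lambda>x. w x t) \<le> exp (- b * t) * ((1 + \<kappa>) * T)"
    using w_decay[OF t] by linarith
  then have "Theta_e ue Ze Xe t \<le> exp (- b * t) * ((1 + \<kappa>) * T) + (1 + \<kappa>) * norm (Ye t)"
    using Theta_e_bounds(3)[of t] H_norm_w_ue(2)[OF \<kappa> t] by (simp add: distrib_right)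
  also have "\<dots> \<le> exp (- b * t) * ((1 + \<kappa>) * T) + (1 + \<kappa>) * (K * ((1 + 2 * p * (1 + \<kappa>)) * T) * exp (- b * t))"
    using Y2 \<open>0 \<le> \<kappa>\<close> by (intro add_left_mono mult_left_mono) auto
  also have "\<dots> = ((1 + \<kappa>) + (1 + \<kappa>) * (K * (1 + 2 * p * (1 + \<kappa>)))) * T * exp (- b * t)"
    by (simp only: distrib_right distrib_left mult_ac)
  finally show ?thesis by (simp only: T_def p_def)
qed

end

theorem theorem4:
  fixes A :: "real^'n^'n"
    and B C_X P0 :: "real^'n"
    and abar P2 :: "real^'m::{finite,linorder}"
    and q :: real
  assumes "q > 0"
    and "controllable A B"
    and "\<forall>k::nat. k \<ge> 1 \<longrightarrow> \<not> eigenvalue A (complex_of_real (- ((real k)\<^sup>2 * pi\<^sup>2)))"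
    and "\<forall>k::nat. k \<ge> 1 \<longrightarrow> \<not> eigenvalue (companion abar) (complex_of_real (- ((real k)\<^sup>2 * pi\<^sup>2)))"
    and "invertible (G_mat q (companion abar))"
    and "invertible (G_mat q A)"
    and "observable (A_a A abar) (B_a q A C_X abar)"
    and "hurwitz (A_a A abar + outer (join_vec P2 P0) (B_a q A C_X abar))"
  shows "\<exists>Ups>0. \<exists>lam>0. \<forall>U X u Z Xh uh Zh.
           plant_solution q A B C_X abar U X u Z \<longrightarrow>
           observer_solution q A B C_X abar P2 P0 U (Dx u 0) Xh uh Zh \<longrightarrow>
           (\<lambda>x. uh x 0) \<in> H_sp (2 * CARD('m)) \<longrightarrow>
           (\<lambda>x. u x 0) \<in> H_sp (2 * CARD('m)) \<longrightarrow>
           (let ue = (\<lambda>x t. u x t - uh x t);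
                Xe = (\<lambda>t. X t - Xh t);
                Ze = (\<lambda>t. Z t - Zh t)
            in \<forall>t\<ge>0. Theta_e ue Ze Xe t
                 \<le> Ups * sqrt ((Theta_e ue Ze Xe 0)\<^sup>2 + (Dx ue 0 0)\<^sup>2) * exp (- lam * t))"
proof -
  obtain \<kappa> where "0 \<le> \<kappa>" and \<kappa>: "\<And>z y. H_norm (2 * CARD('m))
      (\<lambda>x. vtheta q abar x \<bullet> z + theta q A C_X x \<bullet> y) \<le> \<kappa> * norm (join_vec z y)"
    using correction_H_norm_bound[of "2 * CARD('m)" q abar A C_X] by blast
  have "0 < q * pi\<^sup>2" using \<open>q > 0\<close> by simp
  from hurwitz_decay[OF assms(8) this] obtain K b where K: "0 \<le> K" "0 < b" "b \<le> q * pi\<^sup>2"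
    and decay: "\<And>y g C t. 0 \<le> C \<Longrightarrow> continuous_on {0..} y \<Longrightarrow>
      (\<And>t. 0 < t \<Longrightarrow> (y has_vector_derivative
        ((A_a A abar + outer (join_vec P2 P0) (B_a q A C_X abar)) *v y t + g t)) (at t)) \<Longrightarrow>
      (\<And>t. 0 < t \<Longrightarrow> norm (g t) \<le> C * exp (- (q * pi\<^sup>2) * t)) \<Longrightarrow> 0 \<le> t \<Longrightarrow>
      norm (y t) \<le> K * (norm (y 0) + C) * exp (- b * t)"
    by metis
  define Ups where "Ups = (1 + \<kappa>) + (1 + \<kappa>) * (K * (1 + 2 * norm (join_vec P2 P0) * (1 + \<kappa>)))"
  have "0 \<le> (1 + \<kappa>) * (K * (1 + 2 * norm (join_vec P2 P0) * (1 + \<kappa>)))"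
    using \<open>0 \<le> \<kappa>\<close> K(1) by (intro mult_nonneg_nonneg add_nonneg_nonneg) auto
  then have "0 < Ups" using \<open>0 \<le> \<kappa>\<close> unfolding Ups_def by linarith
  show ?thesis
  proof (rule exI[of _ Ups], rule conjI[OF \<open>0 < Ups\<close>], rule exI[of _ b], rule conjI[OF \<open>0 < b\<close>], intro allI impI)
    fix U X u Z Xh uh Zh
    assume "plant_solution q A B C_X abar U X u Z"
      and "observer_solution q A B C_X abar P2 P0 U (Dx u 0) Xh uh Zh"
    then interpret observer_error q A B C_X P0 abar P2 U X Xh u uh Z Zh
      using assms by unfold_locales
    have "Theta_e ue Ze Xe t \<le> Ups * sqrt ((Theta_e ue Ze Xe 0)\<^sup>2 + (Dx ue 0 0)\<^sup>2) * exp (- b * t)"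
      if t: "0 \<le> t" for t
    proof -
      have "Theta_e ue Ze Xe t \<le> Ups * Theta_e ue Ze Xe 0 * exp (- b * t)"
        unfolding Ups_def
        by (rule Theta_e_decay[OF \<open>0 \<le> \<kappa>\<close> _ K(1,3) decay t]) (simp_all add: correction_def[abs_def] \<kappa>)
      moreover have "Theta_e ue Ze Xe 0 \<le> sqrt ((Theta_e ue Ze Xe 0)\<^sup>2 + (Dx ue 0 0)\<^sup>2)"
        by (rule real_le_rsqrt) simp
      then have "Ups * Theta_e ue Ze Xe 0 * exp (- b * t)
          \<le> Ups * sqrt ((Theta_e ue Ze Xe 0)\<^sup>2 + (Dx ue 0 0)\<^sup>2) * exp (- b * t)"
        using \<open>0 < Ups\<close> by (intro mult_right_mono mult_left_mono) auto
      ultimately show ?thesis by linarith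
    qed
    then show "let ue = (\<lambda>x t. u x t - uh x t); Xe = (\<lambda>t. X t - Xh t); Ze = (\<lambda>t. Z t - Zh t)
        in \<forall>t\<ge>0. Theta_e ue Ze Xe t
          \<le> Ups * sqrt ((Theta_e ue Ze Xe 0)\<^sup>2 + (Dx ue 0 0)\<^sup>2) * exp (- b * t)"
      by (simp add: ue_def Ze_def Xe_def Let_def)
  qed
qed

end
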